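(* Suppose $m<p$. An irreducible highest weight module $V_p^\lambda\otimes V_{m|n}^\lambda$ of $gl(p)\times gl(m|n)$ appears in $\mathbb{C}[\mathbf{x},\boldsymbol{\eta}]$ if and only if $\lambda$ is a Young diagram of length not exceeding $p$ with $\lambda_{m+1}\le n$. Furthermore, a highest weight vector associated to such a $\lambda$ is given by $$\prod_{k=1}^r\Delta_{k,\lambda'_k}\prod_{j=r+1}^t\Delta_{\lambda'_j},$$ where $\lambda'_1\ge\cdots\ge\lambda'_t$ ($t=\lambda_1$) are the column lengths of $\lambda$ and $r$ is defined by $\lambda'_r>m$ and $\lambda'_{r+1}\le m$ (with $r=0$ if $\lambda'_1\le m$).
   Context: $\mathbb{C}[\mathbf{x},\boldsymbol{\eta}]$ is the polynomial superalgebra over $\mathbb{C}$ in even variables $x_l^i$ ($1\le i\le p$, $1\le l\le m$) and odd (anticommuting) variables $\eta_k^i$ ($1\le i\le p$, $1\le k\le n$). It is identified with the (super)symmetric algebra $S(\mathbb{C}^p\otimes\mathbb{C}^{m|n})$ via $x_l^i=e_l\otimes e^i$, $\eta_k^i=f_k\otimes e^i$, where $e^1,\ldots,e^p$ is the standard basis of $\mathbb{C}^p$ and $e_1,\ldots,e_m;f_1,\ldots,f_n$ the standard (even; odd) basis of $\mathbb{C}^{m|n}$, with the induced action of $gl(p)\times gl(m|n)$. The Cartan subalgebra of $gl(p)$ is spanned by $\sum_{j=1}^m x_j^i\frac{\partial}{\partial x_j^i}+\sum_{j=1}^n\eta_j^i\frac{\partial}{\partial\eta_j^i}$ ($1\le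 i\le p$), and that of $gl(m|n)$ by $\sum_{j=1}^p x_s^j\frac{\partial}{\partial x_s^j}$ ($1\le s\le m$) and $\sum_{j=1}^p\eta_k^j\frac{\partial}{\partial\eta_k^j}$ ($1\le k\le n$). The simple root vectors are: for $gl(p)$, $\sum_{j=1}^m x_j^{i-1}\frac{\partial}{\partial x_j^i}+\sum_{j=1}^n\eta_j^{i-1}\frac{\partial}{\partial\eta_j^i}$ ($1<i\le p$); for $gl(m|n)$, $\sum_{j=1}^p x_{s-1}^j\frac{\partial}{\partial x_s^j}$ ($1<s\le m$), $\sum_{j=1}^p\eta_{k-1}^j\frac{\partial}{\partial\eta_k^j}$ ($1<k\le n$), $\sum_{j=1}^p x_m^j\frac{\partial}{\partial\eta_1^j}$. A highest weight vector is a nonzero weight vector annihilated by all these simple root vectors. $V_p^\lambda$ is the irreducible $gl(p)$-module of highest weight $(\lambda_1,\ldots,\lambda_p)$ and $V_{m|n}^\lambda$ the irreducible $gl(m|n)$-module of highest weight $(\lambda_1,\ldots,\lambda_m;\langle\lambda'_1-m\rangle,\ldots,\langle\lambda'_n-m\rangle)$ (standard Borel), where $\lambda'$ is the transpose of $\lambda$ and $\langle l\rangle=\max(l,0)$. A vector is associated to $\lambda$ if it has these weights. For an $r\times r$ matrix with entries in a superalgebra, with $a_i^j$ in row $i$ and column $j$, $\det:=\sum_{\sigma\in S_r}\mathrm{sgn}(\sigma)\,a_1^{\sigma(1)}a_2^{\sigma(2)}\cdots a_r^{\sigma(r)}$ (factors in row order). For $1\le r\le\min(m,p)$, $\Delta_r$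 is the determinant of $(x_l^i)_{1\le i,l\le r}$. For $m\le r\le p$ and $1\le k\le n$, $\Delta_{k,r}$ is the determinant of the $r\times r$ matrix whose $l$-th row is $(x_l^1,\ldots,x_l^r)$ for $1\le l\le m$ and whose last $r-m$ rows are all equal to $(\eta_k^1,\ldots,\eta_k^r)$. Products $\prod_{k=1}^r$ are ordered with increasing $k$. *)

theory Defs
  imports Complex_Main "HOL-Library.Poly_Mapping" "HOL-Library.FSet" "HOL-Combinatorics.Permutations"
begin

section \<open>The polynomial superalgebra\<close>

text \<open>
  Variables are indexed from 1. The pair \<open>(i, l)\<close> stands for \<open>x_l^i\<close> among the even variables, and
  \<open>(i, k)\<close> for \<open>\<eta>_k^i\<close> among the odd ones. A monomial \<open>(\<alpha>, A)\<close> is the product of the even monomial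
  with exponents \<open>\<alpha>\<close> and of the odd variables in \<open>A\<close>, the latter multiplied in increasing
  lexicographic order. The type has infinitely many variables; \<open>superpolys p m n\<close> below cuts out
  the superalgebra in the variables with \<open>i \<le> p\<close>, \<open>l \<le> m\<close>, \<open>k \<le> n\<close>.
\<close>

type_synonym var = "nat \<times> nat"
type_synonym supermonom = "(var \<Rightarrow>\<^sub>0 nat) \<times> var fset"

datatype superpoly = Superpoly (coeffs: "supermonom \<Rightarrow>\<^sub>0 complex")

abbreviation coeff :: "superpoly \<Rightarrow> supermonom \<Rightarrow> complex" where
  "coeff f \<equiv> Poly_Mapping.lookup (coeffs f)"

abbreviation support :: "superpoly \<Rightarrow> supermonom set" where
  "support f \<equiv> Poly_Mapping.keys (coeffs f)"

lemma superpoly_eqI: "(\<And>k. coeff f k = coeff g k) \<Longrightarrow> f = g"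
  by (metis poly_mapping_eqI superpoly.expand)

instantiation superpoly :: ab_group_add
begin

definition "0 = Superpoly 0"
definition "f + g = Superpoly (coeffs f + coeffs g)"
definition "- f = Superpoly (- coeffs f)"
definition "f - g = Superpoly (coeffs f - coeffs g)"

instance
  by standard
    (simp_all add: zero_superpoly_def plus_superpoly_def uminus_superpoly_def minus_superpoly_def
      algebra_simps)

end

definition sscale :: "complex \<Rightarrow> superpoly \<Rightarrow> superpoly" where
  "sscale c f = Superpoly (Poly_Mapping.map ((*) c) (coeffs f))"

definition smonom :: "supermonom \<Rightarrow> superpoly" where
  "smonom k = Superpoly (Poly_Mapping.single k 1)"

lemma coeff_simps [simp]:
  "coeff 0 k = 0" "coeff (f + g) k = coeff f k + coeff g k"
  "coeff (- f) k = - coeff f k" "coeff (f - g) k = coeff f k - coeff g k"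
  "coeff (sscale c f) k = c * coeff f k"
  "coeff (smonom k') k = (if k' = k then 1 else 0)"
  by (simp_all add: zero_superpoly_def plus_superpoly_def uminus_superpoly_def
      minus_superpoly_def sscale_def smonom_def lookup_add lookup_minus Poly_Mapping.map.rep_eq
      lookup_single when_def)

lemma coeff_sum [simp]: "coeff (\<Sum>a\<in>S. g a) k = (\<Sum>a\<in>S. coeff (g a) k)"
  by (induction S rule: infinite_finite_induct) simp_all

lemma in_support_iff: "k \<in> support f \<longleftrightarrow> coeff f k \<noteq> 0"
  by (simp add: in_keys_iff)

definition lin_extend :: "(supermonom \<Rightarrow> superpoly) \<Rightarrow> superpoly \<Rightarrow> superpoly" where
  "lin_extend g f = (\<Sum>k\<in>support f. sscale (coeff f k) (g k))"

lemma lin_extend_superset: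
  assumes "finite S" "support f \<subseteq> S"
  shows "lin_extend g f = (\<Sum>k\<in>S. sscale (coeff f k) (g k))"
  unfolding lin_extend_def using assms
  by (intro sum.mono_neutral_left) (auto simp: in_support_iff intro!: superpoly_eqI)

lemma lin_extend_0 [simp]: "lin_extend g 0 = 0"
  by (simp add: lin_extend_def zero_superpoly_def)

lemma lin_extend_add: "lin_extend g (f + f') = lin_extend g f + lin_extend g f'"
proof -
  let ?S = "support f \<union> support f'"
  have "support (f + f') \<subseteq> ?S" by (auto simp: in_support_iff)
  then have "lin_extend g (f + f') = (\<Sum>k\<in>?S. sscale (coeff (f + f') k) (g k))"
    by (intro lin_extend_superset) auto
  also have "\<dots> = (\<Sum>k\<in>?S. sscale (coeff f k) (g k)) + (\<Sum>k\<in>?S. sscale (coeff f' k) (g k))"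
    by (rule superpoly_eqI) (simp add: sum.distrib algebra_simps)
  also have "\<dots> = lin_extend g f + lin_extend g f'"
    by (simp add: lin_extend_superset[of ?S])
  finally show ?thesis .
qed

lemma lin_extend_sscale: "lin_extend g (sscale c f) = sscale c (lin_extend g f)"
proof -
  have "support (sscale c f) \<subseteq> support f" by (auto simp: in_support_iff)
  then have "lin_extend g (sscale c f) = (\<Sum>k\<in>support f. sscale (coeff (sscale c f) k) (g k))"
    by (intro lin_extend_superset) auto
  then show ?thesis
    by (intro superpoly_eqI) (simp add: lin_extend_def sum_distrib_left mult.assoc)
qed

lemma lin_extend_smonom [simp]: "lin_extend g (smonom k) = g k"
  by (rule superpoly_eqI) (simp add: lin_extend_superset[of "{k}"] subset_iff in_support_iff)

lemma lin_extend_fun_add: "lin_extend (\<lambda>a. g a + h a) f = lin_extend g f + lin_extend h f"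
  by (rule superpoly_eqI) (simp add: lin_extend_def sum.distrib algebra_simps)

lemma lin_extend_fun_sscale: "lin_extend (\<lambda>a. sscale c (g a)) f = sscale c (lin_extend g f)"
  by (rule superpoly_eqI) (simp add: lin_extend_def sum_distrib_left mult.left_commute)

lemma lin_extend_fun_0 [simp]: "lin_extend (\<lambda>a. 0) f = 0"
  by (rule superpoly_eqI) (simp add: lin_extend_def)

lemma lin_extend_id: "lin_extend smonom f = f"
  by (rule superpoly_eqI) (simp add: lin_extend_def in_support_iff if_distrib sum.If_cases
      sum.delta cong: if_cong)

lemma superpoly_induct [case_names zero monom add]:
  assumes "P 0" "\<And>c k. P (sscale c (smonom k))" "\<And>f g. P f \<Longrightarrow> P g \<Longrightarrow> P (f + g)"
  shows "P f"
proof -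
  have "P (\<Sum>k\<in>S. sscale (coeff f k) (smonom k))" for S
    by (induction S rule: infinite_finite_induct) (simp_all add: assms)
  then show ?thesis
    using lin_extend_id[of f] unfolding lin_extend_def by metis
qed

definition var_less :: "var \<Rightarrow> var \<Rightarrow> bool" where
  "var_less v w \<longleftrightarrow> fst v < fst w \<or> fst v = fst w \<and> snd v < snd w"

definition inversions :: "var fset \<Rightarrow> var fset \<Rightarrow> nat" where
  "inversions A B = card {(a, b). a |\<in>| A \<and> b |\<in>| B \<and> var_less b a}"

definition monom_times :: "supermonom \<Rightarrow> supermonom \<Rightarrow> superpoly" where
  "monom_times k k' =
    (if snd k |\<inter>| snd k' = {||}
     then sscale ((-1) ^ inversions (snd k) (snd k')) (smonom (fst k + fst k', snd k |\<union>| snd k'))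
     else 0)"

lemma finite_inversions: "finite {(a, b). a |\<in>| A \<and> b |\<in>| B \<and> var_less b a}"
  by (rule finite_subset[of _ "fset A \<times> fset B"]) auto

lemma inversions_union_left:
  assumes "A |\<inter>| B = {||}"
  shows "inversions (A |\<union>| B) C = inversions A C + inversions B C"
proof -
  have "{(a, b). a |\<in>| A |\<union>| B \<and> b |\<in>| C \<and> var_less b a} =
    {(a, b). a |\<in>| A \<and> b |\<in>| C \<and> var_less b a} \<union> {(a, b). a |\<in>| B \<and> b |\<in>| C \<and> var_less b a}"
    by auto
  moreover have "{(a, b). a |\<in>| A \<and> b |\<in>| C \<and> var_less b a} \<inter>
      {(a, b). a |\<in>| B \<and> b |\<in>| C \<and> var_less b a} = {}"
    using assms by fastforce
  ultimately show ?thesis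
    by (simp add: inversions_def card_Un_disjoint finite_inversions)
qed

lemma inversions_union_right:
  assumes "A |\<inter>| B = {||}"
  shows "inversions C (A |\<union>| B) = inversions C A + inversions C B"
proof -
  have "{(a, b). a |\<in>| C \<and> b |\<in>| A |\<union>| B \<and> var_less b a} =
    {(a, b). a |\<in>| C \<and> b |\<in>| A \<and> var_less b a} \<union> {(a, b). a |\<in>| C \<and> b |\<in>| B \<and> var_less b a}"
    by auto
  moreover have "{(a, b). a |\<in>| C \<and> b |\<in>| A \<and> var_less b a} \<inter>
      {(a, b). a |\<in>| C \<and> b |\<in>| B \<and> var_less b a} = {}"
    using assms by fastforce
  ultimately show ?thesis
    by (simp add: inversions_def card_Un_disjoint finite_inversions)
qed

lemma inversions_empty [simp]: "inversions {||} A = 0" "inversions A {||} = 0"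
  by (simp_all add: inversions_def)

instantiation superpoly :: ring_1
begin

definition "1 = smonom (0, {||})"
definition "f * g = lin_extend (\<lambda>a. lin_extend (monom_times a) g) f"

lemma superpoly_distrib:
  fixes f g h :: superpoly
  shows "(f + g) * h = f * h + g * h" "f * (g + h) = f * g + f * h"
  by (simp_all add: times_superpoly_def lin_extend_add lin_extend_fun_add)

lemma superpoly_mult_sscale:
  fixes f g :: superpoly
  shows "sscale c f * g = sscale c (f * g)" "f * sscale c g = sscale c (f * g)"
  by (simp_all add: times_superpoly_def lin_extend_sscale lin_extend_fun_sscale)

lemma superpoly_mult_0:
  fixes f :: superpoly
  shows "0 * f = 0" "f * 0 = 0"
  by (simp_all add: times_superpoly_def)

lemma smonom_mult: "smonom a * smonom b = monom_times a b"
  by (simp add: times_superpoly_def)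

lemma sscale_sscale: "sscale c (sscale d f) = sscale (c * d) f"
  by (rule superpoly_eqI) (simp add: mult.assoc)

lemma smonom_assoc: "(smonom a * smonom b) * smonom c = smonom a * (smonom b * smonom c)"
proof -
  obtain \<alpha> A \<beta> B \<gamma> C where [simp]: "a = (\<alpha>, A)" "b = (\<beta>, B)" "c = (\<gamma>, C)"
    by (metis surj_pair)
  consider "A |\<inter>| B = {||}" "A |\<inter>| C = {||}" "B |\<inter>| C = {||}"
    | "A |\<inter>| B \<noteq> {||} \<or> A |\<inter>| C \<noteq> {||} \<or> B |\<inter>| C \<noteq> {||}" by blast
  then show ?thesis
  proof cases
    case 1
    then have "(A |\<union>| B) |\<inter>| C = {||}" "A |\<inter>| (B |\<union>| C) = {||}"
      by (simp_all add: inf_sup_distrib1 inf_sup_distrib2)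
    with 1 show ?thesis
      by (simp add: smonom_mult monom_times_def superpoly_mult_sscale sscale_sscale
          inversions_union_left inversions_union_right power_add add.assoc sup_assoc mult_ac)
  next
    case 2
    then show ?thesis
      by (auto simp add: smonom_mult monom_times_def superpoly_mult_sscale superpoly_mult_0
          inf_sup_distrib1 inf_sup_distrib2 intro!: superpoly_eqI)
  qed
qed

instance
proof
  fix f g h :: superpoly
  show "(f * g) * h = f * (g * h)"
  proof (induction f rule: superpoly_induct)
    case (monom c a)
    have "(smonom a * g) * h = smonom a * (g * h)"
    proof (induction g rule: superpoly_induct)
      case (monom d b)
      have "(smonom a * smonom b) * h = smonom a * (smonom b * h)"
      proof (induction h rule: superpoly_induct)
        case (monom e k)
        show ?case by (simp add: superpoly_mult_sscale smonom_assoc)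
      qed (simp_all add: superpoly_mult_0 superpoly_distrib)
      then show ?case by (simp add: superpoly_mult_sscale)
    qed (simp_all add: superpoly_mult_0 superpoly_distrib)
    then show ?case by (simp add: superpoly_mult_sscale)
  qed (simp_all add: superpoly_mult_0 superpoly_distrib)
  show "(f + g) * h = f * h + g * h" "f * (g + h) = f * g + f * h"
    by (fact superpoly_distrib)+
  show "1 * f = f"
    by (induction f rule: superpoly_induct)
      (simp_all add: one_superpoly_def superpoly_mult_0 superpoly_distrib superpoly_mult_sscale
        smonom_mult monom_times_def superpoly_eqI)
  show "f * 1 = f"
    by (induction f rule: superpoly_induct)
      (simp_all add: one_superpoly_def superpoly_mult_0 superpoly_distrib superpoly_mult_sscale
        smonom_mult monom_times_def superpoly_eqI)
  have "coeff (0 :: superpoly) (0, {||}) \<noteq> coeff 1 (0, {||})"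
    by (simp add: one_superpoly_def)
  then show "(0 :: superpoly) \<noteq> 1" by metis
qed

end

definition xvar :: "nat \<Rightarrow> nat \<Rightarrow> superpoly" where
  "xvar i l = smonom (Poly_Mapping.single (i, l) 1, {||})"

definition etavar :: "nat \<Rightarrow> nat \<Rightarrow> superpoly" where
  "etavar i k = smonom (0, {|(i, k)|})"

definition xder :: "nat \<Rightarrow> nat \<Rightarrow> superpoly \<Rightarrow> superpoly" where
  "xder i l = lin_extend (\<lambda>(\<alpha>, A).
     sscale (of_nat (Poly_Mapping.lookup \<alpha> (i, l))) (smonom (\<alpha> - Poly_Mapping.single (i, l) 1, A)))"

text \<open>The left derivative: the variable is moved to the front of the odd monomial and removed.\<close>

definition etader :: "nat \<Rightarrow> nat \<Rightarrow> superpoly \<Rightarrow> superpoly" where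
  "etader i k = lin_extend (\<lambda>(\<alpha>, A).
     if (i, k) |\<in>| A
     then sscale ((-1) ^ card {a. a |\<in>| A \<and> var_less a (i, k)}) (smonom (\<alpha>, A |-| {|(i, k)|}))
     else 0)"

definition superpolys :: "nat \<Rightarrow> nat \<Rightarrow> nat \<Rightarrow> superpoly set" where
  "superpolys p m n = {f. \<forall>(\<alpha>, A) \<in> support f.
     Poly_Mapping.keys \<alpha> \<subseteq> {1..p} \<times> {1..m} \<and> fset A \<subseteq> {1..p} \<times> {1..n}}"

text \<open>Parities are booleans, with \<open>True\<close> for odd; the sum of two parities is \<open>\<noteq>\<close>.\<close>

definition superpolys_parity :: "nat \<Rightarrow> nat \<Rightarrow> nat \<Rightarrow> bool \<Rightarrow> superpoly set" where
  "superpolys_parity p m n s = {f \<in> superpolys p m n. \<forall>(\<alpha>, A) \<in> support f. odd (fcard A) = s}"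


section \<open>The actions of \<open>gl(p)\<close> and \<open>gl(m|n)\<close> on the polynomial superalgebra\<close>

definition glp_action :: "nat \<Rightarrow> nat \<Rightarrow> nat \<Rightarrow> nat \<Rightarrow> superpoly \<Rightarrow> superpoly" where
  "glp_action m n i j f =
     (\<Sum>l = 1..m. xvar i l * xder j l f) + (\<Sum>k = 1..n. etavar i k * etader j k f)"

text \<open>
  The standard basis \<open>e_1, \<dots>, e_m, f_1, \<dots>, f_n\<close> of \<open>\<complex>\<^sup>m\<^sup>|\<^sup>n\<close> is numbered \<open>1, \<dots>, m + n\<close>;
  \<open>zvar m a i\<close> is the variable given by its \<open>a\<close>-th vector tensored with \<open>e^i\<close>.
\<close>

definition zvar :: "nat \<Rightarrow> nat \<Rightarrow> nat \<Rightarrow> superpoly" where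
  "zvar m a i = (if a \<le> m then xvar i a else etavar i (a - m))"

definition zder :: "nat \<Rightarrow> nat \<Rightarrow> nat \<Rightarrow> superpoly \<Rightarrow> superpoly" where
  "zder m a i = (if a \<le> m then xder i a else etader i (a - m))"

definition glmn_action :: "nat \<Rightarrow> nat \<Rightarrow> nat \<Rightarrow> nat \<Rightarrow> superpoly \<Rightarrow> superpoly" where
  "glmn_action p m a b f = (\<Sum>j = 1..p. zvar m a j * zder m b j f)"


section \<open>Highest weight modules\<close>

text \<open>
  A \<open>gl(M|N)\<close>-module on the complex superspace \<open>'v\<close>, with homogeneous components \<open>G False\<close> (even)
  and \<open>G True\<close> (odd), is given by the operators \<open>\<rho> a b\<close> of the matrix units \<open>E_{ab}\<close>,
  \<open>1 \<le> a, b \<le> M + N\<close>. The parity of \<open>E_{ab}\<close> is \<open>(M < a) \<noteq> (M < b)\<close>, and the brackets are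
  \<open>[E_{ab}, E_{cd}] = \<delta>_{bc} E_{ad} - (-1)^{|E_{ab}| |E_{cd}|} \<delta>_{ad} E_{cb}\<close>.
  The Lie algebra \<open>gl(p)\<close> is treated as \<open>gl(p|0)\<close>, acting on purely even spaces.
\<close>

locale gl_supermodule = vector_space scale
  for scale :: "complex \<Rightarrow> 'v::ab_group_add \<Rightarrow> 'v" +
  fixes M N :: nat and G :: "bool \<Rightarrow> 'v set" and \<rho> :: "nat \<Rightarrow> nat \<Rightarrow> 'v \<Rightarrow> 'v"
  assumes subspace_G: "subspace (G s)"
    and direct_sum: "\<exists>!u. u \<in> G False \<and> v - u \<in> G True"
    and linear_action: "a \<in> {1..M + N} \<Longrightarrow> b \<in> {1..M + N} \<Longrightarrow>
      Vector_Spaces.linear scale scale (\<rho> a b)"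
    and parity_action: "a \<in> {1..M + N} \<Longrightarrow> b \<in> {1..M + N} \<Longrightarrow> v \<in> G s \<Longrightarrow>
      \<rho> a b v \<in> G (s \<noteq> ((M < a) \<noteq> (M < b)))"
    and superbracket:
      "a \<in> {1..M + N} \<Longrightarrow> b \<in> {1..M + N} \<Longrightarrow> c \<in> {1..M + N} \<Longrightarrow> d \<in> {1..M + N} \<Longrightarrow>
       \<epsilon> = (if (M < a) \<noteq> (M < b) \<and> (M < c) \<noteq> (M < d) then - 1 else 1) \<Longrightarrow>
       \<rho> a b (\<rho> c d v) - scale \<epsilon> (\<rho> c d (\<rho> a b v)) =
         (if b = c then \<rho> a d v else 0) - (if a = d then scale \<epsilon> (\<rho> c b v) else 0)"

locale irreducible_gl_supermodule = gl_supermodule scale M N G \<rho>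
  for scale :: "complex \<Rightarrow> 'v::ab_group_add \<Rightarrow> 'v" and M N G \<rho> +
  assumes nonzero: "\<exists>v :: 'v. v \<noteq> 0"
    and irreducible: "subspace U \<Longrightarrow> \<forall>u\<in>U. \<exists>u\<^sub>0\<in>U \<inter> G False. u - u\<^sub>0 \<in> G True \<Longrightarrow>
      \<forall>a\<in>{1..M + N}. \<forall>b\<in>{1..M + N}. \<rho> a b ` U \<subseteq> U \<Longrightarrow> U = {0} \<or> U = UNIV"

definition even_grading :: "bool \<Rightarrow> 'v::zero set" where
  "even_grading s = (if s then {0} else UNIV)"

text \<open>The weight is a sequence whose entry at \<open>a \<in> {1..M + N}\<close> is the eigenvalue of \<open>E_{aa}\<close>.\<close>

definition highest_weight_vector ::
  "(complex \<Rightarrow> 'v::ab_group_add \<Rightarrow> 'v) \<Rightarrow> nat \<Rightarrow> (nat \<Rightarrow> nat \<Rightarrow> 'v \<Rightarrow> 'v) \<Rightarrow> (nat \<Rightarrow> complex) \<Rightarrow> 'v \<Rightarrow> bool"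
  where
  "highest_weight_vector scale K \<rho> \<mu> v \<longleftrightarrow> v \<noteq> 0 \<and>
     (\<forall>a\<in>{1..K}. \<rho> a a v = scale (\<mu> a) v) \<and> (\<forall>a\<in>{2..K}. \<rho> (a - 1) a v = 0)"

definition irreducible_highest_weight_module ::
  "(complex \<Rightarrow> 'v::ab_group_add \<Rightarrow> 'v) \<Rightarrow> nat \<Rightarrow> nat \<Rightarrow> (bool \<Rightarrow> 'v set) \<Rightarrow>
   (nat \<Rightarrow> nat \<Rightarrow> 'v \<Rightarrow> 'v) \<Rightarrow> (nat \<Rightarrow> complex) \<Rightarrow> bool" where
  "irreducible_highest_weight_module scale M N G \<rho> \<mu> \<longleftrightarrow>
     irreducible_gl_supermodule scale M N G \<rho> \<and> (\<exists>v. highest_weight_vector scale (M + N) \<rho> \<mu> v)"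


section \<open>Young diagrams and the weights attached to them\<close>

text \<open>
  Sequences are indexed from 1, their entry at 0 being ignored. A highest weight is a complex
  sequence, and a Young diagram is one of a special kind. The transpose is only meaningful for the
  latter.
\<close>

definition young_diagram :: "(nat \<Rightarrow> complex) \<Rightarrow> bool" where
  "young_diagram lam \<longleftrightarrow>
     (\<forall>i\<ge>1. lam i \<in> \<nat> \<and> Re (lam (i + 1)) \<le> Re (lam i)) \<and>
     finite {i. 1 \<le> i \<and> lam i \<noteq> 0}"

definition diagram_length :: "(nat \<Rightarrow> complex) \<Rightarrow> nat" where
  "diagram_length lam = card {i. 1 \<le> i \<and> lam i \<noteq> 0}"

definition transpose_diagram :: "(nat \<Rightarrow> complex) \<Rightarrow> nat \<Rightarrow> nat" where
  "transpose_diagram lam j = card {i. 1 \<le> i \<and> real j \<le> Re (lam i)}"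

text \<open>Subtraction on \<open>nat\<close> is truncated, so \<open>\<lambda>'_k - m\<close> below is \<open>\<langle>\<lambda>'_k - m\<rangle>\<close>.\<close>

definition glmn_weight :: "nat \<Rightarrow> (nat \<Rightarrow> complex) \<Rightarrow> nat \<Rightarrow> complex" where
  "glmn_weight m lam a = (if a \<le> m then lam a else of_nat (transpose_diagram lam (a - m) - m))"

definition joint_highest_weight_vector ::
  "nat \<Rightarrow> nat \<Rightarrow> nat \<Rightarrow> (nat \<Rightarrow> complex) \<Rightarrow> superpoly \<Rightarrow> bool" where
  "joint_highest_weight_vector p m n lam f \<longleftrightarrow> f \<in> superpolys p m n \<and>
     highest_weight_vector sscale p (glp_action m n) lam f \<and>
     highest_weight_vector sscale (m + n) (glmn_action p m) (glmn_weight m lam) f"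


section \<open>Tensor products inside the polynomial superalgebra\<close>

text \<open>
  The tensor product of \<open>'v\<close> and \<open>'w\<close> is the quotient of the free vector space
  \<open>'v \<times> 'w \<Rightarrow>\<^sub>0 complex\<close> by the subspace \<open>tensor_relations\<close>.
\<close>

definition free_scale :: "complex \<Rightarrow> ('b \<Rightarrow>\<^sub>0 complex) \<Rightarrow> ('b \<Rightarrow>\<^sub>0 complex)" where
  "free_scale c t = Poly_Mapping.map ((*) c) t"

definition free_pair :: "'v \<Rightarrow> 'w \<Rightarrow> ('v \<times> 'w \<Rightarrow>\<^sub>0 complex)" where
  "free_pair v w = Poly_Mapping.single (v, w) 1"

definition tensor_relations ::
  "(complex \<Rightarrow> 'v::ab_group_add \<Rightarrow> 'v) \<Rightarrow> (complex \<Rightarrow> 'w::ab_group_add \<Rightarrow> 'w) \<Rightarrow>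
   ('v \<times> 'w \<Rightarrow>\<^sub>0 complex) set" where
  "tensor_relations sV sW = module.span free_scale
     ({free_pair (v + v') w - free_pair v w - free_pair v' w | v v' w. True} \<union>
      {free_pair v (w + w') - free_pair v w - free_pair v w' | v w w'. True} \<union>
      {free_pair (sV c v) w - free_scale c (free_pair v w) | c v w. True} \<union>
      {free_pair v (sW c w) - free_scale c (free_pair v w) | c v w. True})"

text \<open>
  The \<open>gl(p) \<times> gl(m|n)\<close>-module \<open>V \<otimes> W\<close> appears in the polynomial superalgebra if the latter has
  a submodule isomorphic to it. The isomorphism is given as a linear map on the free vector space
  whose kernel is \<open>tensor_relations\<close>. There are no signs in the action since \<open>V\<close> is purely even. The
  parity of the highest weight vector of \<open>W\<close> is not prescribed, so the isomorphism is even or odd,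
  according to \<open>t\<close>.
\<close>

definition tensor_appears ::
  "nat \<Rightarrow> nat \<Rightarrow> nat \<Rightarrow>
   (complex \<Rightarrow> 'v::ab_group_add \<Rightarrow> 'v) \<Rightarrow> (nat \<Rightarrow> nat \<Rightarrow> 'v \<Rightarrow> 'v) \<Rightarrow>
   (complex \<Rightarrow> 'w::ab_group_add \<Rightarrow> 'w) \<Rightarrow> (bool \<Rightarrow> 'w set) \<Rightarrow> (nat \<Rightarrow> nat \<Rightarrow> 'w \<Rightarrow> 'w) \<Rightarrow> bool" where
  "tensor_appears p m n sV \<rho>V sW GW \<rho>W \<longleftrightarrow>
     (\<exists>\<Phi>. Vector_Spaces.linear free_scale sscale \<Phi> \<and>
        range \<Phi> \<subseteq> superpolys p m n \<and>
        {z. \<Phi> z = 0} = tensor_relations sV sW \<and>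
        (\<exists>t. \<forall>s v. \<forall>w\<in>GW s. \<Phi> (free_pair v w) \<in> superpolys_parity p m n (s \<noteq> t)) \<and>
        (\<forall>i\<in>{1..p}. \<forall>j\<in>{1..p}. \<forall>v w.
           \<Phi> (free_pair (\<rho>V i j v) w) = glp_action m n i j (\<Phi> (free_pair v w))) \<and>
        (\<forall>a\<in>{1..m + n}. \<forall>b\<in>{1..m + n}. \<forall>v w.
           \<Phi> (free_pair v (\<rho>W a b w)) = glmn_action p m a b (\<Phi> (free_pair v w))))"


section \<open>The highest weight vectors\<close>

text \<open>\<open>A i j\<close> is the entry in row \<open>i\<close> and column \<open>j\<close>; the factors are multiplied in row order.\<close>

definition sdet :: "nat \<Rightarrow> (nat \<Rightarrow> nat \<Rightarrow> superpoly) \<Rightarrow> superpoly" where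
  "sdet r A = (\<Sum>\<sigma> | \<sigma> permutes {1..r}.
     of_int (sign \<sigma>) * prod_list (map (\<lambda>i. A i (\<sigma> i)) [1..<r + 1]))"

definition Delta :: "nat \<Rightarrow> superpoly" where
  "Delta r = sdet r (\<lambda>i l. xvar i l)"

definition DeltaOdd :: "nat \<Rightarrow> nat \<Rightarrow> nat \<Rightarrow> superpoly" where
  "DeltaOdd m k r = sdet r (\<lambda>l i. if l \<le> m then xvar i l else etavar i k)"

end

theory Submission
  imports Defs "HOL-Library.Product_Plus"
begin

text \<open>Both halves of the theorem are statements about joint highest weight vectors: \<open>V \<otimes> W\<close> occurs in the
  superalgebra if and only if the superalgebra contains a nonzero vector which has the two highest
  weights and is killed by the positive root vectors of \<open>gl(p)\<close> and of \<open>gl(m|n)\<close>.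

  What is needed about such vectors follows from one exchange argument, \<open>exists_diagonal_monomial\<close>.
  Let \<open>f\<close> be nonzero and killed by the positive root vectors of \<open>gl(p)\<close> and of \<open>gl(m)\<close>, and take a
  monomial of \<open>f\<close> in which the diagonal variables \<open>x_s^s\<close> have the largest total exponent. Then it
  contains no other even variable, since otherwise a root vector would exchange this variable for a
  diagonal one, and nothing could cancel the result. Now compare weights. The even part of the
  monomial accounts for the first \<open>m\<close> rows of \<open>\<lambda>\<close>, so its odd part lies in the rows below them,
  where there are \<open>n\<close> odd variables in each row and \<open>p - m\<close> in each column. Hence \<open>\<lambda>_{m+1} \<le> n\<close>, and
  \<open>\<lambda>\<close> has at most \<open>p\<close> rows (\<open>joint_highest_weight_is_hook\<close>). The same comparison shows that a vector
  with the weights of \<open>\<lambda>\<close> which is killed by the positive root vectors of \<open>gl(p)\<close> and of \<open>gl(m)\<close> is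
  killed by those of \<open>gl(m|n)\<close> too: its image under another one would have weights that no diagonal
  monomial can have (\<open>mixed_raising\<close>, \<open>odd_raising\<close>). For the product of determinants it is therefore
  enough to know the weights, the vanishing of determinants with two equal rows of even variables or
  two equal columns, and that it is not zero. The last point is seen by substituting the identity
  matrix for the even variables (\<open>product_of_determinants_nonzero\<close>).

  It remains to embed \<open>V \<otimes> W\<close> when a joint highest weight vector \<open>f\<^sub>0\<close> is given. The superalgebra has
  a positive definite Hermitian form for which \<open>E_{ab}\<close> and \<open>E_{ba}\<close> are adjoint. Let \<open>v\<^sub>0\<close> be the highest
  weight vector of \<open>V\<close> or of \<open>W\<close>, and \<open>x\<close> a noncommutative polynomial in the matrix units. The
  coefficient of \<open>v\<^sub>0\<close> in \<open>x v\<^sub>0\<close>, modulo lower weights, depends only on the highest weight. Together with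
  irreducibility of the abstract module on the one side and with the form on the other, this gives
  \<open>x v\<^sub>0 = 0\<close> if and only if \<open>x f\<^sub>0 = 0\<close> (\<open>act_eq_0_iff\<close>). So \<open>x v\<^sub>0 \<otimes> y w\<^sub>0 \<mapsto> x y f\<^sub>0\<close> is well defined. It is
  injective because the form on its image is the product of the forms on the two submodules
  generated by \<open>f\<^sub>0\<close> (\<open>hform_factors\<close>).\<close>

section \<open>The operators of the Weyl-Clifford algebra\<close>

lemma vector_space_superpoly: "vector_space sscale"
  by standard (auto intro!: superpoly_eqI simp: algebra_simps)

interpretation superpoly: vector_space sscale
  by (rule vector_space_superpoly)

definition slinear :: "(superpoly \<Rightarrow> superpoly) \<Rightarrow> bool" where
  "slinear T \<longleftrightarrow> (\<forall>f g. T (f + g) = T f + T g) \<and> (\<forall>c f. T (sscale c f) = sscale c (T f))"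

lemma slinearD:
  assumes "slinear T"
  shows "T (f + g) = T f + T g" "T (sscale c f) = sscale c (T f)"
  using assms by (simp_all add: slinear_def)

lemma slinear_0: "slinear T \<Longrightarrow> T 0 = 0"
  by (metis slinear_def superpoly.scale_zero_left)

lemma slinear_minus: "slinear T \<Longrightarrow> T (- f) = - T f"
  by (metis add.inverse_unique add.right_inverse slinear_0 slinear_def)

lemma slinear_sum: "slinear T \<Longrightarrow> T (sum g S) = (\<Sum>a\<in>S. T (g a))"
  by (induction S rule: infinite_finite_induct) (simp_all add: slinear_0 slinearD)

lemma slinear_eqI:
  assumes "slinear S" "slinear T" "\<And>k. S (smonom k) = T (smonom k)"
  shows "S f = T f"
  by (induction f rule: superpoly_induct) (simp_all add: assms slinear_0 slinearD)

named_theorems slinear_intros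

lemma slinear_lin_extend [slinear_intros]: "slinear (lin_extend g)"
  by (simp add: slinear_def lin_extend_add lin_extend_sscale)

lemma slinear_id [slinear_intros]: "slinear (\<lambda>f. f)"
  by (simp add: slinear_def)

lemma slinear_comp: "slinear S \<Longrightarrow> slinear T \<Longrightarrow> slinear (\<lambda>f. S (T f))"
  by (simp add: slinear_def)

lemma slinear_times_left [slinear_intros]: "slinear T \<Longrightarrow> slinear (\<lambda>f. h * T f)"
  by (simp add: slinear_def superpoly_distrib superpoly_mult_sscale)

lemma slinear_add [slinear_intros]: "slinear S \<Longrightarrow> slinear T \<Longrightarrow> slinear (\<lambda>f. S f + T f)"
  by (simp add: slinear_def superpoly.scale_right_distrib algebra_simps)

lemma slinear_minus_fun [slinear_intros]: "slinear S \<Longrightarrow> slinear T \<Longrightarrow> slinear (\<lambda>f. S f - T f)"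
  by (simp add: slinear_def superpoly.scale_right_diff_distrib algebra_simps)

lemma slinear_sum_fun [slinear_intros]:
  "(\<And>a. a \<in> S \<Longrightarrow> slinear (T a)) \<Longrightarrow> slinear (\<lambda>f. \<Sum>a\<in>S. T a f)"
  by (induction S rule: infinite_finite_induct) (simp_all add: slinear_intros, simp_all add: slinear_def)

lemma slinear_If [slinear_intros]: "slinear (\<lambda>f. if b then f else 0)"
  by (simp add: slinear_def)

lemma slinear_uminus [slinear_intros]: "slinear T \<Longrightarrow> slinear (\<lambda>f. - T f)"
  by (simp add: slinear_def)

lemma slinear_xder [slinear_intros]: "slinear T \<Longrightarrow> slinear (\<lambda>f. xder i l (T f))"
  unfolding xder_def by (rule slinear_comp[OF slinear_lin_extend])

lemma slinear_etader [slinear_intros]: "slinear T \<Longrightarrow> slinear (\<lambda>f. etader i l (T f))"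
  unfolding etader_def by (rule slinear_comp[OF slinear_lin_extend])

lemma slinear_zder [slinear_intros]: "slinear T \<Longrightarrow> slinear (\<lambda>f. zder m a i (T f))"
  by (simp add: zder_def slinear_intros)

lemma sscale_simps [simp]: "sscale 1 f = f" "sscale 0 f = 0" "sscale c 0 = 0" "sscale (- c) f = - sscale c f"
  "sscale c (- f) = - sscale c f"
  by (auto intro!: superpoly_eqI)

subsection \<open>Signs\<close>

text \<open>The parity of this number gives the sign with which \<open>v\<close> is sorted into the odd monomial of \<open>A\<close>, and
  also the sign with which it is moved to the front of it.\<close>

definition before :: "var fset \<Rightarrow> var \<Rightarrow> nat" where
  "before A v = card {a. a |\<in>| A \<and> var_less a v}"

lemma var_less_irrefl [simp]: "\<not> var_less v v"
  by (simp add: var_less_def)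

lemma var_less_asym: "v \<noteq> w \<Longrightarrow> var_less v w \<longleftrightarrow> \<not> var_less w v"
  by (cases v; cases w) (auto simp: var_less_def)

lemma before_finsert:
  assumes "w |\<notin>| A"
  shows "before (finsert w A) v = before A v + (if var_less w v then 1 else 0)"
proof -
  have fin: "finite {a. a |\<in>| A \<and> var_less a v}"
    by (rule finite_subset[of _ "fset A"]) auto
  show ?thesis
  proof (cases "var_less w v")
    case True
    have "{a. a |\<in>| finsert w A \<and> var_less a v} = insert w {a. a |\<in>| A \<and> var_less a v}"
      using True by auto
    then show ?thesis using True fin assms by (simp add: before_def)
  next
    case False
    have "{a. a |\<in>| finsert w A \<and> var_less a v} = {a. a |\<in>| A \<and> var_less a v}"
      using False by auto
    then show ?thesis using False by (simp add: before_def)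
  qed
qed

lemma inversions_singleton: "inversions {|v|} A = before A v"
proof -
  have "{(a, b). a |\<in>| {|v|} \<and> b |\<in>| A \<and> var_less b a} = Pair v ` {b. b |\<in>| A \<and> var_less b v}"
    by auto
  then show ?thesis
    by (simp add: inversions_def before_def card_image inj_on_def)
qed

lemma xvar_smonom: "xvar i l * smonom (\<alpha>, A) = smonom (Poly_Mapping.single (i, l) 1 + \<alpha>, A)"
  by (simp add: xvar_def smonom_mult monom_times_def)

lemma etavar_smonom:
  "etavar i k * smonom (\<alpha>, A) = (if (i, k) |\<in>| A then 0
     else sscale ((-1) ^ before A (i, k)) (smonom (\<alpha>, finsert (i, k) A)))"
  by (simp add: etavar_def smonom_mult monom_times_def inversions_singleton)

lemma xder_smonom:
  "xder i l (smonom (\<alpha>, A)) = sscale (of_nat (Poly_Mapping.lookup \<alpha> (i, l)))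
     (smonom (\<alpha> - Poly_Mapping.single (i, l) 1, A))"
  by (simp add: xder_def)

lemma etader_smonom:
  "etader i k (smonom (\<alpha>, A)) = (if (i, k) |\<in>| A
     then sscale ((-1) ^ before A (i, k)) (smonom (\<alpha>, A |-| {|(i, k)|})) else 0)"
  by (simp add: etader_def before_def)

lemmas op_smonom = xvar_smonom etavar_smonom xder_smonom etader_smonom

text \<open>The basis vector numbered \<open>a\<close>, and with it every variable \<open>zvar m a i\<close>, is odd if and only if
  \<open>m < a\<close>.\<close>

definition zsign :: "nat \<Rightarrow> nat \<Rightarrow> nat \<Rightarrow> complex" where
  "zsign m a b = (if m < a \<and> m < b then - 1 else 1)"

lemma zsign_commute: "zsign m a b = zsign m b a"
  by (auto simp: zsign_def)

lemma zsign_square [simp]: "zsign m a b * zsign m a b = 1" "zsign m a b * (zsign m a b * c) = c"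
  by (auto simp: zsign_def)


lemma xvar_xvar: "xvar i l * (xvar j k * f) = xvar j k * (xvar i l * f)"
  by (rule slinear_eqI[where f = f]; (intro slinear_intros)?; (auto simp: op_smonom add_ac))

lemma xder_xder: "xder i l (xder j k f) = xder j k (xder i l f)"
proof (rule slinear_eqI[where f = f])
  fix a :: supermonom
  obtain \<alpha> A where a: "a = (\<alpha>, A)" by (cases a)
  show "xder i l (xder j k (smonom a)) = xder j k (xder i l (smonom a))"
    by (auto simp: a op_smonom slinearD[OF slinear_xder[OF slinear_id]] lookup_minus lookup_single
      when_def diff_diff_add add.commute)
qed (intro slinear_intros)+

lemma xder_xvar:
  "xder i l (xvar j k * f) = (if i = j \<and> l = k then f else 0) + xvar j k * xder i l f"
proof (rule slinear_eqI[where f = f])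
  fix a :: supermonom
  obtain \<alpha> A where a: "a = (\<alpha>, A)" by (cases a)
  have 1: "Poly_Mapping.single (j, k) 1 + (\<alpha> - Poly_Mapping.single (i, l) 1) =
      Poly_Mapping.single (j, k) 1 + \<alpha> - Poly_Mapping.single (i, l) 1"
    if "Poly_Mapping.lookup \<alpha> (i, l) \<noteq> 0"
    using that by (auto intro!: poly_mapping_eqI simp: lookup_add lookup_minus lookup_single when_def)
  show "xder i l (xvar j k * smonom a) =
      (if i = j \<and> l = k then smonom a else 0) + xvar j k * xder i l (smonom a)"
    using 1
    by (auto simp: a op_smonom superpoly_mult_sscale lookup_add lookup_single when_def algebra_simps
      intro!: superpoly_eqI)
qed (intro slinear_intros)+

lemma xvar_etavar: "xvar i l * (etavar j k * f) = etavar j k * (xvar i l * f)"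
proof (rule slinear_eqI[where f = f])
  fix a :: supermonom
  show "xvar i l * (etavar j k * smonom a) = etavar j k * (xvar i l * smonom a)"
    by (cases a) (auto simp: op_smonom superpoly_mult_sscale)
qed (intro slinear_intros)+

lemma xder_etavar: "xder i l (etavar j k * f) = etavar j k * xder i l f"
proof (rule slinear_eqI[where f = f])
  fix a :: supermonom
  show "xder i l (etavar j k * smonom a) = etavar j k * xder i l (smonom a)"
    by (cases a) (auto simp: op_smonom superpoly_mult_sscale slinearD[OF slinear_xder[OF slinear_id]]
      slinear_0[OF slinear_xder[OF slinear_id]] sscale_sscale mult.commute)
qed (intro slinear_intros)+

lemma etader_xvar: "etader i l (xvar j k * f) = xvar j k * etader i l f"
proof (rule slinear_eqI[where f = f])
  fix a :: supermonom
  show "etader i l (xvar j k * smonom a) = xvar j k * etader i l (smonom a)"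
    by (cases a) (auto simp: op_smonom superpoly_mult_sscale)
qed (intro slinear_intros)+

lemma etader_xder: "etader i l (xder j k f) = xder j k (etader i l f)"
proof (rule slinear_eqI[where f = f])
  fix a :: supermonom
  show "etader i l (xder j k (smonom a)) = xder j k (etader i l (smonom a))"
    by (cases a) (auto simp: op_smonom superpoly_mult_sscale slinearD[OF slinear_xder[OF slinear_id]]
      slinear_0[OF slinear_xder[OF slinear_id]] slinearD[OF slinear_etader[OF slinear_id]]
      sscale_sscale mult.commute)
qed (intro slinear_intros)+

lemma etavar_etavar: "etavar i l * (etavar j k * f) = - (etavar j k * (etavar i l * f))"
proof (rule slinear_eqI[where f = f])
  fix a :: supermonom
  obtain \<alpha> A where a: "a = (\<alpha>, A)" by (cases a)
  show "etavar i l * (etavar j k * smonom a) = - (etavar j k * (etavar i l * smonom a))"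
    by (cases "(i, l) = (j, k)")
      (auto simp: a op_smonom superpoly_mult_sscale before_finsert var_less_asym[of "(i,l)" "(j,k)"]
        sscale_sscale finsert_commute intro!: superpoly_eqI)
qed (intro slinear_intros)+

lemma etader_etavar:
  "etader i l (etavar j k * f) = (if i = j \<and> l = k then f else 0) - etavar j k * etader i l f"
proof (rule slinear_eqI[where f = f])
  fix a :: supermonom
  obtain \<alpha> A where a: "a = (\<alpha>, A)" by (cases a)
  note lin = slinearD[OF slinear_etader[OF slinear_id]] slinear_0[OF slinear_etader[OF slinear_id]]
  have diff: "finsert w B |-| {|v|} = finsert w (B |-| {|v|})" if "v \<noteq> w" for v w :: var and B
    using that by auto
  show "etader i l (etavar j k * smonom a) =
      (if i = j \<and> l = k then smonom a else 0) - etavar j k * etader i l (smonom a)"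
  proof (cases "(i, l) |\<in>| A")
    case True
    then obtain B where A: "A = finsert (i, l) B" and B: "(i, l) |\<notin>| B"
      by (metis mk_disjoint_finsert)
    show ?thesis using B
      by (cases "(i, l) = (j, k)")
        (auto simp: a A op_smonom superpoly_mult_sscale before_finsert var_less_asym[of "(i,l)" "(j,k)"]
        sscale_sscale finsert_commute lin diff finsert_absorb intro!: superpoly_eqI)
  next
    case False
    then show ?thesis
      by (cases "(i, l) = (j, k)")
        (auto simp: a op_smonom superpoly_mult_sscale before_finsert 
        sscale_sscale lin intro!: superpoly_eqI)
  qed
qed (intro slinear_intros)+

lemma etader_etader: "etader i l (etader j k f) = - etader j k (etader i l f)"
proof (rule slinear_eqI[where f = f])
  fix a :: supermonom
  obtain \<alpha> A where a: "a = (\<alpha>, A)" by (cases a)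
  note lin = slinearD[OF slinear_etader[OF slinear_id]] slinear_0[OF slinear_etader[OF slinear_id]]
  have diff: "finsert w B |-| {|v|} = finsert w (B |-| {|v|})" if "v \<noteq> w" for v w :: var and B
    using that by auto
  show "etader i l (etader j k (smonom a)) = - etader j k (etader i l (smonom a))"
  proof (cases "(i, l) \<noteq> (j, k) \<and> (i, l) |\<in>| A \<and> (j, k) |\<in>| A")
    case True
    define B where "B = A |-| {|(i, l), (j, k)|}"
    have A: "A = finsert (i, l) (finsert (j, k) B)" and B: "(i, l) |\<notin>| B" "(j, k) |\<notin>| B"
      using True by (auto simp: B_def)
    have [simp]: "finsert (i, l) (finsert (j, k) B) |-| {|(j, k)|} = finsert (i, l) B"
        "finsert (i, l) (finsert (j, k) B) |-| {|(i, l)|} = finsert (j, k) B"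
        "finsert (i, l) B |-| {|(i, l)|} = B" "finsert (j, k) B |-| {|(j, k)|} = B"
      using B True by auto
    have "before (finsert (i, l) B) (i, l) = before B (i, l)"
         "before (finsert (j, k) B) (j, k) = before B (j, k)"
      using B by (simp_all add: before_finsert)
    moreover have "var_less (i, l) (j, k) \<longleftrightarrow> \<not> var_less (j, k) (i, l)"
      using True by (intro var_less_asym) auto
    ultimately show ?thesis using B True
      by (cases "var_less (j, k) (i, l)")
        (simp_all add: a A op_smonom before_finsert sscale_sscale lin
          slinear_minus[OF slinear_etader[OF slinear_id]] mult_ac)
  next
    case False
    then show ?thesis
      by (auto simp: a op_smonom sscale_sscale lin)
  qed
qed (intro slinear_intros)+

text \<open>The commutation and anticommutation relations in a common form. All brackets below are computed
  from the following three rules.\<close>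

lemma zvar_zvar:
  "zvar m a i * (zvar m b j * f) = sscale (zsign m a b) (zvar m b j * (zvar m a i * f))"
  using xvar_xvar[of i a j b f] xvar_etavar[of i a j "b - m" f] xvar_etavar[of j b i "a - m" f]
    etavar_etavar[of i "a - m" j "b - m" f]
  by (auto simp: zvar_def zsign_def)

lemma zder_zder:
  "zder m a i (zder m b j f) = sscale (zsign m a b) (zder m b j (zder m a i f))"
  using xder_xder[of i a j b f] etader_xder[of i "a - m" j b f] etader_xder[of j "b - m" i a f]
    etader_etader[of i "a - m" j "b - m" f]
  by (auto simp: zder_def zsign_def)

lemma zder_zvar:
  "zder m a i (zvar m b j * f) =
     (if a = b \<and> i = j then f else 0) + sscale (zsign m a b) (zvar m b j * zder m a i f)"
  using xder_xvar[of i a j b f] xder_etavar[of i a j "b - m" f] etader_xvar[of i "a - m" j b f]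
    etader_etavar[of i "a - m" j "b - m" f]
  by (auto simp: zder_def zvar_def zsign_def)


subsection \<open>The brackets\<close>

text \<open>In this form \<open>gl(p)\<close> and \<open>gl(m|n)\<close> are on the same footing: the units of the one sum over the lower
  index of the variables, those of the other over the upper index.\<close>

lemma glp_action_zsum:
  "glp_action m n i j f = (\<Sum>a = 1..m + n. zvar m a i * zder m a j f)"
proof -
  have "(\<Sum>a = 1..m + n. zvar m a i * zder m a j f) =
      (\<Sum>a = 1..m. zvar m a i * zder m a j f) + (\<Sum>a = 1 + m..n + m. zvar m a i * zder m a j f)"
    by (subst sum.ub_add_nat) (simp_all add: add.commute)
  also have "(\<Sum>a = 1 + m..n + m. zvar m a i * zder m a j f) =
      (\<Sum>k = 1..n. zvar m (k + m) i * zder m (k + m) j f)"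
    by (rule sum.shift_bounds_cl_nat_ivl)
  finally show ?thesis
    by (simp add: glp_action_def zvar_def zder_def)
qed

lemma slinear_glp [slinear_intros]: "slinear T \<Longrightarrow> slinear (\<lambda>f. glp_action m n i j (T f))"
  unfolding glp_action_zsum by (intro slinear_intros)

lemma slinear_glmn [slinear_intros]: "slinear T \<Longrightarrow> slinear (\<lambda>f. glmn_action p m a b (T f))"
  unfolding glmn_action_def by (intro slinear_intros)

lemma sscale_sum: "sscale c (sum g S) = (\<Sum>a\<in>S. sscale c (g a))"
  by (rule superpoly_eqI) (simp add: sum_distrib_left)

lemma sscale_add: "sscale c (f + g) = sscale c f + sscale c g"
  by (rule superpoly_eqI) (simp add: algebra_simps)

lemmas zder_sum = slinear_sum[OF slinear_zder[OF slinear_id]]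
lemmas zder_add = slinearD(1)[OF slinear_zder[OF slinear_id]]
lemmas zder_sscale = slinearD(2)[OF slinear_zder[OF slinear_id]]
lemmas zder_0 = slinear_0[OF slinear_zder[OF slinear_id]]

lemma mult_if_zero: "h * (if P then f else 0) = (if P then h * f else (0::superpoly))"
  by simp

text \<open>Once the derivations are moved to the right, the terms of order four are the same for both orders of
  the two matrix units, up to the sign in the superbracket, and cancel there.\<close>

lemma glmn_glmn_normal_order:
  "glmn_action p m a b (glmn_action p m c d f) =
     (if b = c then glmn_action p m a d f else 0) +
     sscale (zsign m b c) (\<Sum>i = 1..p. \<Sum>j = 1..p.
       zvar m a i * (zvar m c j * zder m b i (zder m d j f)))"
  by (simp add: glmn_action_def zder_sum zder_zvar distrib_left sum.distrib sum_distrib_left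
      superpoly_mult_sscale sscale_sum mult_if_zero)

lemma glmn_superbracket:
  assumes "\<epsilon> = (if (m < a) \<noteq> (m < b) \<and> (m < c) \<noteq> (m < d) then - 1 else 1)"
  shows "glmn_action p m a b (glmn_action p m c d f) -
      sscale \<epsilon> (glmn_action p m c d (glmn_action p m a b f)) =
    (if b = c then glmn_action p m a d f else 0) -
    (if a = d then sscale \<epsilon> (glmn_action p m c b f) else 0)"
proof -
  let ?Q = "\<lambda>a b c d. \<Sum>i = 1..p. \<Sum>j = 1..p. zvar m a i * (zvar m c j * zder m b i (zder m d j f))"
  have "zvar m a i * (zvar m c j * zder m b i (zder m d j f)) =
      sscale (zsign m a c * zsign m b d) (zvar m c j * (zvar m a i * zder m d j (zder m b i f)))" for i j
    by (subst zvar_zvar, subst zder_zder)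
      (simp add: superpoly_mult_sscale sscale_sscale)
  then have "?Q a b c d = sscale (zsign m a c * zsign m b d) (?Q c d a b)"
    by (simp add: sscale_sum) (subst sum.swap, simp)
  moreover have "zsign m b c * (zsign m a c * zsign m b d) = \<epsilon> * zsign m d a"
    using assms by (auto simp: zsign_def)
  ultimately show ?thesis
    by (simp add: glmn_glmn_normal_order sscale_sscale sscale_add)
qed

lemma glp_glp_normal_order:
  "glp_action m n i j (glp_action m n k l f) =
     (if j = k then glp_action m n i l f else 0) +
     (\<Sum>a = 1..m + n. \<Sum>b = 1..m + n. sscale (zsign m a b)
       (zvar m a i * (zvar m b k * zder m a j (zder m b l f))))"
  by (simp add: glp_action_zsum zder_sum zder_zvar distrib_left sum.distrib sum_distrib_left
      superpoly_mult_sscale sscale_sum mult_if_zero)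

lemma glp_bracket:
  "glp_action m n i j (glp_action m n k l f) - glp_action m n k l (glp_action m n i j f) =
    (if j = k then glp_action m n i l f else 0) - (if i = l then glp_action m n k j f else 0)"
proof -
  let ?Q = "\<lambda>i j k l. \<Sum>a = 1..m + n. \<Sum>b = 1..m + n.
      sscale (zsign m a b) (zvar m a i * (zvar m b k * zder m a j (zder m b l f)))"
  have "sscale (zsign m a b) (zvar m a i * (zvar m b k * zder m a j (zder m b l f))) =
      sscale (zsign m b a) (zvar m b k * (zvar m a i * zder m b l (zder m a j f)))" for a b
    by (subst zvar_zvar, subst zder_zder)
      (simp add: superpoly_mult_sscale sscale_sscale zsign_commute)
  then have "?Q i j k l = ?Q k l i j"
    by simp (subst sum.swap, simp)
  then show ?thesis
    by (simp add: glp_glp_normal_order)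
qed

text \<open>\<open>gl(p)\<close> acts on the upper indices of the variables only, and \<open>gl(m|n)\<close> on the lower ones.\<close>

lemma glp_glmn_commute:
  assumes "i \<in> {1..p}" "j \<in> {1..p}" "c \<in> {1..m + n}" "d \<in> {1..m + n}"
  shows "glp_action m n i j (glmn_action p m c d f) = glmn_action p m c d (glp_action m n i j f)"
proof -
  have "zvar m a i * (zvar m c k * zder m a j (zder m d k f)) =
      sscale (zsign m a c * zsign m a d) (zvar m c k * (zvar m a i * zder m d k (zder m a j f)))" for a k
    by (subst zvar_zvar, subst zder_zder)
      (simp add: superpoly_mult_sscale sscale_sscale)
  then have "sscale (zsign m a c) (zvar m a i * (zvar m c k * zder m a j (zder m d k f))) =
      sscale (zsign m d a) (zvar m c k * (zvar m a i * zder m d k (zder m a j f)))" for a k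
    by (simp add: sscale_sscale zsign_commute)
  then have eq: "(\<Sum>a = 1..m + n. \<Sum>k = 1..p.
        sscale (zsign m a c) (zvar m a i * (zvar m c k * zder m a j (zder m d k f)))) =
      (\<Sum>k = 1..p. \<Sum>a = 1..m + n.
        sscale (zsign m d a) (zvar m c k * (zvar m a i * zder m d k (zder m a j f))))"
    by simp (rule sum.swap)
  have sum_if: "(\<Sum>k\<in>S. if P then g k else 0) = (if P then sum g S else 0)"
    for S P and g :: "nat \<Rightarrow> superpoly"
    by simp
  have "glp_action m n i j (glmn_action p m c d f) = zvar m c i * zder m d j f +
      (\<Sum>a = 1..m + n. \<Sum>k = 1..p.
        sscale (zsign m a c) (zvar m a i * (zvar m c k * zder m a j (zder m d k f))))"
    using assms
    by (simp add: glp_action_zsum glmn_action_def zder_sum zder_zvar distrib_left sum.distrib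
        sum_distrib_left superpoly_mult_sscale sscale_sum mult_if_zero
        if_if_eq_conj[symmetric] sum_if cong: if_cong)
  moreover have "glmn_action p m c d (glp_action m n i j f) = zvar m c i * zder m d j f +
      (\<Sum>k = 1..p. \<Sum>a = 1..m + n.
        sscale (zsign m d a) (zvar m c k * (zvar m a i * zder m d k (zder m a j f))))"
    using assms
    by (simp add: glp_action_zsum glmn_action_def zder_sum zder_zvar distrib_left sum.distrib
        sum_distrib_left superpoly_mult_sscale sscale_sum mult_if_zero
        if_if_eq_conj[symmetric] cong: if_cong)
  ultimately show ?thesis using eq by simp
qed

lemma glp_zvar:
  assumes "c \<in> {1..m + n}"
  shows "glp_action m n i j (zvar m c k * f) =
    (if j = k then zvar m c i * f else 0) + zvar m c k * glp_action m n i j f"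
proof -
  have "zvar m a i * sscale (zsign m a c) (zvar m c k * h) = zvar m c k * (zvar m a i * h)" for a h
    by (simp add: superpoly_mult_sscale) (subst zvar_zvar, simp add: sscale_sscale)
  then show ?thesis using assms
    by (simp add: glp_action_zsum zder_zvar distrib_left sum.distrib sum_distrib_left mult_if_zero
       if_if_eq_conj[symmetric] cong: if_cong)
qed

text \<open>The supercommutator of a matrix unit with multiplication by a variable is multiplication by its image; by
  induction over products, even matrix units act as derivations.\<close>

lemma glmn_zvar:
  assumes "k \<in> {1..p}"
  shows "glmn_action p m a b (zvar m c k * f) =
    (if b = c then zvar m a k * f else 0) +
    sscale (zsign m b c * zsign m a c) (zvar m c k * glmn_action p m a b f)"
proof -
  have "zvar m a i * sscale (zsign m b c) (zvar m c k * h) =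
      sscale (zsign m b c * zsign m a c) (zvar m c k * (zvar m a i * h))" for i h
    by (simp add: superpoly_mult_sscale) (subst zvar_zvar, simp add: sscale_sscale)
  then show ?thesis using assms
    by (simp add: glmn_action_def zder_zvar distrib_left sum.distrib sum_distrib_left mult_if_zero
       sscale_sum if_if_eq_conj[symmetric] cong: if_cong)
qed

subsection \<open>Supports\<close>

text \<open>Monomials are pairs; a quantifier over them should stay one quantifier.\<close>

declare split_paired_All [simp del]

definition supp_in :: "(supermonom \<Rightarrow> bool) \<Rightarrow> superpoly \<Rightarrow> bool" where
  "supp_in Q f \<longleftrightarrow> (\<forall>k. coeff f k \<noteq> 0 \<longrightarrow> Q k)"

lemma supp_in_0 [simp]: "supp_in Q 0"
  by (simp add: supp_in_def)

lemma supp_in_smonom [simp]: "supp_in Q (smonom k) \<longleftrightarrow> Q k"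
  by (cases k) (auto simp: supp_in_def)

lemma supp_in_add: "supp_in Q f \<Longrightarrow> supp_in Q g \<Longrightarrow> supp_in Q (f + g)"
  by (auto simp: supp_in_def) (metis add.right_neutral)

lemma supp_in_sscale: "supp_in Q f \<Longrightarrow> supp_in Q (sscale c f)"
  by (auto simp: supp_in_def)

lemma supp_in_sum: "(\<And>a. a \<in> S \<Longrightarrow> supp_in Q (g a)) \<Longrightarrow> supp_in Q (sum g S)"
  by (induction S rule: infinite_finite_induct) (auto intro: supp_in_add)

lemma superpoly_expand: "f = (\<Sum>k\<in>support f. sscale (coeff f k) (smonom k))"
  using lin_extend_id[of f] by (simp add: lin_extend_def)

lemma supp_in_slinear:
  assumes "slinear T" "supp_in Q f" "\<And>k. Q k \<Longrightarrow> supp_in Q' (T (smonom k))"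
  shows "supp_in Q' (T f)"
proof -
  have "T f = (\<Sum>k\<in>support f. sscale (coeff f k) (T (smonom k)))"
    using arg_cong[OF superpoly_expand, of T f]
    by (simp only: slinear_sum[OF assms(1)] slinearD[OF assms(1)])
  moreover have "supp_in Q' (\<Sum>k\<in>support f. sscale (coeff f k) (T (smonom k)))"
    by (intro supp_in_sum supp_in_sscale assms(3))
      (use assms(2) in \<open>auto simp: supp_in_def in_support_iff\<close>)
  ultimately show ?thesis by simp
qed

definition in_vars :: "nat \<Rightarrow> nat \<Rightarrow> nat \<Rightarrow> supermonom \<Rightarrow> bool" where
  "in_vars p m n k \<longleftrightarrow>
     Poly_Mapping.keys (fst k) \<subseteq> {1..p} \<times> {1..m} \<and> fset (snd k) \<subseteq> {1..p} \<times> {1..n}"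

lemma superpolys_eq: "f \<in> superpolys p m n \<longleftrightarrow> supp_in (in_vars p m n) f"
  by (simp add: superpolys_def supp_in_def in_vars_def in_support_iff case_prod_unfold Ball_def)

lemma superpolys_parity_eq:
  "f \<in> superpolys_parity p m n s \<longleftrightarrow> supp_in (\<lambda>k. in_vars p m n k \<and> odd (fcard (snd k)) = s) f"
  by (auto simp: superpolys_parity_def superpolys_eq supp_in_def in_support_iff case_prod_unfold
      Ball_def)

lemma superpolys_parity_subset: "f \<in> superpolys_parity p m n s \<Longrightarrow> f \<in> superpolys p m n"
  by (simp add: superpolys_parity_def)

lemma superpolys_parity_disjoint:
  "f \<in> superpolys_parity p m n s \<Longrightarrow> f \<in> superpolys_parity p m n (\<not> s) \<Longrightarrow> f = 0"
  by (rule superpoly_eqI) (auto simp: superpolys_parity_eq supp_in_def)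

lemma zvar_parity:
  assumes "f \<in> superpolys_parity p m n s" "a \<in> {1..m + n}" "i \<in> {1..p}"
  shows "zvar m a i * f \<in> superpolys_parity p m n (s \<noteq> (m < a))"
  unfolding superpolys_parity_eq
proof (rule supp_in_slinear[OF slinear_times_left[OF slinear_id]])
  fix k :: supermonom
  assume k: "in_vars p m n k \<and> odd (fcard (snd k)) = s"
  obtain \<alpha> A where [simp]: "k = (\<alpha>, A)" by (cases k)
  have "Poly_Mapping.keys (Poly_Mapping.single (i, a) 1 + \<alpha>) \<subseteq> insert (i, a) (Poly_Mapping.keys \<alpha>)"
    using Poly_Mapping.keys_add[of "Poly_Mapping.single (i, a) 1" \<alpha>] by auto
  then show "supp_in (\<lambda>k. in_vars p m n k \<and> odd (fcard (snd k)) = (s \<noteq> (m < a))) (zvar m a i * smonom k)"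
    using k assms(2,3)
    by (auto simp: zvar_def op_smonom in_vars_def fcard_finsert_if intro!: supp_in_sscale)
qed (use assms in \<open>simp add: superpolys_parity_eq\<close>)

lemma zder_parity:
  assumes "f \<in> superpolys_parity p m n s"
  shows "zder m a i f \<in> superpolys_parity p m n (s \<noteq> (m < a))"
  unfolding superpolys_parity_eq
proof (rule supp_in_slinear[OF slinear_zder[OF slinear_id]])
  fix k :: supermonom
  assume k: "in_vars p m n k \<and> odd (fcard (snd k)) = s"
  obtain \<alpha> A where [simp]: "k = (\<alpha>, A)" by (cases k)
  have 1: "Poly_Mapping.keys (\<alpha> - Poly_Mapping.single (i, a) 1) \<subseteq> Poly_Mapping.keys \<alpha>"
    by (auto simp: in_keys_iff lookup_minus)
  have 2: "odd (fcard (A |-| {|v|})) \<longleftrightarrow> even (fcard A)" if v: "v |\<in>| A" for v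
  proof -
    obtain B where "A = finsert v B" "v |\<notin>| B" using mk_disjoint_finsert[OF v] by blast
    then show ?thesis by (simp add: fcard_finsert_disjoint)
  qed
  show "supp_in (\<lambda>k. in_vars p m n k \<and> odd (fcard (snd k)) = (s \<noteq> (m < a))) (zder m a i (smonom k))"
    using k 1 2 by (auto simp: zder_def op_smonom in_vars_def intro!: supp_in_sscale)
qed (use assms in \<open>simp add: superpolys_parity_eq\<close>)

lemma superpolys_parity_sum:
  "(\<And>a. a \<in> S \<Longrightarrow> g a \<in> superpolys_parity p m n s) \<Longrightarrow> sum g S \<in> superpolys_parity p m n s"
  by (simp add: superpolys_parity_eq supp_in_sum)

lemma glp_parity:
  assumes "f \<in> superpolys_parity p m n s" "i \<in> {1..p}"
  shows "glp_action m n i j f \<in> superpolys_parity p m n s"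
  unfolding glp_action_zsum
proof (rule superpolys_parity_sum)
  fix a assume "a \<in> {1..m + n}"
  then show "zvar m a i * zder m a j f \<in> superpolys_parity p m n s"
    using zvar_parity[OF zder_parity[OF assms(1)] _ assms(2), of a a j]
    by (cases "m < a") simp_all
qed

lemma glmn_parity:
  assumes "f \<in> superpolys_parity p m n s" "a \<in> {1..m + n}"
  shows "glmn_action p m a b f \<in> superpolys_parity p m n (s \<noteq> ((m < a) \<noteq> (m < b)))"
  unfolding glmn_action_def
proof (rule superpolys_parity_sum)
  fix j assume "j \<in> {1..p}"
  then show "zvar m a j * zder m b j f \<in> superpolys_parity p m n (s \<noteq> ((m < a) \<noteq> (m < b)))"
    using zvar_parity[OF zder_parity[OF assms(1)] assms(2), of j b j] 
    by (cases s; cases "m < a"; cases "m < b"; simp)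
qed

lemma superpolys_zvar:
  assumes "f \<in> superpolys p m n" "a \<in> {1..m + n}" "i \<in> {1..p}"
  shows "zvar m a i * f \<in> superpolys p m n"
  unfolding superpolys_eq
proof (rule supp_in_slinear[OF slinear_times_left[OF slinear_id]])
  fix k :: supermonom
  assume "in_vars p m n k"
  then have "smonom k \<in> superpolys_parity p m n (odd (fcard (snd k)))"
    by (simp add: superpolys_parity_eq)
  then show "supp_in (in_vars p m n) (zvar m a i * smonom k)"
    using zvar_parity[OF _ assms(2,3)] superpolys_parity_subset superpolys_eq by blast
qed (use assms in \<open>simp add: superpolys_eq\<close>)

lemma superpolys_zder:
  assumes "f \<in> superpolys p m n"
  shows "zder m a i f \<in> superpolys p m n"
  unfolding superpolys_eq
proof (rule supp_in_slinear[OF slinear_zder[OF slinear_id]])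
  fix k :: supermonom
  assume "in_vars p m n k"
  then have "smonom k \<in> superpolys_parity p m n (odd (fcard (snd k)))"
    by (simp add: superpolys_parity_eq)
  then show "supp_in (in_vars p m n) (zder m a i (smonom k))"
    using zder_parity superpolys_parity_subset superpolys_eq by blast
qed (use assms in \<open>simp add: superpolys_eq\<close>)

lemma superpolys_closed:
  "0 \<in> superpolys p m n"
  "1 \<in> superpolys p m n"
  "f \<in> superpolys p m n \<Longrightarrow> sscale c f \<in> superpolys p m n"
  "f \<in> superpolys p m n \<Longrightarrow> g \<in> superpolys p m n \<Longrightarrow> f + g \<in> superpolys p m n"
  by (simp_all add: superpolys_eq supp_in_sscale supp_in_add one_superpoly_def in_vars_def)

lemma superpolys_sum:
  "(\<And>a. a \<in> S \<Longrightarrow> g a \<in> superpolys p m n) \<Longrightarrow> sum g S \<in> superpolys p m n"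
  by (simp add: superpolys_eq supp_in_sum)

lemma superpolys_glp:
  "f \<in> superpolys p m n \<Longrightarrow> i \<in> {1..p} \<Longrightarrow> glp_action m n i j f \<in> superpolys p m n"
  unfolding glp_action_zsum by (intro superpolys_sum superpolys_zvar superpolys_zder)

lemma superpolys_glmn:
  "f \<in> superpolys p m n \<Longrightarrow> a \<in> {1..m + n} \<Longrightarrow> glmn_action p m a b f \<in> superpolys p m n"
  unfolding glmn_action_def by (intro superpolys_sum superpolys_zvar superpolys_zder)

text \<open>As the monomials are finite products, an identity that is linear in \<open>f\<close> has to be checked only for 1
  and for products of a variable with an \<open>f\<close> that satisfies it.\<close>

lemma superpolys_induct [consumes 1, case_names one scale add zvar]:
  assumes "f \<in> superpolys p m n"
    and one: "P 1"
    and scale: "\<And>c f. P f \<Longrightarrow> P (sscale c f)"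
    and add: "\<And>f g. P f \<Longrightarrow> P g \<Longrightarrow> P (f + g)"
    and zvar: "\<And>a i f. a \<in> {1..m + n} \<Longrightarrow> i \<in> {1..p} \<Longrightarrow> f \<in> superpolys p m n \<Longrightarrow> P f \<Longrightarrow>
      P (zvar m a i * f)"
  shows "P f"
proof -
  have even: "P (smonom (\<alpha>, {||}))" if "Poly_Mapping.keys \<alpha> \<subseteq> {1..p} \<times> {1..m}" for \<alpha>
    using that
  proof (induction "\<Sum>v\<in>Poly_Mapping.keys \<alpha>. Poly_Mapping.lookup \<alpha> v" arbitrary: \<alpha>
      rule: less_induct)
    case less
    show ?case
    proof (cases "\<alpha> = 0")
      case True
      then show ?thesis using one by (simp add: one_superpoly_def)
    next
      case False
      then obtain v where v: "v \<in> Poly_Mapping.keys \<alpha>" by (metis all_not_in_conv keys_eq_empty)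
      obtain i l where il: "v = (i, l)" by (cases v)
      define \<beta> where "\<beta> = \<alpha> - Poly_Mapping.single v 1"
      have \<alpha>: "\<alpha> = Poly_Mapping.single v 1 + \<beta>"
        using v by (auto simp: \<beta>_def lookup_add lookup_minus lookup_single when_def in_keys_iff
            intro!: poly_mapping_eqI)
      have keys: "Poly_Mapping.keys \<beta> \<subseteq> Poly_Mapping.keys \<alpha>"
        by (auto simp: \<beta>_def in_keys_iff lookup_minus)
      have "(\<Sum>w\<in>Poly_Mapping.keys \<beta>. Poly_Mapping.lookup \<beta> w) =
          (\<Sum>w\<in>Poly_Mapping.keys \<alpha>. Poly_Mapping.lookup \<beta> w)"
        using keys by (intro sum.mono_neutral_left) (auto simp: in_keys_iff)
      also have "\<dots> < (\<Sum>w\<in>Poly_Mapping.keys \<alpha>. Poly_Mapping.lookup \<alpha> w)"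
        using v by (intro sum_strict_mono_ex1)
          (auto simp: \<beta>_def lookup_minus lookup_single when_def in_keys_iff intro!: bexI[of _ v])
      finally have "P (smonom (\<beta>, {||}))"
        using less.prems keys by (intro less.hyps) auto
      moreover have "smonom (\<beta>, {||}) \<in> superpolys p m n"
        using less.prems keys by (auto simp: superpolys_eq in_vars_def)
      moreover have "i \<in> {1..p}" "l \<in> {1..m}"
        using less.prems v il by auto
      ultimately have "P (zvar m l i * smonom (\<beta>, {||}))"
        by (intro zvar) auto
      then show ?thesis using \<open>l \<in> {1..m}\<close> by (simp add: zvar_def xvar_smonom \<alpha> il)
    qed
  qed
  have mon: "P (smonom (\<alpha>, A))"
    if "Poly_Mapping.keys \<alpha> \<subseteq> {1..p} \<times> {1..m}" "fset A \<subseteq> {1..p} \<times> {1..n}" for \<alpha> A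
    using that(2)
  proof (induction A)
    case empty
    then show ?case using even that(1) by blast
  next
    case (insert v A)
    obtain i k where ik: "v = (i, k)" by (cases v)
    have "i \<in> {1..p}" "k \<in> {1..n}" using insert.prems ik by auto
    moreover have "smonom (\<alpha>, A) \<in> superpolys p m n"
      using insert.prems that(1) by (auto simp: superpolys_eq in_vars_def)
    moreover have "P (smonom (\<alpha>, A))" using insert by simp
    ultimately have "P (zvar m (m + k) i * smonom (\<alpha>, A))"
      by (intro zvar) auto
    then have "P (sscale ((-1) ^ before A (i, k)) (zvar m (m + k) i * smonom (\<alpha>, A)))"
      by (rule scale)
    moreover have "(-1 :: complex) ^ x * (-1) ^ x = 1" for x :: nat
      by (simp flip: power_mult_distrib)
    ultimately show ?case using \<open>k \<in> {1..n}\<close> insert.hyps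
      by (simp add: zvar_def etavar_smonom ik sscale_sscale)
  qed
  have "P (\<Sum>k\<in>S. sscale (coeff f k) (smonom k))" if "S \<subseteq> support f" for S
    using finite_subset[OF that finite_keys] that
  proof (induction S)
    case empty
    then show ?case using scale[OF one, of 0] by simp
  next
    case (insert k S)
    have "in_vars p m n k"
      using insert.prems assms(1)[unfolded superpolys_eq supp_in_def] by (simp add: in_support_iff)
    then have "P (smonom k)"
      using mon[of "fst k" "snd k"] by (simp add: in_vars_def)
    then show ?case using insert by (simp add: scale add)
  qed
  then show ?thesis using superpoly_expand[of f] by (metis order_refl)
qed

lemma superpolys_mult:
  assumes "f \<in> superpolys p m n" "g \<in> superpolys p m n"
  shows "f * g \<in> superpolys p m n"
  using assms(1)
  by (induction rule: superpolys_induct)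
    (auto simp: superpoly_distrib superpoly_mult_sscale mult.assoc superpolys_closed assms(2)
      intro: superpolys_zvar)

subsection \<open>The invariant Hermitian form\<close>

text \<open>The monomials are orthogonal, and the square of the norm of one is the product of the
  factorials of its exponents. With this weight, multiplication by a variable and derivation by it
  are adjoint, so that the matrix units \<open>E_{ab}\<close> and \<open>E_{ba}\<close> act by adjoint operators. Since the form
  is positive definite, this replaces complete reducibility.\<close>

definition exp_fact :: "(var \<Rightarrow>\<^sub>0 nat) \<Rightarrow> nat" where
  "exp_fact \<alpha> = (\<Prod>v\<in>Poly_Mapping.keys \<alpha>. fact (Poly_Mapping.lookup \<alpha> v))"

definition hform :: "superpoly \<Rightarrow> superpoly \<Rightarrow> complex" where
  "hform f g = (\<Sum>k\<in>support f. coeff f k * cnj (coeff g k) * of_nat (exp_fact (fst k)))"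

lemma hform_superset:
  assumes "finite S" "support f \<subseteq> S"
  shows "hform f g = (\<Sum>k\<in>S. coeff f k * cnj (coeff g k) * of_nat (exp_fact (fst k)))"
  unfolding hform_def using assms by (intro sum.mono_neutral_left) (auto simp: in_support_iff)

lemma hform_add_left: "hform (f + f') g = hform f g + hform f' g"
proof -
  let ?S = "support f \<union> support f'"
  have "support (f + f') \<subseteq> ?S" by (auto simp: in_support_iff)
  then show ?thesis
    by (simp add: hform_superset[of ?S] algebra_simps sum.distrib)
qed

lemma hform_sscale_left: "hform (sscale c f) g = c * hform f g"
proof -
  have "support (sscale c f) \<subseteq> support f" by (auto simp: in_support_iff)
  then show ?thesis
    by (simp add: hform_superset[of "support f"] sum_distrib_left mult.assoc)
qed

lemma hform_commute: "hform g f = cnj (hform f g)"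
  by (simp add: hform_superset[of "support f \<union> support g"] mult_ac)

lemma hform_add_right: "hform f (g + g') = hform f g + hform f g'"
  by (subst (1 2 3) hform_commute) (simp add: hform_add_left)

lemma hform_sscale_right: "hform f (sscale c g) = cnj c * hform f g"
  by (subst (1 2) hform_commute) (simp add: hform_sscale_left)

lemma hform_0 [simp]: "hform 0 g = 0" "hform f 0 = 0"
  by (simp_all add: hform_def)

lemma hform_sum_left: "hform (sum h S) g = (\<Sum>a\<in>S. hform (h a) g)"
  by (induction S rule: infinite_finite_induct) (simp_all add: hform_add_left)

lemma hform_sum_right: "hform f (sum h S) = (\<Sum>a\<in>S. hform f (h a))"
  by (induction S rule: infinite_finite_induct) (simp_all add: hform_add_right)

lemma hform_smonom: "hform (smonom k) (smonom l) = (if k = l then of_nat (exp_fact (fst k)) else 0)"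
  by (subst hform_superset[of "{k}"]) (auto simp: in_support_iff split: if_splits)

lemma Re_hform_self:
  "Re (hform f f) = (\<Sum>k\<in>support f. (cmod (coeff f k))\<^sup>2 * real (exp_fact (fst k)))"
proof -
  have "Re (c * cnj c * of_nat x) = (cmod c)\<^sup>2 * real x" for c x
    by (simp add: cmod_power2) (simp add: algebra_simps power2_eq_square)
  then show ?thesis by (simp only: hform_def Re_sum)
qed

lemma exp_fact_pos: "exp_fact \<alpha> > 0"
  by (simp add: exp_fact_def prod_pos)

lemma hform_nonneg: "Re (hform f f) \<ge> 0"
  unfolding Re_hform_self by (intro sum_nonneg) simp

lemma hform_pos: "f \<noteq> 0 \<Longrightarrow> Re (hform f f) > 0"
proof -
  assume "f \<noteq> 0"
  then have "support f \<noteq> {}"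
    by (metis keys_eq_empty superpoly.expand superpoly.sel zero_superpoly_def)
  then show ?thesis
    unfolding Re_hform_self by (intro sum_pos) (auto simp: in_support_iff exp_fact_pos)
qed

lemma hform_self_eq_0: "hform f f = 0 \<Longrightarrow> f = 0"
  using hform_pos by force

lemma exp_fact_step:
  "exp_fact (Poly_Mapping.single v 1 + \<alpha>) = Suc (Poly_Mapping.lookup \<alpha> v) * exp_fact \<alpha>"
proof -
  have *: "exp_fact \<beta> = (\<Prod>w\<in>insert v (Poly_Mapping.keys \<alpha>). fact (Poly_Mapping.lookup \<beta> w))"
    if "Poly_Mapping.keys \<beta> \<subseteq> insert v (Poly_Mapping.keys \<alpha>)" for \<beta>
    unfolding exp_fact_def using that
    by (intro prod.mono_neutral_left) (auto simp: in_keys_iff)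
  have "exp_fact (Poly_Mapping.single v 1 + \<alpha>) =
      (\<Prod>w\<in>insert v (Poly_Mapping.keys \<alpha>). fact (Poly_Mapping.lookup (Poly_Mapping.single v 1 + \<alpha>) w))"
    using Poly_Mapping.keys_add[of "Poly_Mapping.single v 1" \<alpha>] by (intro *) auto
  also have "\<dots> = Suc (Poly_Mapping.lookup \<alpha> v) *
      (\<Prod>w\<in>insert v (Poly_Mapping.keys \<alpha>). fact (Poly_Mapping.lookup \<alpha> w))"
  proof -
    have "(\<Prod>w\<in>Poly_Mapping.keys \<alpha> - {v}.
          fact (Poly_Mapping.lookup (Poly_Mapping.single v 1 + \<alpha>) w)) =
        (\<Prod>w\<in>Poly_Mapping.keys \<alpha> - {v}. fact (Poly_Mapping.lookup \<alpha> w) :: nat)"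
      by (intro prod.cong) (auto simp: lookup_add lookup_single when_def)
    moreover have "fact (Poly_Mapping.lookup (Poly_Mapping.single v 1 + \<alpha>) v) =
        Suc (Poly_Mapping.lookup \<alpha> v) * fact (Poly_Mapping.lookup \<alpha> v)"
      by (simp add: lookup_add)
    ultimately show ?thesis
      by (simp only: prod.insert_remove finite_keys mult.assoc)
  qed
  also have "(\<Prod>w\<in>insert v (Poly_Mapping.keys \<alpha>). fact (Poly_Mapping.lookup \<alpha> w)) = exp_fact \<alpha>"
    by (rule *[symmetric]) auto
  finally show ?thesis .
qed

lemma zvar_adjoint: "hform (zvar m a i * f) g = hform f (zder m a i g)"
proof -
  have mon: "hform (zvar m a i * smonom k) (smonom l) = hform (smonom k) (zder m a i (smonom l))"
    for k l :: supermonom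
  proof -
    obtain \<alpha> A \<beta> B where [simp]: "k = (\<alpha>, A)" "l = (\<beta>, B)" by (cases k; cases l)
    show ?thesis
    proof (cases "a \<le> m")
      case True
      have eq: "Poly_Mapping.single (i, a) 1 + \<alpha> = \<beta> \<longleftrightarrow>
          Poly_Mapping.lookup \<beta> (i, a) \<noteq> 0 \<and> \<alpha> = \<beta> - Poly_Mapping.single (i, a) 1"
      proof
        assume "Poly_Mapping.single (i, a) 1 + \<alpha> = \<beta>"
        then show "Poly_Mapping.lookup \<beta> (i, a) \<noteq> 0 \<and> \<alpha> = \<beta> - Poly_Mapping.single (i, a) 1"
          by (auto simp: lookup_add)
      next
        assume *: "Poly_Mapping.lookup \<beta> (i, a) \<noteq> 0 \<and> \<alpha> = \<beta> - Poly_Mapping.single (i, a) 1"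
        show "Poly_Mapping.single (i, a) 1 + \<alpha> = \<beta>"
          using * by (intro poly_mapping_eqI) (auto simp: lookup_add lookup_minus lookup_single when_def)
      qed
      show ?thesis
      proof (cases "Poly_Mapping.single (i, a) 1 + \<alpha> = \<beta>")
        case True
        then show ?thesis using \<open>a \<le> m\<close>
          by (auto simp: zvar_def zder_def op_smonom hform_smonom hform_sscale_right
            exp_fact_step[simplified] lookup_add distrib_right)
      next
        case False
        then show ?thesis using \<open>a \<le> m\<close> eq
          by (auto simp: zvar_def zder_def op_smonom hform_smonom hform_sscale_right)
      qed
    next
      case False
      let ?v = "(i, a - m)"
      have eq: "?v |\<notin>| A \<and> finsert ?v A = B \<longleftrightarrow> ?v |\<in>| B \<and> A = B |-| {|?v|}"
        by blast
      show ?thesis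
      proof (cases "?v |\<notin>| A \<and> finsert ?v A = B")
        case True
        then have "B |-| {|?v|} = A" "?v |\<in>| B" "before B ?v = before A ?v"
          by (auto simp: before_finsert)
        then show ?thesis using True \<open>\<not> a \<le> m\<close>
          by (simp add: zvar_def zder_def op_smonom hform_smonom hform_sscale_left hform_sscale_right)
      next
        case neq: False
        have "hform (zvar m a i * smonom k) (smonom l) = 0"
          using neq \<open>\<not> a \<le> m\<close>
          by (auto simp: zvar_def op_smonom hform_smonom hform_sscale_left)
        moreover have "hform (smonom k) (zder m a i (smonom l)) = 0"
          using neq[unfolded eq] \<open>\<not> a \<le> m\<close>
          by (auto simp: zder_def op_smonom hform_smonom hform_sscale_right)
        ultimately show ?thesis by simp
      qed
    qed
  qed
  note lin = superpoly_distrib superpoly_mult_sscale superpoly_mult_0 zder_add zder_sscale zder_0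
    hform_add_left hform_add_right hform_sscale_left hform_sscale_right
  show ?thesis
  proof (induction f rule: superpoly_induct)
    case (monom c k)
    have "hform (zvar m a i * smonom k) g = hform (smonom k) (zder m a i g)"
      by (induction g rule: superpoly_induct) (simp_all add: lin mon)
    then show ?case by (simp add: lin)
  qed (simp_all add: lin)
qed

lemma zder_adjoint: "hform (zder m a i f) g = hform f (zvar m a i * g)"
  by (subst (1 2) hform_commute) (simp add: zvar_adjoint)

lemma glp_adjoint: "hform (glp_action m n i j f) g = hform f (glp_action m n j i g)"
  by (simp add: glp_action_zsum hform_sum_left hform_sum_right zvar_adjoint zder_adjoint)

lemma glmn_adjoint: "hform (glmn_action p m a b f) g = hform f (glmn_action p m b a g)"
  by (simp add: glmn_action_def hform_sum_left hform_sum_right zvar_adjoint zder_adjoint)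

section \<open>Highest weight vectors in representations of \<open>gl(M|N)\<close>\<close>

definition gl_odd :: "nat \<Rightarrow> nat \<Rightarrow> nat \<Rightarrow> bool" where
  "gl_odd M a b \<longleftrightarrow> (M < a) \<noteq> (M < b)"

text \<open>The grading is left out here. In this way direct sums of modules on different types are covered, as
  well as the space of all superpolynomials, without a restriction of the variables.\<close>

locale gl_rep = vector_space scale
  for scale :: "complex \<Rightarrow> 'v::ab_group_add \<Rightarrow> 'v" +
  fixes M K :: nat and \<rho> :: "nat \<Rightarrow> nat \<Rightarrow> 'v \<Rightarrow> 'v"
  assumes rho_add: "a \<in> {1..K} \<Longrightarrow> b \<in> {1..K} \<Longrightarrow> \<rho> a b (v + w) = \<rho> a b v + \<rho> a b w"
    and rho_scale: "a \<in> {1..K} \<Longrightarrow> b \<in> {1..K} \<Longrightarrow> \<rho> a b (scale z v) = scale z (\<rho> a b v)"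
    and bracket:
      "a \<in> {1..K} \<Longrightarrow> b \<in> {1..K} \<Longrightarrow> c \<in> {1..K} \<Longrightarrow> d \<in> {1..K} \<Longrightarrow>
       \<epsilon> = (if gl_odd M a b \<and> gl_odd M c d then - 1 else 1) \<Longrightarrow>
       \<rho> a b (\<rho> c d v) = scale \<epsilon> (\<rho> c d (\<rho> a b v)) +
         ((if b = c then \<rho> a d v else 0) - (if a = d then scale \<epsilon> (\<rho> c b v) else 0))"
begin

lemma rho_0: "a \<in> {1..K} \<Longrightarrow> b \<in> {1..K} \<Longrightarrow> \<rho> a b 0 = 0"
  using rho_scale[of a b 0 0] by simp

lemma subspace_rho_vimage:
  assumes "subspace S" "a \<in> {1..K}" "b \<in> {1..K}"
  shows "subspace {v. \<rho> a b v \<in> S}"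
  using assms by (auto simp: subspace_def rho_add rho_scale rho_0)

lemma rho_span_mem:
  assumes "u \<in> span X" "a \<in> {1..K}" "b \<in> {1..K}" "\<And>x. x \<in> X \<Longrightarrow> \<rho> a b x \<in> span Y"
  shows "\<rho> a b u \<in> span Y"
proof -
  have "span X \<subseteq> {v. \<rho> a b v \<in> span Y}"
    using assms(4) by (intro span_minimal subspace_rho_vimage[OF subspace_span assms(2,3)]) auto
  then show ?thesis using assms(1) by auto
qed

text \<open>The positive root vectors are brackets of simple ones.\<close>

lemma highest_weight_raising:
  assumes "highest_weight_vector scale K \<rho> \<mu> v" "a \<in> {1..K}" "b \<in> {1..K}" "a < b"
  shows "\<rho> a b v = 0"
  using assms(3,4)
proof (induction b)
  case (Suc b)
  show ?case
  proof (cases "a = b")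
    case True
    have "Suc a \<in> {2..K}" using True assms(2) Suc.prems by auto
    then have "\<rho> (Suc a - 1) (Suc a) v = 0"
      using assms(1) unfolding highest_weight_vector_def by blast
    then show ?thesis using True by simp
  next
    case False
    then have "a < b" "b \<in> {1..K}" using Suc.prems assms(2) by auto
    have 0: "\<rho> a b v = 0" using Suc.IH \<open>a < b\<close> \<open>b \<in> {1..K}\<close> by simp
    have "Suc b \<in> {2..K}" using \<open>b \<in> {1..K}\<close> Suc.prems by auto
    then have "\<rho> (Suc b - 1) (Suc b) v = 0"
      using assms(1) unfolding highest_weight_vector_def by blast
    then have 1: "\<rho> b (Suc b) v = 0" by simp
    show ?thesis
      using bracket[OF assms(2) \<open>b \<in> {1..K}\<close> \<open>b \<in> {1..K}\<close> Suc.prems(1) refl, of v] Suc.prems 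
        \<open>b \<in> {1..K}\<close> assms(2)
      by (simp add: 0 1 rho_0)
  qed
qed simp

text \<open>The span of these vectors is the sum of the lower weight spaces of the module generated by
  \<open>v\<^sub>0\<close>.\<close>

inductive_set lowered :: "'v \<Rightarrow> 'v set" for v\<^sub>0 where
  "a \<in> {1..K} \<Longrightarrow> b \<in> {1..K} \<Longrightarrow> a < b \<Longrightarrow> u = v\<^sub>0 \<or> u \<in> lowered v\<^sub>0 \<Longrightarrow> \<rho> b a u \<in> lowered v\<^sub>0"

lemma rho_lowering:
  assumes "u \<in> span (insert v\<^sub>0 (lowered v\<^sub>0))" "a \<in> {1..K}" "b \<in> {1..K}" "a < b"
  shows "\<rho> b a u \<in> span (lowered v\<^sub>0)"
  using assms(1,3,2) by (rule rho_span_mem) (use assms in \<open>auto intro!: span_base lowered.intros\<close>)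

text \<open>The triangular decomposition: a raising or a Cartan operator can be moved past the lowering
  operators, the commutators being shorter products.\<close>

lemma rho_span_lowered:
  assumes hw: "highest_weight_vector scale K \<rho> \<mu> v\<^sub>0"
    and u: "u \<in> span (insert v\<^sub>0 (lowered v\<^sub>0))" and ab: "a \<in> {1..K}" "b \<in> {1..K}"
  shows "\<rho> a b u \<in> span (insert v\<^sub>0 (lowered v\<^sub>0))"
proof -
  let ?S = "span (insert v\<^sub>0 (lowered v\<^sub>0))"
  have low: "\<rho> d c w \<in> ?S" if "w \<in> ?S" "c \<in> {1..K}" "d \<in> {1..K}" "c < d" for w c d
    using rho_lowering[OF that] span_mono[of "lowered v\<^sub>0" "insert v\<^sub>0 (lowered v\<^sub>0)"] by auto
  have v0: "\<rho> c d v\<^sub>0 \<in> ?S" if "c \<in> {1..K}" "d \<in> {1..K}" for c d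
  proof -
    consider "c < d" | "c = d" | "d < c" by linarith
    then show ?thesis
    proof cases
      case 1
      then show ?thesis using highest_weight_raising[OF hw that] by (simp add: span_zero)
    next
      case 2
      then have "\<rho> c d v\<^sub>0 = scale (\<mu> c) v\<^sub>0"
        using hw that by (simp add: highest_weight_vector_def)
      then show ?thesis by (simp add: span_scale span_base)
    next
      case 3
      then show ?thesis using that by (intro low span_base) auto
    qed
  qed
  have step: "\<rho> c d w \<in> ?S" if "w \<in> lowered v\<^sub>0" "c \<in> {1..K}" "d \<in> {1..K}" for w c d
    using that
  proof (induction arbitrary: c d)
    case (1 a b u)
    have IH: "\<rho> c d u \<in> ?S" if "c \<in> {1..K}" "d \<in> {1..K}" for c d
      using 1 that v0 by auto
    have "\<rho> b a (\<rho> c d u) \<in> ?S"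
      using 1 by (intro low IH) auto
    moreover have "\<rho> c a u \<in> ?S" "\<rho> b d u \<in> ?S"
      using 1 by (auto intro!: IH)
    ultimately show ?case
      unfolding bracket[OF "1.prems" \<open>b \<in> {1..K}\<close> \<open>a \<in> {1..K}\<close> refl]
      by (intro span_add span_diff span_scale) (simp_all add: span_zero span_scale)
  qed
  show ?thesis
    using u ab by (rule rho_span_mem) (use v0 step ab in auto)
qed

text \<open>The operator \<open>\<Sum>\<^sub>a a E\<^sub>a\<^sub>a\<close> separates the highest weight from all lower ones.\<close>

definition height :: "'v \<Rightarrow> 'v" where
  "height v = (\<Sum>a = 1..K. scale (of_nat a) (\<rho> a a v))"

lemma height_add: "height (v + w) = height v + height w"
  by (simp add: height_def rho_add scale_right_distrib sum.distrib)

lemma height_scale: "height (scale c v) = scale c (height v)"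
  by (simp add: height_def rho_scale scale_sum_right mult.commute)

lemma height_highest:
  assumes "highest_weight_vector scale K \<rho> \<mu> v\<^sub>0"
  shows "height v\<^sub>0 = scale (\<Sum>a = 1..K. of_nat a * \<mu> a) v\<^sub>0"
  using assms by (simp add: height_def highest_weight_vector_def scale_sum_left)

lemma height_rho:
  assumes "a \<in> {1..K}" "b \<in> {1..K}"
  shows "height (\<rho> b a v) = \<rho> b a (height v) + scale (of_nat b - of_nat a) (\<rho> b a v)"
proof -
  have "height (\<rho> b a v) = (\<Sum>c = 1..K. scale (of_nat c) (\<rho> b a (\<rho> c c v))
      + ((if c = b then scale (of_nat b) (\<rho> b a v) else 0)
       - (if c = a then scale (of_nat a) (\<rho> b a v) else 0)))"
    unfolding height_def
  proof (intro sum.cong refl)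
    fix c assume c: "c \<in> {1..K}"
    show "scale (of_nat c) (\<rho> c c (\<rho> b a v)) = scale (of_nat c) (\<rho> b a (\<rho> c c v))
      + ((if c = b then scale (of_nat b) (\<rho> b a v) else 0)
       - (if c = a then scale (of_nat a) (\<rho> b a v) else 0))"
      by (subst bracket[OF c c assms(2,1) refl])
        (auto simp: gl_odd_def scale_right_distrib scale_right_diff_distrib)
  qed
  also have "\<dots> = (\<Sum>c = 1..K. scale (of_nat c) (\<rho> b a (\<rho> c c v))) +
      (scale (of_nat b) (\<rho> b a v) - scale (of_nat a) (\<rho> b a v))"
    using assms by (simp add: sum.distrib sum_subtractf)
  also have "(\<Sum>c = 1..K. scale (of_nat c) (\<rho> b a (\<rho> c c v))) = \<rho> b a (height v)"
  proof -
    have "\<rho> b a (sum g S) = (\<Sum>c\<in>S. \<rho> b a (g c))" for g and S :: "nat set"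
      by (induction S rule: infinite_finite_induct) (simp_all add: rho_0[OF assms(2,1)] rho_add[OF assms(2,1)])
    then show ?thesis by (simp add: height_def rho_scale[OF assms(2,1)])
  qed
  finally show ?thesis by (simp add: scale_left_diff_distrib)
qed

lemma height_lowered:
  assumes "highest_weight_vector scale K \<rho> \<mu> v\<^sub>0" "u \<in> lowered v\<^sub>0"
  shows "\<exists>d\<ge>1. height u = scale ((\<Sum>a = 1..K. of_nat a * \<mu> a) + of_nat d) u"
  using assms(2)
proof induction
  case (1 a b u)
  have "\<exists>d. height u = scale ((\<Sum>a = 1..K. of_nat a * \<mu> a) + of_nat d) u"
    using 1(4)
  proof
    assume "u = v\<^sub>0"
    then show ?thesis using height_highest[OF assms(1)] by (intro exI[of _ 0]) simp
  qed blast
  then obtain d where d: "height u = scale ((\<Sum>a = 1..K. of_nat a * \<mu> a) + of_nat d) u" ..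
  define h where "h = (\<Sum>a = 1..K. of_nat a * \<mu> a)"
  have "height (\<rho> b a u) = scale (h + of_nat d) (\<rho> b a u) + scale (of_nat b - of_nat a) (\<rho> b a u)"
    using height_rho[OF 1(1,2)] d by (simp only: rho_scale[OF 1(2,1)] h_def)
  also have "\<dots> = scale (h + of_nat d + (of_nat b - of_nat a)) (\<rho> b a u)"
    by (rule scale_left_distrib[symmetric])
  also have "h + of_nat d + (of_nat b - of_nat a) = h + of_nat (d + (b - a))"
    using 1(3) by (simp add: of_nat_diff)
  finally show ?case
    using 1(3) unfolding h_def by (intro exI[of _ "d + (b - a)"]) auto
qed

text \<open>If the eigenvalue of \<open>v\<^sub>0\<close> for the height is \<open>h\<close>, those of its images under products of lowering
  operators are \<open>h + d\<close> with \<open>d \<ge> 1\<close>. Given a combination of such images, the product of the operators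
  \<open>height - (h + d)\<close> for \<open>1 \<le> d \<le> D\<close> kills it when \<open>D\<close> is large, while it never kills \<open>v\<^sub>0\<close>.\<close>

lemma highest_notin_span_lowered:
  assumes hw: "highest_weight_vector scale K \<rho> \<mu> v\<^sub>0"
  shows "v\<^sub>0 \<notin> span (lowered v\<^sub>0)"
proof
  define h where "h = (\<Sum>a = 1..K. of_nat a * \<mu> a)"
  define P where "P = rec_nat (\<lambda>v. v) (\<lambda>D Q v. height (Q v) - scale (h + of_nat (Suc D)) (Q v))"
  have P_0: "P 0 v = v" and P_Suc: "P (Suc D) v = height (P D v) - scale (h + of_nat (Suc D)) (P D v)"
    for v D by (simp_all add: P_def)
  have P_add: "P D (v + w) = P D v + P D w" for D v w
    by (induction D) (simp_all add: P_0 P_Suc height_add scale_right_distrib)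
  have P_scale: "P D (scale c v) = scale c (P D v)" for D c v
    by (induction D) (simp_all add: P_0 P_Suc height_scale scale_right_diff_distrib mult.commute)
  have P_zero: "P D 0 = 0" for D
    using P_scale[of D 0 0] by simp
  have P_eigen: "P D v = scale (\<Prod>d' = 1..D. of_nat d - of_nat d') v"
    if "height v = scale (h + of_nat d) v" for D v d
  proof (induction D)
    case (Suc D)
    have "P (Suc D) v = scale (\<Prod>d' = 1..D. of_nat d - of_nat d')
        (height v - scale (h + of_nat (Suc D)) v)"
      unfolding P_Suc Suc by (simp add: height_scale scale_right_diff_distrib mult.commute)
    also have "height v - scale (h + of_nat (Suc D)) v = scale (of_nat d - of_nat (Suc D)) v"
      by (simp add: that scale_left_diff_distrib[symmetric])
    finally show ?case by (simp add: mult.commute)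
  qed (simp add: P_0)
  assume "v\<^sub>0 \<in> span (lowered v\<^sub>0)"
  then have "\<exists>D. P D v\<^sub>0 = 0"
  proof -
    have mono: "P D' u = 0" if "P D u = 0" "D \<le> D'" for D D' u
      using that(2,1) by (induction rule: dec_induct) (simp_all add: P_Suc height_def rho_0)
    have "subspace {u. \<exists>D. P D u = 0}"
      unfolding subspace_def
    proof (intro conjI ballI allI)
      fix u w assume "u \<in> {u. \<exists>D. P D u = 0}" "w \<in> {u. \<exists>D. P D u = 0}"
      then obtain D D' where "P D u = 0" "P D' w = 0" by auto
      then have "P (max D D') u = 0" "P (max D D') w = 0"
        using mono max.cobounded1 max.cobounded2 by blast+
      then have "P (max D D') (u + w) = 0" by (simp add: P_add)
      then show "u + w \<in> {u. \<exists>D. P D u = 0}" by blast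
    qed (auto simp: P_scale P_zero)
    moreover have "lowered v\<^sub>0 \<subseteq> {u. \<exists>D. P D u = 0}"
    proof
      fix u assume "u \<in> lowered v\<^sub>0"
      then obtain d where "d \<ge> 1" "height u = scale (h + of_nat d) u"
        using height_lowered[OF hw] h_def by blast
      moreover have "(\<Prod>d' = 1..d. of_nat d - of_nat d' :: complex) = 0"
        using \<open>d \<ge> 1\<close> by (intro prod_zero) (auto intro!: bexI[of _ d])
      ultimately have "P d u = 0" by (simp only: P_eigen scale_zero_left)
      then show "u \<in> {u. \<exists>D. P D u = 0}" by blast
    qed
    ultimately show ?thesis using \<open>v\<^sub>0 \<in> span (lowered v\<^sub>0)\<close> span_minimal by blast
  qed
  then obtain D where "P D v\<^sub>0 = 0" by blast
  moreover have "height v\<^sub>0 = scale (h + of_nat 0) v\<^sub>0"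
    using height_highest[OF hw] h_def by simp
  ultimately show False
    using hw P_eigen[of v\<^sub>0 0 D] by (auto simp: highest_weight_vector_def)
qed

end

subsection \<open>Noncommutative polynomials in the matrix units\<close>

text \<open>These expressions stand for elements of the universal enveloping algebra. They are used to
  transport a computation from one representation to another.\<close>

datatype uexp = Unit nat nat | Const complex | Plus uexp uexp | Times uexp uexp

primrec act :: "(complex \<Rightarrow> 'v \<Rightarrow> 'v) \<Rightarrow> (nat \<Rightarrow> nat \<Rightarrow> 'v \<Rightarrow> 'v) \<Rightarrow> uexp \<Rightarrow> 'v::ab_group_add \<Rightarrow> 'v" where
  "act scale \<rho> (Unit a b) v = \<rho> a b v"
| "act scale \<rho> (Const c) v = scale c v"
| "act scale \<rho> (Plus x y) v = act scale \<rho> x v + act scale \<rho> y v"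
| "act scale \<rho> (Times x y) v = act scale \<rho> x (act scale \<rho> y v)"

primrec units_in :: "nat \<Rightarrow> uexp \<Rightarrow> bool" where
  "units_in K (Unit a b) \<longleftrightarrow> a \<in> {1..K} \<and> b \<in> {1..K}"
| "units_in K (Const c) \<longleftrightarrow> True"
| "units_in K (Plus x y) \<longleftrightarrow> units_in K x \<and> units_in K y"
| "units_in K (Times x y) \<longleftrightarrow> units_in K x \<and> units_in K y"

primrec adjoint_exp :: "uexp \<Rightarrow> uexp" where
  "adjoint_exp (Unit a b) = Unit b a"
| "adjoint_exp (Const c) = Const (cnj c)"
| "adjoint_exp (Plus x y) = Plus (adjoint_exp x) (adjoint_exp y)"
| "adjoint_exp (Times x y) = Times (adjoint_exp y) (adjoint_exp x)"

primrec parity_part :: "nat \<Rightarrow> bool \<Rightarrow> uexp \<Rightarrow> uexp" where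
  "parity_part M s (Unit a b) = (if gl_odd M a b = s then Unit a b else Const 0)"
| "parity_part M s (Const c) = (if s then Const 0 else Const c)"
| "parity_part M s (Plus x y) = Plus (parity_part M s x) (parity_part M s y)"
| "parity_part M s (Times x y) =
     Plus (Times (parity_part M False x) (parity_part M s y))
       (Times (parity_part M True x) (parity_part M (\<not> s) y))"

lemma units_in_adjoint [simp]: "units_in K (adjoint_exp x) = units_in K x"
  by (induction x) auto

lemma units_in_parity_part: "units_in K x \<Longrightarrow> units_in K (parity_part M s x)"
  by (induction x arbitrary: s) auto

context gl_rep
begin

abbreviation acts :: "uexp \<Rightarrow> 'v \<Rightarrow> 'v" where
  "acts \<equiv> act scale \<rho>"

lemma act_add: "units_in K x \<Longrightarrow> acts x (v + w) = acts x v + acts x w"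
  by (induction x arbitrary: v w) (simp_all add: rho_add scale_right_distrib)

lemma act_scale: "units_in K x \<Longrightarrow> acts x (scale c v) = scale c (acts x v)"
  by (induction x arbitrary: v) (simp_all add: rho_scale scale_right_distrib mult.commute)

lemma act_0: "units_in K x \<Longrightarrow> acts x 0 = 0"
  using act_scale[of x 0 0] by simp

lemma act_parity_parts:
  "units_in K x \<Longrightarrow> acts x v = acts (parity_part M False x) v + acts (parity_part M True x) v"
proof (induction x arbitrary: v)
  case (Times x y)
  then show ?case
    by (simp add: act_add act_0 units_in_parity_part)
qed (auto simp: algebra_simps)

lemma act_span_lowered:
  assumes "highest_weight_vector scale K \<rho> \<mu> v\<^sub>0" "units_in K x"
    "u \<in> span (insert v\<^sub>0 (lowered v\<^sub>0))"
  shows "acts x u \<in> span (insert v\<^sub>0 (lowered v\<^sub>0))"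
  using assms(2,3)
  by (induction x arbitrary: u) (auto intro: span_add span_scale rho_span_lowered[OF assms(1)])

text \<open>By the triangular decomposition; this \<open>c\<close> is the coefficient of \<open>v\<^sub>0\<close> in \<open>x v\<^sub>0\<close>.\<close>

lemma act_highest:
  assumes "highest_weight_vector scale K \<rho> \<mu> v\<^sub>0" "units_in K x"
  shows "\<exists>c. acts x v\<^sub>0 - scale c v\<^sub>0 \<in> span (lowered v\<^sub>0)"
proof -
  have "acts x v\<^sub>0 \<in> span (insert v\<^sub>0 (lowered v\<^sub>0))"
    using assms by (intro act_span_lowered) (auto intro: span_base)
  then show ?thesis using span_breakdown_eq[of "acts x v\<^sub>0" v\<^sub>0] by blast
qed

end


context gl_rep
begin

lemma act_parity_part:
  assumes "\<And>s. subspace (G s)"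
    and "\<And>a b v s. a \<in> {1..K} \<Longrightarrow> b \<in> {1..K} \<Longrightarrow> v \<in> G s \<Longrightarrow> \<rho> a b v \<in> G (s \<noteq> gl_odd M a b)"
    and "units_in K x" "v \<in> G s"
  shows "acts (parity_part M t x) v \<in> G (s \<noteq> t)"
  using assms(3,4)
proof (induction x arbitrary: s t v)
  case (Unit a b)
  then show ?case using assms(2)[of a b v s] subspace_0[OF assms(1)] by auto
next
  case (Const c)
  then show ?case using subspace_0[OF assms(1)] subspace_scale[OF assms(1)] by auto
next
  case (Plus x y)
  then show ?case using subspace_add[OF assms(1)] by simp
next
  case (Times x y)
  have "acts (parity_part M False x) (acts (parity_part M t y) v) \<in> G ((s \<noteq> t) \<noteq> False)"
    using Times.prems by (intro Times.IH) auto
  moreover have "acts (parity_part M True x) (acts (parity_part M (\<not> t) y) v) \<in> G ((s \<noteq> (\<not> t)) \<noteq> True)"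
    using Times.prems by (intro Times.IH) auto
  moreover have "((s \<noteq> t) \<noteq> False) = (s \<noteq> t)" "((s \<noteq> (\<not> t)) \<noteq> True) = (s \<noteq> t)" by auto
  ultimately show ?case using subspace_add[OF assms(1)] by simp
qed

lemma highest_multiple_in_span_lowered:
  assumes "highest_weight_vector scale K \<rho> \<mu> v\<^sub>0" "scale c v\<^sub>0 \<in> span (lowered v\<^sub>0)"
  shows "c = 0"
proof (rule ccontr)
  assume "c \<noteq> 0"
  then have "scale (inverse c) (scale c v\<^sub>0) = v\<^sub>0" by simp
  then show False
    using highest_notin_span_lowered[OF assms(1)] span_scale[OF assms(2)] by metis
qed

end

subsection \<open>Two representations with the same highest weight\<close>

definition pair_scale ::
  "(complex \<Rightarrow> 'v \<Rightarrow> 'v) \<Rightarrow> (complex \<Rightarrow> 'w \<Rightarrow> 'w) \<Rightarrow> complex \<Rightarrow> 'v \<times> 'w \<Rightarrow> 'v \<times> 'w" where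
  "pair_scale sV sW c z = (sV c (fst z), sW c (snd z))"

definition pair_rep ::
  "(nat \<Rightarrow> nat \<Rightarrow> 'v \<Rightarrow> 'v) \<Rightarrow> (nat \<Rightarrow> nat \<Rightarrow> 'w \<Rightarrow> 'w) \<Rightarrow> nat \<Rightarrow> nat \<Rightarrow> 'v \<times> 'w \<Rightarrow> 'v \<times> 'w" where
  "pair_rep \<rho> R a b z = (\<rho> a b (fst z), R a b (snd z))"

locale two_gl_reps =
  V: gl_rep sV M K \<rho> + W: gl_rep sW M K R
  for sV :: "complex \<Rightarrow> 'v::ab_group_add \<Rightarrow> 'v" and sW :: "complex \<Rightarrow> 'w::ab_group_add \<Rightarrow> 'w"
    and M K \<rho> R +
  fixes \<mu> :: "nat \<Rightarrow> complex" and v\<^sub>0 :: 'v and w\<^sub>0 :: 'w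
  assumes hwV: "highest_weight_vector sV K \<rho> \<mu> v\<^sub>0"
    and hwW: "highest_weight_vector sW K R \<mu> w\<^sub>0"
begin

sublocale VW: gl_rep "pair_scale sV sW" M K "pair_rep \<rho> R"
proof
  fix a b c d :: nat and \<epsilon> :: complex and z :: "'v \<times> 'w"
  assume *: "a \<in> {1..K}" "b \<in> {1..K}" "c \<in> {1..K}" "d \<in> {1..K}"
    "\<epsilon> = (if gl_odd M a b \<and> gl_odd M c d then - 1 else 1)"
  show "pair_rep \<rho> R a b (pair_rep \<rho> R c d z) =
      pair_scale sV sW \<epsilon> (pair_rep \<rho> R c d (pair_rep \<rho> R a b z)) +
         ((if b = c then pair_rep \<rho> R a d z else 0) -
          (if a = d then pair_scale sV sW \<epsilon> (pair_rep \<rho> R c b z) else 0))"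
    using V.bracket[OF *, of "fst z"] W.bracket[OF *, of "snd z"]
    by (auto simp: pair_scale_def pair_rep_def prod_eq_iff)
qed (auto simp: pair_scale_def pair_rep_def V.rho_add V.rho_scale W.rho_add W.rho_scale
    V.scale_right_distrib V.scale_left_distrib W.scale_right_distrib W.scale_left_distrib
    prod_eq_iff)

lemma act_pair:
  "act (pair_scale sV sW) (pair_rep \<rho> R) x z = (act sV \<rho> x (fst z), act sW R x (snd z))"
  by (induction x arbitrary: z) (simp_all add: pair_scale_def pair_rep_def)

lemma hwVW: "highest_weight_vector (pair_scale sV sW) K (pair_rep \<rho> R) \<mu> (v\<^sub>0, w\<^sub>0)"
  using hwV hwW by (simp add: highest_weight_vector_def pair_scale_def pair_rep_def prod_eq_iff)

lemma lowered_pair: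
  "z \<in> VW.lowered (v\<^sub>0, w\<^sub>0) \<Longrightarrow> fst z \<in> V.lowered v\<^sub>0 \<and> snd z \<in> W.lowered w\<^sub>0"
proof (induction rule: VW.lowered.induct)
  case (1 a b u)
  then show ?case by (auto simp: pair_rep_def intro: V.lowered.intros W.lowered.intros)
qed

lemma span_lowered_pair:
  assumes "z \<in> VW.span (VW.lowered (v\<^sub>0, w\<^sub>0))"
  shows "fst z \<in> V.span (V.lowered v\<^sub>0)" "snd z \<in> W.span (W.lowered w\<^sub>0)"
proof -
  have "VW.subspace {z. fst z \<in> V.span (V.lowered v\<^sub>0) \<and> snd z \<in> W.span (W.lowered w\<^sub>0)}"
    by (auto simp: VW.subspace_def pair_scale_def intro: V.span_zero W.span_zero V.span_add W.span_add
        V.span_scale W.span_scale)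
  then have "VW.span (VW.lowered (v\<^sub>0, w\<^sub>0)) \<subseteq>
      {z. fst z \<in> V.span (V.lowered v\<^sub>0) \<and> snd z \<in> W.span (W.lowered w\<^sub>0)}"
    by (intro VW.span_minimal) (use lowered_pair in \<open>auto intro: V.span_base W.span_base\<close>)
  then show "fst z \<in> V.span (V.lowered v\<^sub>0)" "snd z \<in> W.span (W.lowered w\<^sub>0)"
    using assms by auto
qed

text \<open>The coefficient of the highest weight vector depends on the highest weight only. This is seen
  by computing in the direct sum of the two representations.\<close>

lemma act_highest_same:
  assumes "units_in K x"
  obtains c where "act sV \<rho> x v\<^sub>0 - sV c v\<^sub>0 \<in> V.span (V.lowered v\<^sub>0)"
    "act sW R x w\<^sub>0 - sW c w\<^sub>0 \<in> W.span (W.lowered w\<^sub>0)"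
proof -
  obtain c where c: "act (pair_scale sV sW) (pair_rep \<rho> R) x (v\<^sub>0, w\<^sub>0) -
      pair_scale sV sW c (v\<^sub>0, w\<^sub>0) \<in> VW.span (VW.lowered (v\<^sub>0, w\<^sub>0))"
    using VW.act_highest[OF hwVW assms] by blast
  show ?thesis
    using span_lowered_pair[OF c] by (intro that[of c]) (simp_all add: act_pair pair_scale_def)
qed

end

context gl_supermodule
begin

sublocale rep: gl_rep scale M "M + N" \<rho>
proof
  fix a b c d :: nat and \<epsilon> :: complex and v :: 'v
  assume *: "a \<in> {1..M + N}" "b \<in> {1..M + N}" "c \<in> {1..M + N}" "d \<in> {1..M + N}"
    "\<epsilon> = (if gl_odd M a b \<and> gl_odd M c d then - 1 else 1)"
  show "\<rho> a b (\<rho> c d v) = scale \<epsilon> (\<rho> c d (\<rho> a b v)) +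
      ((if b = c then \<rho> a d v else 0) - (if a = d then scale \<epsilon> (\<rho> c b v) else 0))"
    using superbracket[OF *(1-4) *(5)[unfolded gl_odd_def], of v] by (simp add: diff_eq_eq add.commute)
next
  fix a b :: nat and v w :: 'v
  assume "a \<in> {1..M + N}" "b \<in> {1..M + N}"
  then show "\<rho> a b (v + w) = \<rho> a b v + \<rho> a b w"
    using linear_action module_hom.add Vector_Spaces.linear.axioms(3) by (metis linear_iff_module_hom)
next
  fix a b :: nat and z :: complex and v :: 'v
  assume "a \<in> {1..M + N}" "b \<in> {1..M + N}"
  then show "\<rho> a b (scale z v) = scale z (\<rho> a b v)"
    using linear_action module_hom.scale by (metis linear_iff_module_hom)
qed

end

text \<open>An abstract irreducible module is compared with the submodule of the superalgebra generated by a
  vector \<open>f\<^sub>0\<close> of the same highest weight. The comparison is made on expressions in the matrix units, so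
  that the submodule itself does not have to be turned into a type.\<close>

locale embedded_comparison =
  irreducible_gl_supermodule scale M N G \<rho> + U: gl_rep sscale M "M + N" R
  for scale :: "complex \<Rightarrow> 'v::ab_group_add \<Rightarrow> 'v" and M N G \<rho> R +
  fixes \<mu> :: "nat \<Rightarrow> complex" and v\<^sub>0 :: 'v and f\<^sub>0 :: superpoly and p m n :: nat and s\<^sub>0 t\<^sub>0 :: bool
  assumes hwV: "highest_weight_vector scale (M + N) \<rho> \<mu> v\<^sub>0"
    and hwU: "highest_weight_vector sscale (M + N) R \<mu> f\<^sub>0"
    and v0_parity: "v\<^sub>0 \<in> G s\<^sub>0"
    and f0_parity: "f\<^sub>0 \<in> superpolys_parity p m n t\<^sub>0"
    and R_parity: "a \<in> {1..M + N} \<Longrightarrow> b \<in> {1..M + N} \<Longrightarrow> f \<in> superpolys_parity p m n s \<Longrightarrow>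
      R a b f \<in> superpolys_parity p m n (s \<noteq> gl_odd M a b)"
    and R_adjoint: "a \<in> {1..M + N} \<Longrightarrow> b \<in> {1..M + N} \<Longrightarrow> hform (R a b f) g = hform f (R b a g)"
begin

sublocale VU: two_gl_reps scale sscale M "M + N" \<rho> R \<mu> v\<^sub>0 f\<^sub>0
  by standard (fact hwV hwU)+

abbreviation units :: "uexp \<Rightarrow> bool" where "units \<equiv> units_in (M + N)"
abbreviation actV :: "uexp \<Rightarrow> 'v \<Rightarrow> 'v" where "actV \<equiv> act scale \<rho>"
abbreviation actU :: "uexp \<Rightarrow> superpoly \<Rightarrow> superpoly" where "actU \<equiv> act sscale R"

lemma act_adjoint: "units x \<Longrightarrow> hform (actU x f) g = hform f (actU (adjoint_exp x) g)"
  by (induction x arbitrary: f g)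
    (simp_all add: R_adjoint hform_add_left hform_add_right hform_sscale_left hform_sscale_right)

lemma lowered_orthogonal:
  assumes "s \<in> superpoly.span (U.lowered f\<^sub>0)" "\<And>a b. a \<in> {1..M+N} \<Longrightarrow> b \<in> {1..M+N} \<Longrightarrow> a < b \<Longrightarrow> R a b g = 0"
  shows "hform s g = 0"
proof -
  have "superpoly.subspace {s. hform s g = 0}"
    by (auto simp: superpoly.subspace_def hform_add_left hform_sscale_left)
  moreover have "U.lowered f\<^sub>0 \<subseteq> {s. hform s g = 0}"
  proof
    fix u assume "u \<in> U.lowered f\<^sub>0"
    then obtain a b w where "a \<in> {1..M + N}" "b \<in> {1..M + N}" "a < b" "u = R b a w"
      by (metis U.lowered.cases)
    then show "u \<in> {s. hform s g = 0}" using R_adjoint assms(2) by simp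
  qed
  ultimately show ?thesis using superpoly.span_minimal assms(1) by blast
qed

lemma subspace_parity: "superpoly.subspace (superpolys_parity p m n s)"
  by (auto simp: superpoly.subspace_def superpolys_parity_eq supp_in_add supp_in_sscale)

lemma actU_parity_part:
  "units x \<Longrightarrow> f \<in> superpolys_parity p m n s \<Longrightarrow>
    actU (parity_part M t x) f \<in> superpolys_parity p m n (s \<noteq> t)"
  by (rule U.act_parity_part[OF subspace_parity R_parity])

lemma actV_parity_part: "units x \<Longrightarrow> v \<in> G s \<Longrightarrow> actV (parity_part M t x) v \<in> G (s \<noteq> t)"
  by (rule rep.act_parity_part[OF subspace_G]) (use parity_action in \<open>auto simp: gl_odd_def\<close>)

text \<open>If \<open>x\<close> kills \<open>v\<^sub>0\<close>, then so does \<open>x\<^sup>* x\<close>. The coefficient of \<open>f\<^sub>0\<close> in \<open>x\<^sup>* x f\<^sub>0\<close> therefore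
  vanishes; but it is the square of the norm of \<open>x f\<^sub>0\<close>, up to a positive factor.\<close>

lemma act_eq_0_imp:
  assumes "units x" "actV x v\<^sub>0 = 0"
  shows "actU x f\<^sub>0 = 0"
proof -
  let ?z = "Times (adjoint_exp x) x"
  have z: "units ?z" "actV ?z v\<^sub>0 = 0" using assms by (simp_all add: rep.act_0)
  obtain c where c: "actV ?z v\<^sub>0 - scale c v\<^sub>0 \<in> span (rep.lowered v\<^sub>0)"
    "actU ?z f\<^sub>0 - sscale c f\<^sub>0 \<in> superpoly.span (U.lowered f\<^sub>0)"
    by (rule VU.act_highest_same[OF z(1)])
  have "scale (- c) v\<^sub>0 \<in> span (rep.lowered v\<^sub>0)" using c(1) by (simp only: z(2)) simp
  then have "c = 0" using rep.highest_multiple_in_span_lowered[OF hwV] by fastforce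
  then have "hform (actU ?z f\<^sub>0) f\<^sub>0 = 0"
    using lowered_orthogonal[OF c(2), of f\<^sub>0] U.highest_weight_raising[OF hwU] by simp
  then have "cnj (hform f\<^sub>0 (actU (adjoint_exp x) (actU x f\<^sub>0))) = 0"
    by (simp flip: hform_commute)
  then have "hform (actU x f\<^sub>0) (actU x f\<^sub>0) = 0"
    using assms(1) by (simp add: act_adjoint)
  then show ?thesis by (rule hform_self_eq_0)
qed

text \<open>Irreducibility is a condition on graded submodules. A set of expressions that is closed under taking
  homogeneous parts yields such a submodule, because \<open>v\<^sub>0\<close> is homogeneous.\<close>

lemma graded_invariant_subset:
  assumes "\<And>x y. Q x \<Longrightarrow> Q y \<Longrightarrow> Q (Plus x y)" "\<And>c x. Q x \<Longrightarrow> Q (Times (Const c) x)" "Q (Const 0)"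
    "\<And>a b x. a \<in> {1..M + N} \<Longrightarrow> b \<in> {1..M + N} \<Longrightarrow> Q x \<Longrightarrow> Q (Times (Unit a b) x)"
    "\<And>x t. Q x \<Longrightarrow> Q (parity_part M t x)" "\<And>x. Q x \<Longrightarrow> units x"
  shows "{actV x v\<^sub>0 |x. Q x} = {0} \<or> {actV x v\<^sub>0 |x. Q x} = UNIV"
proof (rule irreducible)
  let ?S = "{actV x v\<^sub>0 |x. Q x}"
  show "subspace ?S"
    unfolding subspace_def
  proof (intro conjI ballI allI)
    have "actV (Const 0) v\<^sub>0 \<in> ?S" using assms(3) by blast
    then show "0 \<in> ?S" by simp
  next
    fix u w assume "u \<in> ?S" "w \<in> ?S"
    then obtain x y where "Q x" "Q y" "u = actV x v\<^sub>0" "w = actV y v\<^sub>0" by blast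
    moreover from this have "actV (Plus x y) v\<^sub>0 \<in> ?S" using assms(1) by blast
    ultimately show "u + w \<in> ?S" by simp
  next
    fix c u assume "u \<in> ?S"
    then obtain x where "Q x" "u = actV x v\<^sub>0" by blast
    moreover from this have "actV (Times (Const c) x) v\<^sub>0 \<in> ?S" using assms(2) by blast
    ultimately show "scale c u \<in> ?S" by simp
  qed
  show "\<forall>u\<in>?S. \<exists>u\<^sub>0\<in>?S \<inter> G False. u - u\<^sub>0 \<in> G True"
  proof
    fix u assume "u \<in> ?S"
    then obtain x where x: "Q x" "u = actV x v\<^sub>0" by blast
    have parts: "actV (parity_part M t x) v\<^sub>0 \<in> G (s\<^sub>0 \<noteq> t)" for t
      using actV_parity_part[OF assms(6)[OF x(1)] v0_parity] .
    have "u = actV (parity_part M False x) v\<^sub>0 + actV (parity_part M True x) v\<^sub>0"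
      using rep.act_parity_parts[OF assms(6)[OF x(1)]] x by simp
    then have "u - actV (parity_part M s\<^sub>0 x) v\<^sub>0 = actV (parity_part M (\<not> s\<^sub>0) x) v\<^sub>0"
      by (cases s\<^sub>0) (simp_all add: algebra_simps)
    moreover have "actV (parity_part M (\<not> s\<^sub>0) x) v\<^sub>0 \<in> G True"
      using parts[of "\<not> s\<^sub>0"] by simp
    ultimately have "u - actV (parity_part M s\<^sub>0 x) v\<^sub>0 \<in> G True" by (simp only:)
    moreover have "actV (parity_part M s\<^sub>0 x) v\<^sub>0 \<in> ?S \<inter> G False"
      using parts[of s\<^sub>0] assms(5)[OF x(1)] by auto
    ultimately show "\<exists>u\<^sub>0\<in>?S \<inter> G False. u - u\<^sub>0 \<in> G True" by (rule bexI)
  qed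
  show "\<forall>a\<in>{1..M + N}. \<forall>b\<in>{1..M + N}. \<rho> a b ` ?S \<subseteq> ?S"
  proof (intro ballI subsetI)
    fix a b u assume ab: "a \<in> {1..M + N}" "b \<in> {1..M + N}" and "u \<in> \<rho> a b ` ?S"
    then obtain x where "Q x" "u = \<rho> a b (actV x v\<^sub>0)" by blast
    moreover from this have "actV (Times (Unit a b) x) v\<^sub>0 \<in> ?S" using assms(4)[OF ab] by blast
    ultimately show "u \<in> ?S" by simp
  qed
qed

text \<open>By irreducibility, as \<open>v\<^sub>0\<close> is among these vectors.\<close>

lemma act_generates: "\<exists>x. units x \<and> actV x v\<^sub>0 = v"
proof -
  have "{actV x v\<^sub>0 |x. units x} = {0} \<or> {actV x v\<^sub>0 |x. units x} = UNIV"
    by (rule graded_invariant_subset) (auto simp: units_in_parity_part)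
  moreover have "actV (Const 1) v\<^sub>0 \<in> {actV x v\<^sub>0 |x. units x}"
    by (intro CollectI exI[of _ "Const 1"]) simp
  then have "v\<^sub>0 \<in> {actV x v\<^sub>0 |x. units x}" by simp
  moreover have "v\<^sub>0 \<noteq> 0" using hwV by (simp add: highest_weight_vector_def)
  ultimately have "{actV x v\<^sub>0 |x. units x} = UNIV" by auto
  then have "v \<in> {actV x v\<^sub>0 |x. units x}" by (simp only: UNIV_I)
  then show ?thesis unfolding mem_Collect_eq by metis
qed

text \<open>For the converse, the vectors \<open>x v\<^sub>0\<close> with \<open>x f\<^sub>0 = 0\<close> form a graded submodule. It does not contain \<open>v\<^sub>0\<close>:
  the coefficient of the highest weight vector in \<open>x v\<^sub>0\<close> is the same as in \<open>x f\<^sub>0 = 0\<close>.\<close>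

lemma act_eq_0_iff:
  assumes "units x"
  shows "actV x v\<^sub>0 = 0 \<longleftrightarrow> actU x f\<^sub>0 = 0"
proof
  let ?Q = "\<lambda>x. units x \<and> actU x f\<^sub>0 = 0"
  assume x: "actU x f\<^sub>0 = 0"
  have part: "actU (parity_part M t x) f\<^sub>0 = 0" if "?Q x" for x t
  proof -
    have "actU (parity_part M t x) f\<^sub>0 = - actU (parity_part M (\<not> t) x) f\<^sub>0"
      using U.act_parity_parts[of x f\<^sub>0] that by (cases t) (simp_all add: eq_neg_iff_add_eq_0 add.commute)
    moreover have "actU (parity_part M (\<not> t) x) f\<^sub>0 \<in> superpolys_parity p m n (\<not> (t\<^sub>0 \<noteq> t))"
      using actU_parity_part[of x f\<^sub>0 t\<^sub>0 "\<not> t"] that f0_parity by (cases t; cases t\<^sub>0) simp_all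
    ultimately have "actU (parity_part M t x) f\<^sub>0 \<in> superpolys_parity p m n (\<not> (t\<^sub>0 \<noteq> t))"
      using superpoly.subspace_neg[OF subspace_parity] by (simp only:)
    moreover have "actU (parity_part M t x) f\<^sub>0 \<in> superpolys_parity p m n (t\<^sub>0 \<noteq> t)"
      using that f0_parity actU_parity_part by blast
    ultimately show ?thesis using superpolys_parity_disjoint by blast
  qed
  have "{actV x v\<^sub>0 |x. ?Q x} = {0} \<or> {actV x v\<^sub>0 |x. ?Q x} = UNIV"
    by (rule graded_invariant_subset) (auto simp: units_in_parity_part part U.rho_0)
  moreover have "v\<^sub>0 \<notin> {actV x v\<^sub>0 |x. ?Q x}"
  proof
    assume "v\<^sub>0 \<in> {actV x v\<^sub>0 |x. ?Q x}"
    then obtain x where x: "v\<^sub>0 = actV x v\<^sub>0" "units x" "actU x f\<^sub>0 = 0"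
      unfolding mem_Collect_eq by (elim exE conjE)
    obtain c where c: "actV x v\<^sub>0 - scale c v\<^sub>0 \<in> span (rep.lowered v\<^sub>0)"
      "actU x f\<^sub>0 - sscale c f\<^sub>0 \<in> superpoly.span (U.lowered f\<^sub>0)"
      by (rule VU.act_highest_same[OF x(2)])
    have "sscale (- c) f\<^sub>0 \<in> superpoly.span (U.lowered f\<^sub>0)" using c(2) x(3) by simp
    then have "c = 0" using U.highest_multiple_in_span_lowered[OF hwU, of "- c"] by simp
    then show False using c(1) x(1) rep.highest_notin_span_lowered[OF hwV] by simp
  qed
  ultimately have "{actV x v\<^sub>0 |x. ?Q x} = {0}" by auto
  moreover have "actV x v\<^sub>0 \<in> {actV x v\<^sub>0 |x. ?Q x}" using assms x by blast
  ultimately show "actV x v\<^sub>0 = 0" by simp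
qed (rule act_eq_0_imp[OF assms])

end

section \<open>Diagonal monomials\<close>

lemma coeff_xvar_mult:
  "coeff (xvar i l * f) (Poly_Mapping.single (i, l) 1 + \<beta>, A) = coeff f (\<beta>, A)"
proof (induction f rule: superpoly_induct)
  case (monom c k)
  show ?case by (cases k) (simp add: superpoly_mult_sscale xvar_smonom)
qed (simp_all add: superpoly_mult_0 superpoly_distrib)

lemma coeff_xvar_mult_0:
  assumes "Poly_Mapping.lookup \<beta> (i, l) = 0"
  shows "coeff (xvar i l * f) (\<beta>, A) = 0"
proof (induction f rule: superpoly_induct)
  case (monom c k)
  show ?case using assms
    by (cases k) (auto simp add: superpoly_mult_sscale xvar_smonom lookup_add)
qed (simp_all add: superpoly_mult_0 superpoly_distrib)

lemma single_add_diff: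
  fixes \<alpha> :: "var \<Rightarrow>\<^sub>0 nat"
  assumes "Poly_Mapping.lookup \<alpha> v \<noteq> 0"
  shows "\<alpha> = Poly_Mapping.single v 1 + (\<alpha> - Poly_Mapping.single v 1)"
  using assms by (intro poly_mapping_eqI) (auto simp: lookup_add lookup_minus lookup_single when_def)

lemma coeff_xder:
  "coeff (xder i l f) (\<beta>, A) =
     of_nat (Suc (Poly_Mapping.lookup \<beta> (i, l))) * coeff f (Poly_Mapping.single (i, l) 1 + \<beta>, A)"
proof (induction f rule: superpoly_induct)
  case (monom c k)
  obtain \<alpha> B where k: "k = (\<alpha>, B)" by (cases k)
  have eq: "Poly_Mapping.lookup \<alpha> (i, l) \<noteq> 0 \<and> \<alpha> - Poly_Mapping.single (i, l) 1 = \<beta> \<longleftrightarrow>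
      \<alpha> = Poly_Mapping.single (i, l) 1 + \<beta>"
  proof
    assume "Poly_Mapping.lookup \<alpha> (i, l) \<noteq> 0 \<and> \<alpha> - Poly_Mapping.single (i, l) 1 = \<beta>"
    then show "\<alpha> = Poly_Mapping.single (i, l) 1 + \<beta>"
      using single_add_diff[of \<alpha> "(i, l)"] by blast
  qed (auto simp: lookup_add)
  show ?case
  proof (cases "\<alpha> = Poly_Mapping.single (i, l) 1 + \<beta>")
    case True
    then show ?thesis
      by (simp add: k slinearD[OF slinear_xder[OF slinear_id]] xder_smonom lookup_add)
  next
    case False
    then have "Poly_Mapping.lookup \<alpha> (i, l) = 0 \<or> \<alpha> - Poly_Mapping.single (i, l) 1 \<noteq> \<beta>"
      using eq by blast
    then show ?thesis using False
      by (auto simp add: k slinearD[OF slinear_xder[OF slinear_id]] xder_smonom)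
  qed
qed (simp_all add: slinear_0[OF slinear_xder[OF slinear_id]] slinearD[OF slinear_xder[OF slinear_id]]
    algebra_simps)

lemma coeff_etavar_etader_0:
  assumes "\<And>A. coeff f (\<beta>, A) = 0"
  shows "coeff (etavar i k * etader j l f) (\<beta>, A) = 0"
proof -
  let ?Q = "\<lambda>k. fst k \<noteq> \<beta>"
  have "supp_in ?Q f" using assms by (force simp: supp_in_def)
  then have "supp_in ?Q (etader j l f)"
  proof (rule supp_in_slinear[OF slinear_etader[OF slinear_id]])
    fix k :: supermonom assume "?Q k"
    then show "supp_in ?Q (etader j l (smonom k))"
      by (cases k) (auto simp: etader_smonom intro: supp_in_sscale)
  qed
  then have "supp_in ?Q (etavar i k * etader j l f)"
  proof (rule supp_in_slinear[OF slinear_times_left[OF slinear_id]])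
    fix k' :: supermonom assume "?Q k'"
    then show "supp_in ?Q (etavar i k * smonom k')"
      by (cases k') (auto simp: etavar_smonom intro: supp_in_sscale)
  qed
  then show ?thesis by (force simp: supp_in_def)
qed

definition diag_degree :: "nat \<Rightarrow> (var \<Rightarrow>\<^sub>0 nat) \<Rightarrow> nat" where
  "diag_degree m \<alpha> = (\<Sum>s = 1..m. Poly_Mapping.lookup \<alpha> (s, s))"

lemma diag_degree_single_add:
  "diag_degree m (Poly_Mapping.single (i, l) 1 + \<alpha>) =
     diag_degree m \<alpha> + (if i = l \<and> i \<in> {1..m} then 1 else 0)"
proof -
  have "diag_degree m (Poly_Mapping.single (i, l) 1 + \<alpha>) =
      (\<Sum>s = 1..m. (if s = i then (if i = l then 1 else 0) else 0) + Poly_Mapping.lookup \<alpha> (s, s))"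
    unfolding diag_degree_def by (intro sum.cong) (auto simp: lookup_add lookup_single when_def)
  then show ?thesis by (simp add: sum.distrib diag_degree_def)
qed

text \<open>The operator \<open>x_s^j \<partial>/\<partial>x_l^i\<close> leads to the monomial in which one factor \<open>x_l^i\<close> of \<open>(\<alpha>, A)\<close> is exchanged
  for \<open>x_s^j\<close> only from \<open>(\<alpha>, A)\<close> itself.\<close>

lemma coeff_exchange:
  assumes "Poly_Mapping.lookup \<alpha> (i, l) \<noteq> 0"
  shows "coeff (xvar j s * xder i l f)
      (Poly_Mapping.single (j, s) 1 + (\<alpha> - Poly_Mapping.single (i, l) 1), A) =
    of_nat (Poly_Mapping.lookup \<alpha> (i, l)) * coeff f (\<alpha>, A)"
  using assms single_add_diff[OF assms] by (simp add: coeff_xvar_mult[simplified] coeff_xder lookup_minus)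

text \<open>Here \<open>d\<close> is the largest diagonal exponent of a monomial of \<open>f\<close>. A monomial which \<open>x_s^j \<partial>/\<partial>x_l^i\<close>
  carries to one of diagonal exponent \<open>d + 1\<close> has itself a diagonal exponent of at least \<open>d + 1\<close>, since
  the variable it gains is not diagonal.\<close>

lemma coeff_other_exchange:
  assumes max: "\<And>\<beta> B. coeff f (\<beta>, B) \<noteq> 0 \<Longrightarrow> diag_degree m \<beta> \<le> d"
    and \<gamma>: "diag_degree m \<gamma> = d" and b: "b \<in> {1..m}" and js: "j \<noteq> s"
  shows "coeff (xvar j s * xder i l f) (Poly_Mapping.single (b, b) 1 + \<gamma>, A) = 0"
proof (cases "Poly_Mapping.lookup (Poly_Mapping.single (b, b) 1 + \<gamma>) (j, s) = 0")
  case True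
  then show ?thesis by (rule coeff_xvar_mult_0)
next
  case False
  then have *: "Poly_Mapping.lookup \<gamma> (j, s) \<noteq> 0"
    using js by (auto simp: lookup_add lookup_single when_def split: if_splits)
  define \<delta> where "\<delta> = \<gamma> - Poly_Mapping.single (j, s) 1"
  have \<gamma>\<delta>: "\<gamma> = Poly_Mapping.single (j, s) 1 + \<delta>"
    unfolding \<delta>_def using * by (rule single_add_diff)
  have "diag_degree m \<delta> = d"
    using \<gamma> js unfolding \<gamma>\<delta> by (simp only: diag_degree_single_add) simp
  then have "diag_degree m (Poly_Mapping.single (i, l) 1 + (Poly_Mapping.single (b, b) 1 + \<delta>)) > d"
    using b by (simp only: diag_degree_single_add) simp
  then have "coeff f (Poly_Mapping.single (i, l) 1 + (Poly_Mapping.single (b, b) 1 + \<delta>), A) = 0"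
    using max by (meson not_le)
  then have "coeff (xder i l f) (Poly_Mapping.single (b, b) 1 + \<delta>, A) = 0"
    by (simp only: coeff_xder) simp
  then have "coeff (xvar j s * xder i l f)
      (Poly_Mapping.single (j, s) 1 + (Poly_Mapping.single (b, b) 1 + \<delta>), A) = 0"
    by (simp only: coeff_xvar_mult)
  moreover have "Poly_Mapping.single (b, b) 1 + \<gamma> =
      Poly_Mapping.single (j, s) 1 + (Poly_Mapping.single (b, b) 1 + \<delta>)"
    by (simp add: \<gamma>\<delta> add_ac)
  ultimately show ?thesis by (simp only:)
qed

text \<open>Among the monomials of \<open>f\<close> take one in which the diagonal variables \<open>x_s^s\<close> have the largest
  total exponent. If it contained \<open>x_l^i\<close> with \<open>i \<noteq> l\<close>, then a raising operator of \<open>gl(p)\<close> (for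
  \<open>l < i\<close>) or of \<open>gl(m)\<close> (for \<open>i < l\<close>) would exchange this variable for a diagonal one; no other
  monomial of \<open>f\<close> could cancel the result, for it would have a larger diagonal exponent.\<close>

lemma exists_diagonal_monomial:
  assumes "f \<in> superpolys p m n" "f \<noteq> 0" "m \<le> p"
    and glp: "\<And>i j. i \<in> {1..p} \<Longrightarrow> j \<in> {1..p} \<Longrightarrow> i < j \<Longrightarrow> glp_action m n i j f = 0"
    and glm: "\<And>a b. a \<in> {1..m} \<Longrightarrow> b \<in> {1..m} \<Longrightarrow> a < b \<Longrightarrow> glmn_action p m a b f = 0"
  obtains \<alpha> A where "coeff f (\<alpha>, A) \<noteq> 0"
    "\<And>i l. Poly_Mapping.lookup \<alpha> (i, l) \<noteq> 0 \<Longrightarrow> i = l"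
proof -
  have fin: "finite (diag_degree m ` fst ` support f)" by simp
  have ne: "support f \<noteq> {}"
    using assms(2) by (metis keys_eq_empty superpoly.expand superpoly.sel zero_superpoly_def)
  define d where "d = Max (diag_degree m ` fst ` support f)"
  have "d \<in> diag_degree m ` fst ` support f"
    unfolding d_def by (rule Max_in) (use ne in auto)
  then obtain \<alpha> A where \<alpha>: "coeff f (\<alpha>, A) \<noteq> 0" "diag_degree m \<alpha> = d"
    by (auto simp: in_support_iff)
  have max: "diag_degree m \<beta> \<le> d" if "coeff f (\<beta>, B) \<noteq> 0" for \<beta> B
    unfolding d_def using that by (intro Max_ge fin) (force simp: in_support_iff)
  have "i = l" if il: "Poly_Mapping.lookup \<alpha> (i, l) \<noteq> 0" for i l
  proof (rule ccontr)
    assume neq: "i \<noteq> l"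
    have "in_vars p m n (\<alpha>, A)" using assms(1) \<alpha>(1) by (simp add: superpolys_eq supp_in_def)
    moreover have "(i, l) \<in> Poly_Mapping.keys \<alpha>" using il by (simp add: in_keys_iff)
    ultimately have i: "i \<in> {1..p}" and l: "l \<in> {1..m}"
      by (auto simp: in_vars_def)
    define \<gamma> where "\<gamma> = \<alpha> - Poly_Mapping.single (i, l) 1"
    have \<alpha>\<gamma>: "\<alpha> = Poly_Mapping.single (i, l) 1 + \<gamma>"
      unfolding \<gamma>_def using il by (rule single_add_diff)
    have \<gamma>: "diag_degree m \<gamma> = d"
      using \<alpha>(2) neq unfolding \<alpha>\<gamma> by (simp only: diag_degree_single_add) simp
    have big: "coeff f (Poly_Mapping.single (b, b) 1 + \<gamma>, B) = 0" if "b \<in> {1..m}" for b B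
    proof -
      have "diag_degree m (Poly_Mapping.single (b, b) 1 + \<gamma>) > d"
        using that \<gamma> by (simp only: diag_degree_single_add) simp
      then show ?thesis using max by (meson not_le)
    qed
    show False
    proof (cases "l < i")
      case True
      let ?T = "(Poly_Mapping.single (l, l) 1 + \<gamma>, A)"
      have "0 = coeff (glp_action m n l i f) ?T"
        using glp[of l i] True i l assms(3) by simp
      also have "\<dots> = (\<Sum>s = 1..m. coeff (xvar l s * xder i s f) ?T) +
          (\<Sum>k = 1..n. coeff (etavar l k * etader i k f) ?T)"
        by (simp add: glp_action_def)
      also have "(\<Sum>k = 1..n. coeff (etavar l k * etader i k f) ?T) = 0"
        using big[OF l] by (intro sum.neutral ballI coeff_etavar_etader_0)
      also have "(\<Sum>s = 1..m. coeff (xvar l s * xder i s f) ?T) =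
          (\<Sum>s = 1..m. if s = l then of_nat (Poly_Mapping.lookup \<alpha> (i, l)) * coeff f (\<alpha>, A) else 0)"
        using coeff_exchange[OF il, of l l] coeff_other_exchange[OF max \<gamma> l]
        by (intro sum.cong) (auto simp: \<gamma>_def)
      finally show False using l il \<alpha>(1) by simp
    next
      case False
      then have "i < l" using neq by simp
      then have i': "i \<in> {1..m}" using i l by auto
      let ?T = "(Poly_Mapping.single (i, i) 1 + \<gamma>, A)"
      have "0 = coeff (glmn_action p m i l f) ?T"
        using glm[of i l] \<open>i < l\<close> i' l by simp
      also have "\<dots> = (\<Sum>j = 1..p. coeff (xvar j i * xder j l f) ?T)"
        using i' l by (simp add: glmn_action_def zvar_def zder_def)
      also have "\<dots> = (\<Sum>j = 1..p. if j = i then of_nat (Poly_Mapping.lookup \<alpha> (i, l)) * coeff f (\<alpha>, A) else 0)"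
        using coeff_exchange[OF il, of i i] coeff_other_exchange[OF max \<gamma> i']
        by (intro sum.cong) (auto simp: \<gamma>_def)
      finally show False using i il \<alpha>(1) by simp
    qed
  qed
  with \<alpha>(1) show ?thesis by (intro that[of \<alpha> A]) auto
qed

subsection \<open>Weights of monomials\<close>

definition zdegree :: "nat \<Rightarrow> nat \<Rightarrow> nat \<Rightarrow> supermonom \<Rightarrow> nat" where
  "zdegree m a i k = (if a \<le> m then Poly_Mapping.lookup (fst k) (i, a)
     else if (i, a - m) |\<in>| snd k then 1 else 0)"

lemma minus_one_power_square: "(-1 :: complex) ^ x * (-1) ^ x = 1"
  by (simp flip: power_mult_distrib)

lemma zvar_zder_smonom:
  "zvar m a i * zder m a i (smonom k) = sscale (of_nat (zdegree m a i k)) (smonom k)"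
proof -
  obtain \<alpha> A where k: "k = (\<alpha>, A)" by (cases k)
  show ?thesis
  proof (cases "a \<le> m")
    case True
    then show ?thesis using single_add_diff[of \<alpha> "(i, a)"]
      by (cases "Poly_Mapping.lookup \<alpha> (i, a) = 0")
        (simp_all add: k zvar_def zder_def op_smonom superpoly_mult_sscale zdegree_def)
  next
    case False
    show ?thesis
    proof (cases "(i, a - m) |\<in>| A")
      case True
      define B where "B = A |-| {|(i, a - m)|}"
      have "A = finsert (i, a - m) B" "(i, a - m) |\<notin>| B" using True by (auto simp: B_def)
      moreover from this have "finsert (i, a - m) B |-| {|(i, a - m)|} = B" by auto
      ultimately show ?thesis using False
        by (simp add: k zvar_def zder_def op_smonom superpoly_mult_sscale zdegree_def sscale_sscale
            before_finsert minus_one_power_square)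
    qed (use False in \<open>simp add: k zvar_def zder_def op_smonom superpoly_mult_sscale zdegree_def\<close>)
  qed
qed

lemma coeff_zvar_zder: "coeff (zvar m a i * zder m a i f) k = of_nat (zdegree m a i k) * coeff f k"
proof (induction f rule: superpoly_induct)
  case (monom c k')
  then show ?case by (simp add: zder_sscale superpoly_mult_sscale zvar_zder_smonom)
qed (simp_all add: zder_0 zder_add distrib_left)

lemma glp_weight_monomial:
  assumes "glp_action m n i i f = sscale c f" "coeff f k \<noteq> 0"
  shows "c = of_nat (\<Sum>a = 1..m + n. zdegree m a i k)"
  using arg_cong[OF assms(1), of "\<lambda>f. coeff f k"] assms(2)
  by (simp add: glp_action_zsum coeff_zvar_zder sum_distrib_right[symmetric])

lemma glmn_weight_monomial:
  assumes "glmn_action p m a a f = sscale c f" "coeff f k \<noteq> 0"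
  shows "c = of_nat (\<Sum>j = 1..p. zdegree m a j k)"
  using arg_cong[OF assms(1), of "\<lambda>f. coeff f k"] assms(2)
  by (simp add: glmn_action_def coeff_zvar_zder sum_distrib_right[symmetric])

lemma sum_zdegree_split:
  "(\<Sum>a = 1..m + n. zdegree m a i (\<alpha>, A)) =
     (\<Sum>l = 1..m. Poly_Mapping.lookup \<alpha> (i, l)) + card {k \<in> {1..n}. (i, k) |\<in>| A}"
proof -
  have "(\<Sum>a = 1..m + n. zdegree m a i (\<alpha>, A)) =
      (\<Sum>a = 1..m. zdegree m a i (\<alpha>, A)) + (\<Sum>a = 1 + m..n + m. zdegree m a i (\<alpha>, A))"
    by (subst sum.ub_add_nat) (simp_all add: add.commute)
  also have "(\<Sum>a = 1 + m..n + m. zdegree m a i (\<alpha>, A)) = (\<Sum>k = 1..n. zdegree m (k + m) i (\<alpha>, A))"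
    by (rule sum.shift_bounds_cl_nat_ivl)
  also have "\<dots> = (\<Sum>k = 1..n. if (i, k) |\<in>| A then 1 else 0)"
    by (intro sum.cong) (auto simp: zdegree_def)
  also have "\<dots> = card {k \<in> {1..n}. (i, k) |\<in>| A}"
    by (simp add: sum.If_cases Int_def)
  finally show ?thesis by (simp add: zdegree_def)
qed

text \<open>The weights of a vector killed by the raising operators of \<open>gl(p)\<close> and \<open>gl(m)\<close>, read off from a
  monomial with diagonal even part: \<open>c\<close> is the sequence of its diagonal exponents, \<open>A\<close> its odd part.\<close>

lemma weights_of_diagonal_monomial:
  assumes "f \<in> superpolys p m n" "f \<noteq> 0" "m \<le> p"
    and "\<And>i j. i \<in> {1..p} \<Longrightarrow> j \<in> {1..p} \<Longrightarrow> i < j \<Longrightarrow> glp_action m n i j f = 0"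
    and "\<And>a b. a \<in> {1..m} \<Longrightarrow> b \<in> {1..m} \<Longrightarrow> a < b \<Longrightarrow> glmn_action p m a b f = 0"
    and lam: "\<And>i. i \<in> {1..p} \<Longrightarrow> glp_action m n i i f = sscale (lam i) f"
    and nu: "\<And>a. a \<in> {1..m + n} \<Longrightarrow> glmn_action p m a a f = sscale (\<nu> a) f"
  obtains c :: "nat \<Rightarrow> nat" and A :: "var fset" where
    "\<And>a. a \<in> {1..m} \<Longrightarrow> \<nu> a = of_nat (c a)"
    "\<And>i. i \<in> {1..m} \<Longrightarrow> lam i = of_nat (c i + card {k \<in> {1..n}. (i, k) |\<in>| A})"
    "\<And>i. i \<in> {m + 1..p} \<Longrightarrow> lam i = of_nat (card {k \<in> {1..n}. (i, k) |\<in>| A})"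
    "\<And>k. k \<in> {1..n} \<Longrightarrow> \<nu> (m + k) = of_nat (card {i \<in> {1..p}. (i, k) |\<in>| A})"
proof -
  obtain \<alpha> A where \<alpha>: "coeff f (\<alpha>, A) \<noteq> 0"
    and diag: "\<And>i l. Poly_Mapping.lookup \<alpha> (i, l) \<noteq> 0 \<Longrightarrow> i = l"
    using exists_diagonal_monomial[OF assms(1-5)] by blast
  have row: "(\<Sum>l = 1..m. Poly_Mapping.lookup \<alpha> (i, l)) =
      (if i \<in> {1..m} then Poly_Mapping.lookup \<alpha> (i, i) else 0)" for i
  proof -
    have "(\<Sum>l = 1..m. Poly_Mapping.lookup \<alpha> (i, l)) =
        (\<Sum>l = 1..m. if l = i then Poly_Mapping.lookup \<alpha> (i, i) else 0)"
      using diag by (intro sum.cong) auto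
    then show ?thesis by simp
  qed
  have col: "(\<Sum>j = 1..p. Poly_Mapping.lookup \<alpha> (j, l)) = Poly_Mapping.lookup \<alpha> (l, l)"
    if "l \<in> {1..m}" for l
  proof -
    have "(\<Sum>j = 1..p. Poly_Mapping.lookup \<alpha> (j, l)) =
        (\<Sum>j = 1..p. if j = l then Poly_Mapping.lookup \<alpha> (l, l) else 0)"
      using diag by (intro sum.cong) auto
    then show ?thesis using that assms(3) by simp
  qed
  have lam': "lam i = of_nat ((if i \<in> {1..m} then Poly_Mapping.lookup \<alpha> (i, i) else 0) +
      card {k \<in> {1..n}. (i, k) |\<in>| A})" if "i \<in> {1..p}" for i
    using glp_weight_monomial[OF lam[OF that] \<alpha>] by (simp only: sum_zdegree_split row)
  have nu_even: "\<nu> a = of_nat (Poly_Mapping.lookup \<alpha> (a, a))" if "a \<in> {1..m}" for a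
    using glmn_weight_monomial[OF nu \<alpha>, of a] that col[OF that]
    by (simp add: zdegree_def flip: of_nat_sum)
  have nu_odd: "\<nu> (m + k) = of_nat (card {i \<in> {1..p}. (i, k) |\<in>| A})" if "k \<in> {1..n}" for k
  proof -
    have "\<nu> (m + k) = of_nat (\<Sum>j = 1..p. if (j, k) |\<in>| A then 1 else 0)"
      using glmn_weight_monomial[OF nu \<alpha>, of "m + k"] that by (simp add: zdegree_def)
    then show ?thesis by (simp add: sum.If_cases Int_def)
  qed
  show ?thesis
  proof (rule that[of "\<lambda>a. Poly_Mapping.lookup \<alpha> (a, a)" A])
    fix i assume "i \<in> {1..m}"
    then show "lam i = of_nat (Poly_Mapping.lookup \<alpha> (i, i) + card {k \<in> {1..n}. (i, k) |\<in>| A})"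
      using lam'[of i] assms(3) by auto
  next
    fix i assume "i \<in> {m + 1..p}"
    then show "lam i = of_nat (card {k \<in> {1..n}. (i, k) |\<in>| A})"
      using lam'[of i] by auto
  qed (use nu_even nu_odd in auto)
qed


section \<open>Young diagrams and highest weights\<close>

definition row_lengths :: "(nat \<Rightarrow> complex) \<Rightarrow> (nat \<Rightarrow> nat) \<Rightarrow> bool" where
  "row_lengths lam L \<longleftrightarrow> (\<forall>i\<ge>1. lam i = of_nat (L i)) \<and>
     (\<forall>i j. 1 \<le> i \<longrightarrow> i \<le> j \<longrightarrow> L j \<le> L i) \<and> finite {i. 1 \<le> i \<and> L i \<noteq> 0}"

lemma young_diagram_row_lengths:
  assumes "young_diagram lam"
  obtains L where "row_lengths lam L"
proof -
  have "\<exists>k. lam i = of_nat k" if "i \<ge> 1" for i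
    using assms that by (auto simp: young_diagram_def Nats_def)
  then obtain L :: "nat \<Rightarrow> nat" where L: "\<And>i. i \<ge> 1 \<Longrightarrow> lam i = of_nat (L i)" by metis
  have step: "L (Suc i) \<le> L i" if "i \<ge> 1" for i
  proof -
    have "Re (lam (i + 1)) \<le> Re (lam i)" using assms that by (simp add: young_diagram_def)
    then show ?thesis using that by (simp add: L)
  qed
  have anti: "L j \<le> L i" if "1 \<le> i" "i \<le> j" for i j
    using that(2)
  proof (induction rule: dec_induct)
    case (step k)
    then show ?case using \<open>\<And>i. i \<ge> 1 \<Longrightarrow> L (Suc i) \<le> L i\<close>[of k] that(1) by simp
  qed simp
  have "{i. 1 \<le> i \<and> L i \<noteq> 0} = {i. 1 \<le> i \<and> lam i \<noteq> 0}" using L by auto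
  then have "row_lengths lam L"
    using assms L anti by (simp add: row_lengths_def young_diagram_def)
  then show ?thesis by (rule that)
qed

lemma row_lengthsD:
  assumes "row_lengths lam L"
  shows "i \<ge> 1 \<Longrightarrow> lam i = of_nat (L i)" "1 \<le> i \<Longrightarrow> i \<le> j \<Longrightarrow> L j \<le> L i"
    "finite {i. 1 \<le> i \<and> L i \<noteq> 0}"
  using assms by (simp_all add: row_lengths_def)

lemma transpose_row_lengths:
  assumes "row_lengths lam L"
  shows "transpose_diagram lam j = card {i. 1 \<le> i \<and> j \<le> L i}"
  unfolding transpose_diagram_def
  using row_lengthsD(1)[OF assms] by (intro arg_cong[of _ _ card]) auto

lemma diagram_length_eq_first_column:
  assumes "row_lengths lam L"
  shows "diagram_length lam = transpose_diagram lam 1"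
  unfolding diagram_length_def transpose_row_lengths[OF assms]
  using row_lengthsD(1)[OF assms] by (intro arg_cong[of _ _ card]) auto

lemma column_eq_interval:
  assumes L: "row_lengths lam L" and "j \<ge> 1"
  shows "{i. 1 \<le> i \<and> j \<le> L i} = {1..transpose_diagram lam j}"
proof -
  let ?S = "{i. 1 \<le> i \<and> j \<le> L i}"
  have "finite ?S" by (rule finite_subset[OF _ row_lengthsD(3)[OF L]]) (use assms(2) in auto)
  have "\<exists>k. ?S = {1..k}"
  proof (cases "?S = {}")
    case False
    have "?S = {1..Max ?S}"
    proof
      show "?S \<subseteq> {1..Max ?S}" using \<open>finite ?S\<close> by auto
      show "{1..Max ?S} \<subseteq> ?S"
      proof
        fix i assume i: "i \<in> {1..Max ?S}"
        have "Max ?S \<in> ?S" using Max_in[OF \<open>finite ?S\<close> False] .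
        then have "j \<le> L (Max ?S)" by blast
        also have "L (Max ?S) \<le> L i" using i by (intro row_lengthsD(2)[OF L]) auto
        finally show "i \<in> ?S" using i by auto
      qed
    qed
    then show ?thesis by blast
  qed (intro exI[of _ 0], simp)
  then obtain k where "?S = {1..k}" by blast
  then show ?thesis by (simp add: transpose_row_lengths[OF L])
qed

lemma le_transpose_iff:
  assumes "row_lengths lam L" "i \<ge> 1" "j \<ge> 1"
  shows "i \<le> transpose_diagram lam j \<longleftrightarrow> j \<le> L i"
proof -
  have "i \<in> {i. 1 \<le> i \<and> j \<le> L i} \<longleftrightarrow> i \<in> {1..transpose_diagram lam j}"
    by (simp only: column_eq_interval[OF assms(1,3)])
  then show ?thesis using assms(2) by simp
qed

text \<open>As \<open>E_{i,i+1}\<close> kills \<open>f\<close>, the squared norm of \<open>E_{i+1,i} f\<close> is that of \<open>f\<close> times the difference of the weights.\<close>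

lemma highest_weight_dominant:
  assumes "highest_weight_vector sscale p (glp_action m n) lam f" "1 \<le> i" "i < p"
  shows "Re (lam (Suc i)) \<le> Re (lam i)"
proof -
  let ?g = "glp_action m n (Suc i) i f"
  have f: "f \<noteq> 0" "glp_action m n i i f = sscale (lam i) f"
    "glp_action m n (Suc i) (Suc i) f = sscale (lam (Suc i)) f"
    using assms by (auto simp: highest_weight_vector_def)
  have "Suc i \<in> {2..p}" using assms by auto
  then have "glp_action m n (Suc i - 1) (Suc i) f = 0"
    using assms(1) unfolding highest_weight_vector_def by blast
  then have "glp_action m n i (Suc i) ?g = sscale (lam i - lam (Suc i)) f"
    using glp_bracket[of m n i "Suc i" "Suc i" i f] f
    by (simp add: slinear_0[OF slinear_glp[OF slinear_id]] superpoly.scale_left_diff_distrib)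
  then have "hform ?g ?g = (lam i - lam (Suc i)) * hform f f"
    by (simp add: hform_sscale_left flip: glp_adjoint[of m n i])
  moreover have "Im (hform f f) = 0"
    using arg_cong[OF hform_commute[of f f], of Im] by simp
  ultimately have "Re (hform ?g ?g) = (Re (lam i) - Re (lam (Suc i))) * Re (hform f f)"
    by simp
  then have "0 \<le> (Re (lam i) - Re (lam (Suc i))) * Re (hform f f)"
    using hform_nonneg[of ?g] by simp
  then show ?thesis
    using hform_pos[OF f(1)] by (simp add: zero_le_mult_iff)
qed

interpretation glp: gl_rep sscale p p "glp_action m n" for p m n
proof
  fix a b c d :: nat and \<epsilon> :: complex and f :: superpoly
  assume "a \<in> {1..p}" "b \<in> {1..p}" "c \<in> {1..p}" "d \<in> {1..p}"
    "\<epsilon> = (if gl_odd p a b \<and> gl_odd p c d then - 1 else 1)"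
  then have "\<epsilon> = 1" by (simp add: gl_odd_def)
  then show "glp_action m n a b (glp_action m n c d f) =
      sscale \<epsilon> (glp_action m n c d (glp_action m n a b f)) +
      ((if b = c then glp_action m n a d f else 0) -
       (if a = d then sscale \<epsilon> (glp_action m n c b f) else 0))"
    using glp_bracket[of m n a b c d f] by (simp only: diff_eq_eq sscale_simps) (simp only: add.commute)
qed (simp_all add: slinearD[OF slinear_glp[OF slinear_id]])

interpretation glmn: gl_rep sscale m "m + n" "glmn_action p m" for p m n
  by standard
    (simp_all add: slinearD[OF slinear_glmn[OF slinear_id]] glmn_superbracket[symmetric] gl_odd_def)

lemma slinear_rules:
  "glp_action m n i j 0 = 0" "glmn_action p m a b 0 = 0"
  "glp_action m n i j (sscale c f) = sscale c (glp_action m n i j f)"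
  "glmn_action p m a b (sscale c f) = sscale c (glmn_action p m a b f)"
  by (simp_all add: slinear_0[OF slinear_glmn[OF slinear_id]] slinearD[OF slinear_glmn[OF slinear_id]]
      slinear_0[OF slinear_glp[OF slinear_id]] slinearD[OF slinear_glp[OF slinear_id]])

text \<open>In the diagonal monomial of a joint highest weight vector, the even part accounts for the first
  \<open>m\<close> rows of \<open>\<lambda>\<close>. Its odd part hence lies in the rows below, each of which has only \<open>n\<close> variables, so
  that \<open>\<lambda>_{m+1} \<le> n\<close>; and each column contains at most \<open>p - m\<close> odd variables, which bounds the length.\<close>

lemma joint_highest_weight_is_hook:
  assumes "m < p" and young: "young_diagram lam \<or> (\<forall>i>p. lam i = 0)"
    and joint: "joint_highest_weight_vector p m n lam f"
  shows "young_diagram lam \<and> diagram_length lam \<le> p \<and> Re (lam (m + 1)) \<le> real n"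
proof -
  have f: "f \<in> superpolys p m n" and hwp: "highest_weight_vector sscale p (glp_action m n) lam f"
    and hwm: "highest_weight_vector sscale (m + n) (glmn_action p m) (glmn_weight m lam) f"
    using joint by (simp_all add: joint_highest_weight_vector_def)
  have "f \<noteq> 0" using hwp by (simp add: highest_weight_vector_def)
  obtain c A where A:
    "\<And>a. a \<in> {1..m} \<Longrightarrow> glmn_weight m lam a = of_nat (c a)"
    "\<And>i. i \<in> {1..m} \<Longrightarrow> lam i = of_nat (c i + card {k \<in> {1..n}. (i, k) |\<in>| A})"
    "\<And>i. i \<in> {m + 1..p} \<Longrightarrow> lam i = of_nat (card {k \<in> {1..n}. (i, k) |\<in>| A})"
    "\<And>k. k \<in> {1..n} \<Longrightarrow> glmn_weight m lam (m + k) = of_nat (card {i \<in> {1..p}. (i, k) |\<in>| A})"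
  proof (rule weights_of_diagonal_monomial[OF f \<open>f \<noteq> 0\<close> less_imp_le[OF assms(1)]])
    show "glmn_action p m a b f = 0" if "a \<in> {1..m}" "b \<in> {1..m}" "a < b" for a b
      by (rule glmn.highest_weight_raising[OF hwm]) (use that in auto)
  qed (use glp.highest_weight_raising[OF hwp] hwp hwm in
      \<open>auto simp: highest_weight_vector_def\<close>)
  have rows: "card {k \<in> {1..n}. (i, k) |\<in>| A} = 0" if i: "i \<in> {1..m}" for i
  proof -
    have "(of_nat (c i) :: complex) = of_nat (c i + card {k \<in> {1..n}. (i, k) |\<in>| A})"
      using A(1,2)[OF i] i by (simp add: glmn_weight_def)
    then show ?thesis by (simp only: of_nat_eq_iff)
  qed
  have "card {k \<in> {1..n}. (m + 1, k) |\<in>| A} \<le> card {1..n}" by (intro card_mono) auto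
  then have hook: "Re (lam (m + 1)) \<le> real n" using A(3)[of "m + 1"] assms(1) by simp
  have nat: "lam i \<in> \<nat>" if "i \<in> {1..p}" for i
  proof (cases "i \<le> m")
    case True
    show ?thesis by (subst A(2)) (use that True in \<open>auto intro: of_nat_in_Nats simp del: of_nat_add\<close>)
  next
    case False
    show ?thesis by (subst A(3)) (use that False in auto)
  qed
  show ?thesis
  proof (cases "\<forall>i>p. lam i = 0")
    case True
    have "Re (lam (i + 1)) \<le> Re (lam i) \<and> lam i \<in> \<nat>" if "i \<ge> 1" for i
    proof (cases "i < p")
      case True
      then show ?thesis using highest_weight_dominant[OF hwp that] nat that by simp
    next
      case False
      have "0 \<le> Re (lam i)" and "lam i \<in> \<nat>"
        using nat[of i] True that False by (cases "i = p"; auto elim!: Nats_cases)+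
      then show ?thesis using True False by simp
    qed
    moreover have sub: "{i. 1 \<le> i \<and> lam i \<noteq> 0} \<subseteq> {1..p}"
      using True by (auto simp: not_le[symmetric])
    moreover have "card {i. 1 \<le> i \<and> lam i \<noteq> 0} \<le> card {1..p}"
      using sub by (intro card_mono) auto
    ultimately show ?thesis
      using hook by (auto simp: young_diagram_def diagram_length_def intro: finite_subset)
  next
    case False
    then have yd: "young_diagram lam" using young by blast
    then obtain L where L: "row_lengths lam L" by (rule young_diagram_row_lengths)
    have "diagram_length lam \<le> p"
    proof (rule ccontr)
      assume "\<not> diagram_length lam \<le> p"
      then have long: "diagram_length lam > p" by simp
      then have "1 \<le> L (p + 1)"
        using le_transpose_iff[OF L, of "p + 1" 1] diagram_length_eq_first_column[OF L] by simp
      then have "1 \<le> L (m + 1)" using row_lengthsD(2)[OF L, of "m + 1" "p + 1"] assms(1) by simp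
      then have "n \<ge> 1" using hook row_lengthsD(1)[OF L, of "m + 1"] by simp
      have "{i \<in> {1..p}. (i, 1) |\<in>| A} \<subseteq> {m + 1..p}"
      proof
        fix i assume i: "i \<in> {i \<in> {1..p}. (i, 1) |\<in>| A}"
        have "i > m"
        proof (rule ccontr)
          assume "\<not> i > m"
          then have "{k \<in> {1..n}. (i, k) |\<in>| A} = {}" using rows[of i] i by simp
          then show False using i \<open>n \<ge> 1\<close> by auto
        qed
        then show "i \<in> {m + 1..p}" using i by simp
      qed
      then have "card {i \<in> {1..p}. (i, 1) |\<in>| A} \<le> card {m + 1..p}"
        by (intro card_mono) auto
      moreover have "transpose_diagram lam 1 - m = card {i \<in> {1..p}. (i, 1) |\<in>| A}"
        using A(4)[of 1] \<open>n \<ge> 1\<close> by (simp add: glmn_weight_def)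
      ultimately show False
        using long assms(1) diagram_length_eq_first_column[OF L] by simp
    qed
    then show ?thesis using yd hook by simp
  qed
qed

text \<open>Conversely, the highest weight conditions for \<open>gl(p)\<close> and \<open>gl(m)\<close> and the weights suffice: if a
  positive root vector of \<open>gl(m|n)\<close> that is not in \<open>gl(m)\<close> did not kill \<open>f\<close>, it would give a vector
  whose weights contradict the existence of a diagonal monomial. For \<open>a \<le> m < b\<close>, the exponent of the
  \<open>a\<close>-th diagonal variable would be larger than \<open>\<lambda>_a\<close>.\<close>

locale even_highest_weight_vector =
  fixes p m n :: nat and lam :: "nat \<Rightarrow> complex" and f :: superpoly
  assumes mp: "m \<le> p" and f: "f \<in> superpolys p m n"
    and glp_raising: "\<And>i j. i \<in> {1..p} \<Longrightarrow> j \<in> {1..p} \<Longrightarrow> i < j \<Longrightarrow> glp_action m n i j f = 0"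
    and glm_raising: "\<And>a b. a \<in> {1..m} \<Longrightarrow> b \<in> {1..m} \<Longrightarrow> a < b \<Longrightarrow> glmn_action p m a b f = 0"
    and glp_weight: "\<And>i. i \<in> {1..p} \<Longrightarrow> glp_action m n i i f = sscale (lam i) f"
    and glmn_weight: "\<And>a. a \<in> {1..m + n} \<Longrightarrow> glmn_action p m a a f = sscale (glmn_weight m lam a) f"
begin

text \<open>The weights of \<open>E_{ab} f\<close> are those of \<open>f\<close>, changed by the root of \<open>E_{ab}\<close>.\<close>

lemma raised_weights:
  assumes ab: "a \<in> {1..m + n}" "b \<in> {m + 1..m + n}" "a < b" and ne: "glmn_action p m a b f \<noteq> 0"
    and glm: "\<And>s t. s \<in> {1..m} \<Longrightarrow> t \<in> {1..m} \<Longrightarrow> s < t \<Longrightarrow>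
      glmn_action p m s t (glmn_action p m a b f) = 0"
  obtains c :: "nat \<Rightarrow> nat" and A :: "var fset" where
    "\<And>s. s \<in> {1..m} \<Longrightarrow> glmn_weight m lam s + (if s = a then 1 else 0) = of_nat (c s)"
    "\<And>i. i \<in> {1..m} \<Longrightarrow> lam i = of_nat (c i + card {k \<in> {1..n}. (i, k) |\<in>| A})"
    "\<And>i. i \<in> {m + 1..p} \<Longrightarrow> lam i = of_nat (card {k \<in> {1..n}. (i, k) |\<in>| A})"
    "\<And>k. k \<in> {1..n} \<Longrightarrow> glmn_weight m lam (m + k) + (if m + k = a then 1 else 0) -
       (if m + k = b then 1 else 0) = of_nat (card {i \<in> {1..p}. (i, k) |\<in>| A})"
proof -
  let ?u = "glmn_action p m a b f"
  have b: "b \<in> {1..m + n}" using ab(2) by auto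
  define \<nu> where "\<nu> s = glmn_weight m lam s + (if s = a then 1 else 0) - (if s = b then 1 else 0)" for s
  obtain c A where
    "\<And>s. s \<in> {1..m} \<Longrightarrow> \<nu> s = of_nat (c s)"
    "\<And>i. i \<in> {1..m} \<Longrightarrow> lam i = of_nat (c i + card {k \<in> {1..n}. (i, k) |\<in>| A})"
    "\<And>i. i \<in> {m + 1..p} \<Longrightarrow> lam i = of_nat (card {k \<in> {1..n}. (i, k) |\<in>| A})"
    "\<And>k. k \<in> {1..n} \<Longrightarrow> \<nu> (m + k) = of_nat (card {i \<in> {1..p}. (i, k) |\<in>| A})"
  proof (rule weights_of_diagonal_monomial[OF _ ne mp])
    show "?u \<in> superpolys p m n" using f ab(1) by (rule superpolys_glmn)
    show "glp_action m n i j ?u = 0" if "i \<in> {1..p}" "j \<in> {1..p}" "i < j" for i j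
      using that ab(1) b by (simp only: glp_glmn_commute glp_raising slinear_rules)
    show "glp_action m n i i ?u = sscale (lam i) ?u" if "i \<in> {1..p}" for i
      using that ab(1) b by (simp only: glp_glmn_commute glp_weight slinear_rules)
    show "glmn_action p m s s ?u = sscale (\<nu> s) ?u" if s: "s \<in> {1..m + n}" for s
    proof -
      have "glmn_action p m s s ?u = glmn_action p m a b (glmn_action p m s s f) +
          ((if s = a then ?u else 0) - (if s = b then ?u else 0))"
        by (subst glmn.bracket[OF s s ab(1) b refl]) (auto simp: gl_odd_def)
      also have "\<dots> = sscale (\<nu> s) ?u"
        using glmn_weight[OF s]
        by (auto simp: slinear_rules \<nu>_def superpoly.scale_left_distrib superpoly.scale_left_diff_distrib)
      finally show ?thesis .
    qed
  qed (use glm in auto)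
  then show ?thesis using ab by (intro that[of c A]) (auto simp: \<nu>_def)
qed

text \<open>The induction on \<open>a\<close> ensures that \<open>E_{ab} f\<close> is killed by the positive root vectors of \<open>gl(m)\<close>, in view of
  \<open>[E_{sa}, E_{ab}] = E_{sb}\<close> for \<open>s < a\<close>.\<close>

lemma mixed_raising:
  assumes "a \<in> {1..m}" "b \<in> {m + 1..m + n}"
  shows "glmn_action p m a b f = 0"
  using assms(1)
proof (induction a rule: less_induct)
  case (less a)
  show ?case
  proof (rule ccontr)
    assume ne: "glmn_action p m a b f \<noteq> 0"
    have a: "a \<in> {1..m + n}" and b: "b \<in> {1..m + n}" and "a < b" using less.prems assms(2) by auto
    obtain c A where c: "\<And>s. s \<in> {1..m} \<Longrightarrow> glmn_weight m lam s + (if s = a then 1 else 0) = of_nat (c s)"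
      "\<And>i. i \<in> {1..m} \<Longrightarrow> lam i = of_nat (c i + card {k \<in> {1..n}. (i, k) |\<in>| A})"
    proof (rule raised_weights[OF a assms(2) \<open>a < b\<close> ne])
      fix s t assume st: "s \<in> {1..m}" "t \<in> {1..m}" "s < t"
      then have st': "s \<in> {1..m + n}" "t \<in> {1..m + n}" by auto
      have "glmn_action p m s t (glmn_action p m a b f) =
          glmn_action p m a b (glmn_action p m s t f) + (if t = a then glmn_action p m s b f else 0)"
        by (subst glmn.bracket[OF st' a b refl]) (use st assms(2) in \<open>auto simp: gl_odd_def\<close>)
      also have "\<dots> = 0"
        using glm_raising[OF st] less.IH[of s] st by (simp add: slinear_rules)
      finally show "glmn_action p m s t (glmn_action p m a b f) = 0" .
    qed blast
    have "lam a + 1 = of_nat (c a)"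
      using c(1)[OF less.prems] less.prems by (simp add: glmn_weight_def)
    moreover have "lam a + 1 = of_nat (c a + card {k \<in> {1..n}. (a, k) |\<in>| A} + 1)"
      by (simp only: c(2)[OF less.prems] of_nat_add of_nat_1)
    ultimately have "(of_nat (c a) :: complex) = of_nat (c a + card {k \<in> {1..n}. (a, k) |\<in>| A} + 1)"
      by (simp only:)
    then show False by (simp only: of_nat_eq_iff)
  qed
qed

text \<open>For \<open>a = m + k\<close> with \<open>k \<ge> 1\<close>, count the cells of the odd part in the first \<open>k\<close> columns: the row
  lengths allow at most \<open>\<Sum>_{j \<le> k} \<langle>\<lambda>'_j - m\<rangle>\<close>, while the weight requires one more.\<close>

lemma odd_raising:
  assumes young: "young_diagram lam" and k: "1 \<le> k" "k < n"
  shows "glmn_action p m (m + k) (m + k + 1) f = 0"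
proof (rule ccontr)
  let ?a = "m + k" and ?b = "m + k + 1"
  assume ne: "glmn_action p m ?a ?b f \<noteq> 0"
  have a: "?a \<in> {1..m + n}" and b: "?b \<in> {1..m + n}" "?b \<in> {m + 1..m + n}" using k by auto
  obtain L where L: "row_lengths lam L" by (rule young_diagram_row_lengths[OF young])
  obtain c A where A:
    "\<And>s. s \<in> {1..m} \<Longrightarrow> glmn_weight m lam s + (if s = ?a then 1 else 0) = of_nat (c s)"
    "\<And>i. i \<in> {1..m} \<Longrightarrow> lam i = of_nat (c i + card {k \<in> {1..n}. (i, k) |\<in>| A})"
    "\<And>i. i \<in> {m + 1..p} \<Longrightarrow> lam i = of_nat (card {k \<in> {1..n}. (i, k) |\<in>| A})"
    "\<And>j. j \<in> {1..n} \<Longrightarrow> glmn_weight m lam (m + j) + (if m + j = ?a then 1 else 0) -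
       (if m + j = ?b then 1 else 0) = of_nat (card {i \<in> {1..p}. (i, j) |\<in>| A})"
  proof (rule raised_weights[OF a b(2) _ ne])
    fix s t assume st: "s \<in> {1..m}" "t \<in> {1..m}" "s < t"
    then have st': "s \<in> {1..m + n}" "t \<in> {1..m + n}" by auto
    have "glmn_action p m s t (glmn_action p m ?a ?b f) =
        glmn_action p m ?a ?b (glmn_action p m s t f)"
      by (subst glmn.bracket[OF st' a b(1) refl]) (use st k in \<open>auto simp: gl_odd_def\<close>)
    then show "glmn_action p m s t (glmn_action p m ?a ?b f) = 0"
      using glm_raising[OF st] by (simp add: slinear_rules)
  qed (simp, blast)
  have rows: "{k \<in> {1..n}. (i, k) |\<in>| A} = {}" if i: "i \<in> {1..m}" for i
  proof -
    have "(of_nat (c i) :: complex) = of_nat (c i + card {k \<in> {1..n}. (i, k) |\<in>| A})"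
      using A(1,2)[OF i] i k by (simp add: glmn_weight_def split: if_splits)
    then have "card {k \<in> {1..n}. (i, k) |\<in>| A} = 0" by (simp only: of_nat_eq_iff)
    then show ?thesis by simp
  qed
  have col: "card {i \<in> {1..p}. (i, j) |\<in>| A} = card {i \<in> {m + 1..p}. (i, j) |\<in>| A}" if "j \<in> {1..n}" for j
  proof -
    have "m < i" if "(i, j) |\<in>| A" "1 \<le> i" for i
      using rows[of i] that \<open>j \<in> {1..n}\<close> by (cases "i \<le> m") auto
    then have "{i \<in> {1..p}. (i, j) |\<in>| A} = {i \<in> {m + 1..p}. (i, j) |\<in>| A}"
      by (auto simp: Suc_le_eq)
    then show ?thesis by simp
  qed
  \<comment> \<open>Double counting, used once for the cells of \<open>A\<close> and once for those of the diagram.\<close>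
  have switch: "(\<Sum>j\<in>J. card {i \<in> I. P i j}) = (\<Sum>i\<in>I. card {j \<in> J. P i j})"
    if "finite I" "finite J" for I J :: "nat set" and P
  proof -
    have "(\<Sum>j\<in>J. card {i \<in> I. P i j}) = (\<Sum>j\<in>J. \<Sum>i\<in>I. if P i j then 1 else 0)"
      using that by (simp add: sum.If_cases Int_def)
    also have "\<dots> = (\<Sum>i\<in>I. \<Sum>j\<in>J. if P i j then 1 else 0)" by (rule sum.swap)
    finally show ?thesis using that by (simp add: sum.If_cases Int_def)
  qed
  have "(of_nat ((\<Sum>j = 1..k. transpose_diagram lam j - m) + 1) :: complex) =
      (\<Sum>j = 1..k. of_nat (transpose_diagram lam j - m) + (if j = k then 1 else 0))"
    using k by (simp add: sum.distrib)
  also have "\<dots> = (\<Sum>j = 1..k. of_nat (card {i \<in> {m + 1..p}. (i, j) |\<in>| A}))"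
  proof (intro sum.cong refl)
    fix j assume j: "j \<in> {1..k}"
    then show "of_nat (transpose_diagram lam j - m) + (if j = k then 1 else 0 :: complex) =
        of_nat (card {i \<in> {m + 1..p}. (i, j) |\<in>| A})"
      using A(4)[of j] col[of j] k by (auto simp: glmn_weight_def)
  qed
  finally have "(\<Sum>j = 1..k. transpose_diagram lam j - m) + 1 =
      (\<Sum>j = 1..k. card {i \<in> {m + 1..p}. (i, j) |\<in>| A})"
    by (simp only: of_nat_eq_iff flip: of_nat_sum)
  also have "\<dots> = (\<Sum>i = m + 1..p. card {j \<in> {1..k}. (i, j) |\<in>| A})"
    by (rule switch) auto
  also have "\<dots> \<le> (\<Sum>i = m + 1..p. card {j \<in> {1..k}. j \<le> L i})"
  proof (intro sum_mono)
    fix i assume i: "i \<in> {m + 1..p}"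
    have "of_nat (L i) = (of_nat (card {k \<in> {1..n}. (i, k) |\<in>| A}) :: complex)"
      using A(3)[OF i] row_lengthsD(1)[OF L, of i] i by simp
    then have "L i = card {k \<in> {1..n}. (i, k) |\<in>| A}" by (simp only: of_nat_eq_iff)
    moreover have "card {j \<in> {1..k}. (i, j) |\<in>| A} \<le> card {k \<in> {1..n}. (i, k) |\<in>| A}"
      using k by (intro card_mono) auto
    moreover have "card {j \<in> {1..k}. (i, j) |\<in>| A} \<le> card {1..k}" by (intro card_mono) auto
    moreover have "{j \<in> {1..k}. j \<le> L i} = {1..min k (L i)}" by auto
    ultimately show "card {j \<in> {1..k}. (i, j) |\<in>| A} \<le> card {j \<in> {1..k}. j \<le> L i}" by simp
  qed
  also have "\<dots> = (\<Sum>j = 1..k. card {i \<in> {m + 1..p}. j \<le> L i})"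
    by (rule switch[symmetric]) auto
  also have "\<dots> \<le> (\<Sum>j = 1..k. transpose_diagram lam j - m)"
  proof (intro sum_mono)
    fix j assume j: "j \<in> {1..k}"
    have "{i \<in> {m + 1..p}. j \<le> L i} \<subseteq> {i. 1 \<le> i \<and> j \<le> L i} \<inter> {m + 1..}" by auto
    also have "{i. 1 \<le> i \<and> j \<le> L i} = {1..transpose_diagram lam j}"
      using j by (intro column_eq_interval[OF L]) simp
    finally have "{i \<in> {m + 1..p}. j \<le> L i} \<subseteq> {m + 1..transpose_diagram lam j}" by auto
    then have "card {i \<in> {m + 1..p}. j \<le> L i} \<le> card {m + 1..transpose_diagram lam j}"
      by (intro card_mono) auto
    then show "card {i \<in> {m + 1..p}. j \<le> L i} \<le> transpose_diagram lam j - m" by simp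
  qed
  finally show False by simp
qed

lemma joint_highest_weight:
  assumes "young_diagram lam" "f \<noteq> 0"
  shows "joint_highest_weight_vector p m n lam f"
proof -
  have "glmn_action p m (a - 1) a f = 0" if a: "a \<in> {2..m + n}" for a
  proof -
    consider "a \<le> m" | "a = m + 1" | "a > m + 1" by linarith
    then show ?thesis
    proof cases
      case 1
      then show ?thesis using a by (intro glm_raising) auto
    next
      case 2
      then show ?thesis using a by (intro mixed_raising) auto
    next
      case 3
      then have "a - 1 = m + (a - 1 - m)" "a = m + (a - 1 - m) + 1" by auto
      then show ?thesis using odd_raising[OF assms(1), of "a - 1 - m"] a 3 by simp
    qed
  qed
  moreover have "glp_action m n (i - 1) i f = 0" if "i \<in> {2..p}" for i
    using that by (intro glp_raising) auto
  ultimately show ?thesis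
    using f assms(2) glp_weight glmn_weight
    by (auto simp: joint_highest_weight_vector_def highest_weight_vector_def)
qed

end

section \<open>Derivations and determinants\<close>

definition even_derivation :: "nat \<Rightarrow> nat \<Rightarrow> nat \<Rightarrow> (superpoly \<Rightarrow> superpoly) \<Rightarrow> bool" where
  "even_derivation p m n D \<longleftrightarrow> slinear D \<and> D 1 = 0 \<and>
     (\<forall>f\<in>superpolys p m n. \<forall>g. D (f * g) = D f * g + f * D g)"

lemma zder_one: "zder m a i 1 = 0"
  by (auto simp: one_superpoly_def zder_def op_smonom)

lemma glp_one: "glp_action m n i j 1 = 0"
  by (simp add: glp_action_zsum zder_one)

lemma glmn_one: "glmn_action p m a b 1 = 0"
  by (simp add: glmn_action_def zder_one)

lemma even_derivation_glp: "even_derivation p m n (glp_action m n i j)"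
proof -
  have "glp_action m n i j (f * g) = glp_action m n i j f * g + f * glp_action m n i j g"
    if "f \<in> superpolys p m n" for f g
    using that
  proof (induction rule: superpolys_induct)
    case (zvar a k f)
    then show ?case
      by (simp add: mult.assoc glp_zvar algebra_simps)
  qed (simp_all add: glp_one slinear_rules slinearD[OF slinear_glp[OF slinear_id]] superpoly_mult_sscale
      superpoly_distrib sscale_add)
  then show ?thesis
    by (auto simp: even_derivation_def glp_one intro: slinear_glp[OF slinear_id])
qed

lemma even_derivation_glmn:
  assumes "\<not> gl_odd m a b"
  shows "even_derivation p m n (glmn_action p m a b)"
proof -
  have "zsign m b c * zsign m a c = 1" for c
    using assms by (auto simp: zsign_def gl_odd_def)
  then have step: "glmn_action p m a b (zvar m c k * f) =
      (if b = c then zvar m a k * f else 0) + zvar m c k * glmn_action p m a b f"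
    if "k \<in> {1..p}" for c k f
    using glmn_zvar[OF that] by simp
  have "glmn_action p m a b (f * g) = glmn_action p m a b f * g + f * glmn_action p m a b g"
    if "f \<in> superpolys p m n" for f g
    using that
  proof (induction rule: superpolys_induct)
    case (zvar c k f)
    then show ?case
      by (simp add: mult.assoc step algebra_simps)
  qed (simp_all add: glmn_one slinear_rules slinearD[OF slinear_glmn[OF slinear_id]] superpoly_mult_sscale
      superpoly_distrib sscale_add)
  then show ?thesis
    by (auto simp: even_derivation_def glmn_one intro: slinear_glmn[OF slinear_id])
qed

lemma superpolys_prod_list: "(\<And>f. f \<in> set fs \<Longrightarrow> f \<in> superpolys p m n) \<Longrightarrow> prod_list fs \<in> superpolys p m n"
  by (induction fs) (auto simp: superpolys_closed intro: superpolys_mult)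

lemma derivation_eigen_mult:
  assumes "even_derivation p m n D" "f \<in> superpolys p m n" "D f = sscale a f" "D g = sscale b g"
  shows "D (f * g) = sscale (a + b) (f * g)"
  using assms by (simp add: even_derivation_def superpoly_mult_sscale superpoly.scale_left_distrib)

lemma derivation_eigen_prod_list:
  assumes "even_derivation p m n D"
    and "\<And>x. x \<in> set xs \<Longrightarrow> F x \<in> superpolys p m n \<and> D (F x) = sscale (w x) (F x)"
  shows "D (prod_list (map F xs)) = sscale (\<Sum>x\<leftarrow>xs. w x) (prod_list (map F xs))"
  using assms(2)
proof (induction xs)
  case Nil
  then show ?case using assms(1) by (simp add: even_derivation_def)
next
  case (Cons x xs)
  then show ?case
    by (simp add: derivation_eigen_mult[OF assms(1)])
qed

lemma prod_list_zero: "(0 :: superpoly) \<in> set fs \<Longrightarrow> prod_list fs = 0"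
  by (induction fs) auto

lemma derivation_prod_list_zero:
  assumes D: "even_derivation p m n D"
    and "\<And>x. x \<in> set xs \<Longrightarrow> F x \<in> superpolys p m n \<and> D (F x) = 0"
  shows "D (prod_list (map F xs)) = 0"
  using derivation_eigen_prod_list[OF D, of xs F "\<lambda>x. 0"] assms(2) by simp

lemma derivation_prod_list_single:
  assumes D: "even_derivation p m n D" and "distinct xs" "z \<in> set xs"
    and "\<And>x. x \<in> set xs \<Longrightarrow> F x \<in> superpolys p m n"
    and "\<And>x. x \<in> set xs \<Longrightarrow> x \<noteq> z \<Longrightarrow> D (F x) = 0 \<and> G x = F x" and "G z = D (F z)"
  shows "D (prod_list (map F xs)) = prod_list (map G xs)"
  using assms(2-6)
proof (induction xs)
  case (Cons x xs)
  have D_Cons: "D (prod_list (map F (x # xs))) =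
      D (F x) * prod_list (map F xs) + F x * D (prod_list (map F xs))"
    using D Cons.prems by (simp add: even_derivation_def)
  show ?case
  proof (cases "x = z")
    case True
    then have ne: "y \<noteq> z" if "y \<in> set xs" for y using that Cons.prems(1) by auto
    have "prod_list (map G xs) = prod_list (map F xs)"
      using Cons.prems(4) ne by (intro arg_cong[of _ _ prod_list] map_cong) auto
    moreover have "D (prod_list (map F xs)) = 0"
      using Cons.prems(3,4) ne by (intro derivation_prod_list_zero[OF D]) auto
    ultimately show ?thesis using D_Cons True Cons.prems(5) by simp
  next
    case False
    then have "z \<in> set xs" using Cons.prems(2) by auto
    then have "D (prod_list (map F xs)) = prod_list (map G xs)"
      using Cons.prems by (intro Cons.IH) auto
    then show ?thesis using D_Cons False Cons.prems(4)[of x] by simp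
  qed
qed simp

lemma of_int_sign_mult: "of_int (sign \<sigma>) * f = sscale (of_int (sign \<sigma>)) (f :: superpoly)"
  by (cases \<sigma> rule: sign_cases) simp_all

lemma sdet_sscale:
  "sdet r A = (\<Sum>\<sigma> | \<sigma> permutes {1..r}.
     sscale (of_int (sign \<sigma>)) (prod_list (map (\<lambda>i. A i (\<sigma> i)) [1..<r + 1])))"
  by (simp add: sdet_def of_int_sign_mult)

lemma permutes_interval_mem: "\<sigma> permutes {1..r} \<Longrightarrow> i \<in> {1..r} \<Longrightarrow> \<sigma> i \<in> {1..r}"
  by (simp only: permutes_in_image)

lemma superpolys_sdet:
  assumes "\<And>l i. l \<in> {1..r} \<Longrightarrow> i \<in> {1..r} \<Longrightarrow> A l i \<in> superpolys p m n"
  shows "sdet r A \<in> superpolys p m n"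
  unfolding sdet_sscale
proof (intro superpolys_sum superpolys_closed superpolys_prod_list)
  fix \<sigma> f assume \<sigma>: "\<sigma> \<in> {\<sigma>. \<sigma> permutes {1..r}}" "f \<in> set (map (\<lambda>i. A i (\<sigma> i)) [1..<r + 1])"
  then obtain i where "i \<in> set [1..<r + 1]" and f: "f = A i (\<sigma> i)" by (auto simp del: upt_Suc)
  then have i: "i \<in> {1..r}" by auto
  then show "f \<in> superpolys p m n"
    using assms permutes_interval_mem[of \<sigma> r i] \<sigma>(1) f by blast
qed

lemma derivation_sdet_eigen:
  assumes D: "even_derivation p m n D"
    and A: "\<And>l i. l \<in> {1..r} \<Longrightarrow> i \<in> {1..r} \<Longrightarrow> A l i \<in> superpolys p m n"
    and DA: "\<And>l i. l \<in> {1..r} \<Longrightarrow> i \<in> {1..r} \<Longrightarrow> D (A l i) = sscale (w l i) (A l i)"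
    and w: "\<And>\<sigma>. \<sigma> permutes {1..r} \<Longrightarrow> (\<Sum>l = 1..r. w l (\<sigma> l)) = c"
  shows "D (sdet r A) = sscale c (sdet r A)"
proof -
  have lin: "slinear D" using D by (simp add: even_derivation_def)
  have "D (prod_list (map (\<lambda>l. A l (\<sigma> l)) [1..<r + 1])) =
      sscale c (prod_list (map (\<lambda>l. A l (\<sigma> l)) [1..<r + 1]))" if \<sigma>: "\<sigma> permutes {1..r}" for \<sigma>
  proof -
    have "D (prod_list (map (\<lambda>l. A l (\<sigma> l)) [1..<r + 1])) =
        sscale (\<Sum>l\<leftarrow>[1..<r + 1]. w l (\<sigma> l)) (prod_list (map (\<lambda>l. A l (\<sigma> l)) [1..<r + 1]))"
    proof (rule derivation_eigen_prod_list[OF D])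
      fix l assume "l \<in> set [1..<r + 1]"
      then have l: "l \<in> {1..r}" by auto
      show "A l (\<sigma> l) \<in> superpolys p m n \<and> D (A l (\<sigma> l)) = sscale (w l (\<sigma> l)) (A l (\<sigma> l))"
        using A DA l permutes_interval_mem[OF \<sigma> l] by blast
    qed
    moreover have "(\<Sum>l\<leftarrow>[1..<r + 1]. w l (\<sigma> l)) = c"
      using w[OF \<sigma>] by (simp add: sum_list_distinct_conv_sum_set atLeastLessThanSuc_atLeastAtMost
          del: upt_Suc)
    ultimately show ?thesis by simp
  qed
  then show ?thesis
    by (simp add: sdet_sscale slinear_sum[OF lin] slinearD[OF lin] sscale_sum sscale_sscale mult.commute
        del: upt_Suc)
qed

lemma superpoly_eq_neg:
  assumes "f = - (f :: superpoly)"
  shows "f = 0"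
proof (rule superpoly_eqI)
  fix k
  have "coeff f k = - coeff f k" using assms by (metis coeff_simps(3))
  then show "coeff f k = coeff 0 k" by simp
qed

lemma permutes_sign_reversing_sum_zero:
  assumes "finite S" "a \<in> S" "b \<in> S" "a \<noteq> b"
    and Q: "\<And>\<sigma>. \<sigma> permutes S \<Longrightarrow> Q (Transposition.transpose a b \<circ> \<sigma>) = (Q \<sigma> :: superpoly)"
  shows "(\<Sum>\<sigma> | \<sigma> permutes S. sscale (of_int (sign \<sigma>)) (Q \<sigma>)) = 0"
proof -
  let ?\<tau> = "Transposition.transpose a b"
  let ?s = "\<Sum>\<sigma> | \<sigma> permutes S. sscale (of_int (sign \<sigma>)) (Q \<sigma>)"
  have \<tau>: "?\<tau> permutes S" using assms by (simp add: permutes_swap_id)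
  have "?s = (\<Sum>\<sigma> | \<sigma> permutes S. sscale (of_int (sign (?\<tau> \<circ> \<sigma>))) (Q (?\<tau> \<circ> \<sigma>)))"
    by (rule sum.reindex_bij_witness[of _ "\<lambda>\<sigma>. ?\<tau> \<circ> \<sigma>" "\<lambda>\<sigma>. ?\<tau> \<circ> \<sigma>"])
      (auto simp: comp_assoc[symmetric] intro: permutes_compose[OF _ \<tau>])
  also have "\<dots> = (\<Sum>\<sigma> | \<sigma> permutes S. - sscale (of_int (sign \<sigma>)) (Q \<sigma>))"
  proof (intro sum.cong refl)
    fix \<sigma> assume "\<sigma> \<in> {\<sigma>. \<sigma> permutes S}"
    then have \<sigma>: "\<sigma> permutes S" by simp
    have "sign (?\<tau> \<circ> \<sigma>) = - sign \<sigma>"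
      using sign_compose[OF permutes_imp_permutation[OF assms(1) \<tau>] permutes_imp_permutation[OF assms(1) \<sigma>]]
        assms(4) by (simp add: sign_swap_id)
    then show "sscale (of_int (sign (?\<tau> \<circ> \<sigma>))) (Q (?\<tau> \<circ> \<sigma>)) = - sscale (of_int (sign \<sigma>)) (Q \<sigma>)"
      using Q[OF \<sigma>] by simp
  qed
  also have "\<dots> = - ?s" by (simp add: sum_negf)
  finally have "?s = - ?s" .
  then show ?thesis
    by (rule superpoly_eq_neg)
qed

text \<open>The derivation replaces column \<open>b\<close> by column \<open>a\<close>. Then \<open>\<sigma>\<close> and \<open>(a b) \<circ> \<sigma>\<close> give the same product of
  entries, in the same order, so that the entries may be even or odd.\<close>

lemma derivation_sdet_column:
  assumes D: "even_derivation p m n D"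
    and A: "\<And>l i. l \<in> {1..r} \<Longrightarrow> i \<in> {1..r} \<Longrightarrow> A l i \<in> superpolys p m n"
    and DA: "\<And>l i. l \<in> {1..r} \<Longrightarrow> i \<in> {1..r} \<Longrightarrow> D (A l i) = (if i = b then A l a else 0)"
    and ab: "a \<noteq> b" "b \<in> {1..r} \<Longrightarrow> a \<in> {1..r}"
  shows "D (sdet r A) = 0"
proof -
  have lin: "slinear D" using D by (simp add: even_derivation_def)
  let ?g = "\<lambda>i. if i = b then a else i"
  have step: "D (prod_list (map (\<lambda>l. A l (\<sigma> l)) [1..<r + 1])) =
      (if b \<in> {1..r} then prod_list (map (\<lambda>l. A l (?g (\<sigma> l))) [1..<r + 1]) else 0)"
    if \<sigma>: "\<sigma> permutes {1..r}" for \<sigma>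
  proof -
    have mem: "A l (\<sigma> l) \<in> superpolys p m n" "D (A l (\<sigma> l)) = (if \<sigma> l = b then A l a else 0)"
      if "l \<in> set [1..<r + 1]" for l
    proof -
      have l: "l \<in> {1..r}" using that by auto
      then show "A l (\<sigma> l) \<in> superpolys p m n" "D (A l (\<sigma> l)) = (if \<sigma> l = b then A l a else 0)"
        using A DA permutes_interval_mem[OF \<sigma> l] by blast+
    qed
    show ?thesis
    proof (cases "b \<in> {1..r}")
      case True
      obtain z where z: "\<sigma> z = b" using permutes_surj[OF \<sigma>] by (metis surjD)
      then have "z \<in> {1..r}" using True permutes_in_image[OF \<sigma>] by blast
      then have z_mem: "z \<in> set [1..<r + 1]" by auto
      have "\<sigma> l \<noteq> b" if "l \<noteq> z" for l
        using that z permutes_inj[OF \<sigma>] by (metis injD)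
      then have "D (prod_list (map (\<lambda>l. A l (\<sigma> l)) [1..<r + 1])) =
          prod_list (map (\<lambda>l. A l (?g (\<sigma> l))) [1..<r + 1])"
        using mem z z_mem by (intro derivation_prod_list_single[OF D _ z_mem]) (auto simp del: upt_Suc)
      then show ?thesis using True by (simp only: if_True)
    next
      case False
      have "\<sigma> l \<noteq> b" if "l \<in> set [1..<r + 1]" for l
        using that False permutes_interval_mem[OF \<sigma>, of l] by auto
      then have "D (prod_list (map (\<lambda>l. A l (\<sigma> l)) [1..<r + 1])) = 0"
        using mem by (intro derivation_prod_list_zero[OF D]) (simp del: upt_Suc)
      then show ?thesis using False by (simp only: if_False)
    qed
  qed
  have "D (sdet r A) = (\<Sum>\<sigma> | \<sigma> permutes {1..r}. sscale (of_int (sign \<sigma>))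
      (if b \<in> {1..r} then prod_list (map (\<lambda>l. A l (?g (\<sigma> l))) [1..<r + 1]) else 0))"
    unfolding sdet_sscale using step
    by (simp add: slinear_sum[OF lin] slinearD[OF lin] del: upt_Suc)
  also have "\<dots> = 0"
  proof (cases "b \<in> {1..r}")
    case True
    have "?g (Transposition.transpose a b i) = ?g i" for i
      using ab(1) by (auto simp: transpose_def)
    then have "(\<Sum>\<sigma> | \<sigma> permutes {1..r}. sscale (of_int (sign \<sigma>))
        (prod_list (map (\<lambda>l. A l (?g (\<sigma> l))) [1..<r + 1]))) = 0"
      using True ab
      by (intro permutes_sign_reversing_sum_zero[of "{1..r}" a b]) (simp_all only: o_apply finite_atLeastAtMost not_False_eq_True)
    then show ?thesis using True by (simp only: if_True)
  next
    case False
    then show ?thesis by (simp only: if_False) simp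
  qed
  finally show ?thesis .
qed

text \<open>The derivation replaces row \<open>a + 1\<close> by row \<open>a\<close>. Then \<open>\<sigma>\<close> and \<open>\<sigma> \<circ> (a a+1)\<close> give products that differ in
  the order of two neighbouring entries of row \<open>a\<close>.\<close>

lemma derivation_sdet_row:
  assumes D: "even_derivation p m n D"
    and A: "\<And>l i. l \<in> {1..r} \<Longrightarrow> i \<in> {1..r} \<Longrightarrow> A l i \<in> superpolys p m n"
    and DA: "\<And>l i. l \<in> {1..r} \<Longrightarrow> i \<in> {1..r} \<Longrightarrow> D (A l i) = (if l = Suc a then A a i else 0)"
    and a: "a \<ge> 1"
    and comm: "\<And>i j. A a i * A a j = A a j * A a i"
  shows "D (sdet r A) = 0"
proof -
  have lin: "slinear D" using D by (simp add: even_derivation_def)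
  let ?g = "\<lambda>l. if l = Suc a then a else l"
  let ?Q = "\<lambda>\<sigma>. prod_list (map (\<lambda>l. A (?g l) (\<sigma> l)) [1..<r + 1])"
  have step: "D (prod_list (map (\<lambda>l. A l (\<sigma> l)) [1..<r + 1])) =
      (if Suc a \<in> {1..r} then ?Q \<sigma> else 0)"
    if \<sigma>: "\<sigma> permutes {1..r}" for \<sigma>
  proof -
    have mem: "A l (\<sigma> l) \<in> superpolys p m n" "D (A l (\<sigma> l)) = (if l = Suc a then A a (\<sigma> l) else 0)"
      if "l \<in> set [1..<r + 1]" for l
    proof -
      have l: "l \<in> {1..r}" using that by auto
      then show "A l (\<sigma> l) \<in> superpolys p m n"
        "D (A l (\<sigma> l)) = (if l = Suc a then A a (\<sigma> l) else 0)"
        using A DA permutes_interval_mem[OF \<sigma> l] by blast+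
    qed
    show ?thesis
    proof (cases "Suc a \<in> {1..r}")
      case True
      then have z_mem: "Suc a \<in> set [1..<r + 1]" by auto
      have "D (prod_list (map (\<lambda>l. A l (\<sigma> l)) [1..<r + 1])) = ?Q \<sigma>"
        using mem z_mem by (intro derivation_prod_list_single[OF D _ z_mem]) (auto simp del: upt_Suc)
      then show ?thesis using True by (simp only: if_True)
    next
      case False
      have "l \<noteq> Suc a" if "l \<in> set [1..<r + 1]" for l
        using that False by auto
      then have "D (prod_list (map (\<lambda>l. A l (\<sigma> l)) [1..<r + 1])) = 0"
        using mem by (intro derivation_prod_list_zero[OF D]) (simp del: upt_Suc)
      then show ?thesis using False by (simp only: if_False)
    qed
  qed
  have D_sdet: "D (sdet r A) = (\<Sum>\<sigma> | \<sigma> permutes {1..r}. sscale (of_int (sign \<sigma>))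
      (if Suc a \<in> {1..r} then ?Q \<sigma> else 0))"
    unfolding sdet_sscale using step
    by (simp add: slinear_sum[OF lin] slinearD[OF lin] del: upt_Suc)
  show ?thesis
  proof (cases "Suc a \<in> {1..r}")
    case True
    let ?\<tau> = "Transposition.transpose a (Suc a)"
    have split: "[1..<r + 1] = [1..<a] @ [a, Suc a] @ [Suc (Suc a)..<r + 1]"
    proof -
      have "[1..<r + 1] = [1..<a] @ [a..<r + 1]"
        using upt_add_eq_append[OF a, of "r + 1 - a"] True by simp
      moreover have "[a..<r + 1] = a # Suc a # [Suc (Suc a)..<r + 1]"
        using True by (simp add: upt_conv_Cons del: upt_Suc)
      ultimately show ?thesis by simp
    qed
    have Q: "?Q (\<sigma> \<circ> ?\<tau>) = ?Q \<sigma>" for \<sigma>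
    proof -
      have 1: "map (\<lambda>l. A (?g l) ((\<sigma> \<circ> ?\<tau>) l)) [1..<a] = map (\<lambda>l. A (?g l) (\<sigma> l)) [1..<a]"
        by (intro map_cong refl) (simp add: transpose_def)
      have 2: "map (\<lambda>l. A (?g l) ((\<sigma> \<circ> ?\<tau>) l)) [Suc (Suc a)..<r + 1] =
          map (\<lambda>l. A (?g l) (\<sigma> l)) [Suc (Suc a)..<r + 1]"
        by (intro map_cong refl) (auto simp add: transpose_def simp del: upt_Suc)
      show ?thesis
        unfolding split map_append prod_list.append 1 2
        using comm[of "\<sigma> a" "\<sigma> (Suc a)"] by (simp add: mult.assoc[symmetric])
    qed
    \<comment> \<open>Passing to inverses turns \<open>\<sigma> \<circ> \<tau>\<close> into \<open>\<tau> \<circ> \<sigma>\<close>, as needed for the sign-reversing pairing.\<close>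
    have "(\<Sum>\<sigma> | \<sigma> permutes {1..r}. sscale (of_int (sign \<sigma>)) (?Q \<sigma>)) =
        (\<Sum>\<sigma> | \<sigma> permutes {1..r}. sscale (of_int (sign (inv \<sigma>))) (?Q (inv \<sigma>)))"
      by (rule sum.reindex_bij_witness[of _ inv inv])
        (auto simp: permutes_inv permutes_inv_inv)
    also have "\<dots> = (\<Sum>\<sigma> | \<sigma> permutes {1..r}. sscale (of_int (sign \<sigma>)) (?Q (inv \<sigma>)))"
      by (intro sum.cong refl) (simp add: sign_inverse permutes_imp_permutation[of "{1..r}"])
    also have "\<dots> = 0"
    proof (rule permutes_sign_reversing_sum_zero[of "{1..r}" a "Suc a"])
      fix \<sigma> :: "nat \<Rightarrow> nat" assume "\<sigma> permutes {1..r}"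
      then have "inv (?\<tau> \<circ> \<sigma>) = inv \<sigma> \<circ> ?\<tau>"
        by (subst o_inv_distrib) (auto simp: permutes_bij inv_transpose_eq)
      then show "?Q (inv (?\<tau> \<circ> \<sigma>)) = ?Q (inv \<sigma>)" using Q by simp
    qed (use True a in auto)
    finally show ?thesis using D_sdet True by simp
  next
    case False
    then show ?thesis unfolding D_sdet by (simp only: if_False) simp
  qed
qed


subsection \<open>The determinants as weight vectors\<close>

lemma sum_permutes_delta:
  fixes \<sigma> :: "nat \<Rightarrow> nat"
  assumes "\<sigma> permutes {1..r}"
  shows "(\<Sum>l = 1..r. if \<sigma> l = i then c else (0::complex)) = (if i \<in> {1..r} then c else 0)"
proof -
  have "(\<Sum>l = 1..r. if \<sigma> l = i then c else 0) = (\<Sum>l = 1..r. if l = i then c else 0)"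
    by (rule sum.permute[OF assms, symmetric, unfolded comp_def])
  then show ?thesis by simp
qed

definition odd_entry :: "nat \<Rightarrow> nat \<Rightarrow> nat \<Rightarrow> nat \<Rightarrow> superpoly" where
  "odd_entry m k l i = zvar m (if l \<le> m then l else m + k) i"

lemma DeltaOdd_entries: "k \<ge> 1 \<Longrightarrow> DeltaOdd m k r = sdet r (odd_entry m k)"
  unfolding DeltaOdd_def by (intro arg_cong[of _ _ "sdet r"] ext) (auto simp: odd_entry_def zvar_def)

lemma zvar_in_superpolys: "a \<in> {1..m + n} \<Longrightarrow> i \<in> {1..p} \<Longrightarrow> zvar m a i \<in> superpolys p m n"
  using superpolys_zvar[OF superpolys_closed(2)] by simp

lemma glp_zvar_alone:
  "c \<in> {1..m + n} \<Longrightarrow> glp_action m n i j (zvar m c k) = (if j = k then zvar m c i else 0)"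
  using glp_zvar[of c m n i j k 1] by (simp add: glp_one)

lemma glmn_zvar_alone:
  "k \<in> {1..p} \<Longrightarrow> glmn_action p m a b (zvar m c k) = (if b = c then zvar m a k else 0)"
  using glmn_zvar[of k p m a b c 1] by (simp add: glmn_one)

lemma xvar_commute: "xvar i l * xvar j k = xvar j k * xvar i l"
  using xvar_xvar[of i l j k 1] by simp

lemma odd_entry_superpolys:
  "k \<in> {1..n} \<Longrightarrow> l \<ge> 1 \<Longrightarrow> i \<in> {1..p} \<Longrightarrow> odd_entry m k l i \<in> superpolys p m n"
  unfolding odd_entry_def by (intro zvar_in_superpolys) auto

text \<open>All these facts have the form \<open>D \<Delta> = c \<Delta>\<close> for an even derivation \<open>D\<close>, with \<open>c = 0\<close> for a raising operator,
  because in this form they pass to products, the numbers \<open>c\<close> being added.\<close>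

lemma DeltaOdd_facts:
  assumes k: "k \<in> {1..n}" and r: "m < r" "r \<le> p"
  shows "DeltaOdd m k r \<in> superpolys p m n"
    and "glp_action m n i i (DeltaOdd m k r) = sscale (if i \<in> {1..r} then 1 else 0) (DeltaOdd m k r)"
    and "a \<in> {1..m} \<Longrightarrow> glmn_action p m a a (DeltaOdd m k r) = sscale 1 (DeltaOdd m k r)"
    and "k' \<in> {1..n} \<Longrightarrow> glmn_action p m (m + k') (m + k') (DeltaOdd m k r) =
       sscale (if k' = k then of_nat (r - m) else 0) (DeltaOdd m k r)"
    and "i \<ge> 1 \<Longrightarrow> glp_action m n i (Suc i) (DeltaOdd m k r) = sscale 0 (DeltaOdd m k r)"
    and "a \<ge> 1 \<Longrightarrow> Suc a \<le> m \<Longrightarrow> glmn_action p m a (Suc a) (DeltaOdd m k r) = sscale 0 (DeltaOdd m k r)"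
proof -
  have [simp]: "DeltaOdd m k r = sdet r (odd_entry m k)" using k by (simp add: DeltaOdd_entries)
  have even: "even_derivation p m n (glmn_action p m a a)" for a
    by (rule even_derivation_glmn) (simp add: gl_odd_def)
  have A: "odd_entry m k l i \<in> superpolys p m n" if "l \<in> {1..r}" "i \<in> {1..r}" for l i
    using that k r by (intro odd_entry_superpolys) auto
  have glp: "glp_action m n i j (odd_entry m k l c) = (if c = j then odd_entry m k l i else 0)"
    if "l \<in> {1..r}" for i j l c
    unfolding odd_entry_def by (subst glp_zvar_alone) (use that k in auto)
  have glm: "glmn_action p m a b (odd_entry m k l i) =
      (if b = (if l \<le> m then l else m + k) then zvar m a i else 0)"
    if "i \<in> {1..r}" for a b l i
    unfolding odd_entry_def by (subst glmn_zvar_alone) (use that r in auto)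
  show "DeltaOdd m k r \<in> superpolys p m n"
    using superpolys_sdet[of r "odd_entry m k" p m n] A by simp
  have "glp_action m n i i (sdet r (odd_entry m k)) =
      sscale (if i \<in> {1..r} then 1 else 0) (sdet r (odd_entry m k))"
  proof (rule derivation_sdet_eigen[OF even_derivation_glp])
    show "glp_action m n i i (odd_entry m k l c) = sscale (if c = i then 1 else 0) (odd_entry m k l c)"
      if "l \<in> {1..r}" "c \<in> {1..r}" for l c
      using glp[OF that(1)] by simp
  qed (erule (1) A, rule sum_permutes_delta)
  then show "glp_action m n i i (DeltaOdd m k r) =
      sscale (if i \<in> {1..r} then 1 else 0) (DeltaOdd m k r)" by simp
  show "glmn_action p m a a (DeltaOdd m k r) = sscale 1 (DeltaOdd m k r)" if a: "a \<in> {1..m}"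
  proof -
    have "glmn_action p m a a (sdet r (odd_entry m k)) = sscale 1 (sdet r (odd_entry m k))"
    proof (rule derivation_sdet_eigen[OF even])
      show "glmn_action p m a a (odd_entry m k l c) = sscale (if l = a then 1 else 0) (odd_entry m k l c)"
        if "l \<in> {1..r}" "c \<in> {1..r}" for l c
        using glm[OF that(2)] a k by (auto simp: odd_entry_def)
    qed (erule (1) A, use a r in simp)
    then show ?thesis by simp
  qed
  show "glmn_action p m (m + k') (m + k') (DeltaOdd m k r) =
      sscale (if k' = k then of_nat (r - m) else 0) (DeltaOdd m k r)" if k': "k' \<in> {1..n}"
  proof -
    have "glmn_action p m (m + k') (m + k') (sdet r (odd_entry m k)) =
        sscale (if k' = k then of_nat (r - m) else 0) (sdet r (odd_entry m k))"
    proof (rule derivation_sdet_eigen[OF even])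
      show "glmn_action p m (m + k') (m + k') (odd_entry m k l c) =
          sscale (if l \<in> {m + 1..r} \<and> k' = k then 1 else 0) (odd_entry m k l c)"
        if "l \<in> {1..r}" "c \<in> {1..r}" for l c
        using glm[OF that(2)] k' that by (auto simp: odd_entry_def)
      have "(\<Sum>l = 1..r. if l \<in> {m + 1..r} \<and> k' = k then 1 else 0) =
          (\<Sum>l = m + 1..r. if k' = k then 1 else (0 :: complex))"
        by (rule sum.mono_neutral_cong_right) auto
      then show "(\<Sum>l = 1..r. if l \<in> {m + 1..r} \<and> k' = k then 1 else 0) =
          (if k' = k then of_nat (r - m) else (0 :: complex))"
        by simp
    qed (erule (1) A)
    then show ?thesis by simp
  qed
  show "glp_action m n i (Suc i) (DeltaOdd m k r) = sscale 0 (DeltaOdd m k r)" if "i \<ge> 1"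
  proof -
    have "glp_action m n i (Suc i) (sdet r (odd_entry m k)) = 0"
      by (rule derivation_sdet_column[OF even_derivation_glp[of p m n], where a = i and b = "Suc i"])
        (use that glp A in auto)
    then show ?thesis by simp
  qed
  show "glmn_action p m a (Suc a) (DeltaOdd m k r) = sscale 0 (DeltaOdd m k r)"
    if a: "a \<ge> 1" "Suc a \<le> m"
  proof -
    have "glmn_action p m a (Suc a) (sdet r (odd_entry m k)) = 0"
    proof (rule derivation_sdet_row[OF even_derivation_glmn, where a = a])
      show "\<not> gl_odd m a (Suc a)" using a by (simp add: gl_odd_def)
      show "glmn_action p m a (Suc a) (odd_entry m k l c) = (if l = Suc a then odd_entry m k a c else 0)"
        if "l \<in> {1..r}" "c \<in> {1..r}" for l c
        using glm[OF that(2)] a k by (auto simp: odd_entry_def)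
      show "odd_entry m k a i * odd_entry m k a j = odd_entry m k a j * odd_entry m k a i" for i j
        using a by (simp add: odd_entry_def zvar_def xvar_commute)
    qed (use a A in auto)
    then show ?thesis by simp
  qed
qed

lemma Delta_facts:
  assumes r: "r \<le> m" "m \<le> p"
  shows "Delta r \<in> superpolys p m n"
    and "glp_action m n i i (Delta r) = sscale (if i \<in> {1..r} then 1 else 0) (Delta r)"
    and "a \<in> {1..m + n} \<Longrightarrow> glmn_action p m a a (Delta r) = sscale (if a \<in> {1..r} then 1 else 0) (Delta r)"
    and "i \<ge> 1 \<Longrightarrow> glp_action m n i (Suc i) (Delta r) = sscale 0 (Delta r)"
    and "a \<ge> 1 \<Longrightarrow> Suc a \<le> m \<Longrightarrow> glmn_action p m a (Suc a) (Delta r) = sscale 0 (Delta r)"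
proof -
  let ?A = "\<lambda>i l. xvar i l"
  have even: "even_derivation p m n (glmn_action p m a a)" for a
    by (rule even_derivation_glmn) (simp add: gl_odd_def)
  have z: "xvar i l = zvar m l i" if "l \<in> {1..r}" for i l
    using that r by (simp add: zvar_def)
  have A: "?A i l \<in> superpolys p m n" if "i \<in> {1..r}" "l \<in> {1..r}" for i l
    using that r z[OF that(2)] by (auto intro!: zvar_in_superpolys)
  have glp: "glp_action m n i j (xvar c l) = (if c = j then xvar i l else 0)"
    if "l \<in> {1..r}" for i j l c
    unfolding z[OF that] by (subst glp_zvar_alone) (use that r in auto)
  have glm: "glmn_action p m a b (xvar i l) = (if b = l then zvar m a i else 0)"
    if "i \<in> {1..r}" "l \<in> {1..r}" for a b l i
    unfolding z[OF that(2)] by (subst glmn_zvar_alone) (use that r in auto)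
  show "Delta r \<in> superpolys p m n"
    unfolding Delta_def using A by (intro superpolys_sdet) auto
  show "glp_action m n i i (Delta r) = sscale (if i \<in> {1..r} then 1 else 0) (Delta r)"
    unfolding Delta_def
  proof (rule derivation_sdet_eigen[OF even_derivation_glp])
    show "glp_action m n i i (xvar c l) = sscale (if c = i then 1 else 0) (xvar c l)"
      if "c \<in> {1..r}" "l \<in> {1..r}" for c l
      using glp[OF that(2)] by simp
  qed (erule (1) A, simp)
  show "glmn_action p m a a (Delta r) = sscale (if a \<in> {1..r} then 1 else 0) (Delta r)"
    if a: "a \<in> {1..m + n}"
    unfolding Delta_def
  proof (rule derivation_sdet_eigen[OF even])
    show "glmn_action p m a a (xvar c l) = sscale (if l = a then 1 else 0) (xvar c l)"
      if "c \<in> {1..r}" "l \<in> {1..r}" for c l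
      using glm[OF that] z[OF that(2)] by simp
  qed (erule (1) A, rule sum_permutes_delta)
  show "glp_action m n i (Suc i) (Delta r) = sscale 0 (Delta r)" if "i \<ge> 1"
  proof -
    have "glp_action m n i (Suc i) (sdet r (\<lambda>i l. xvar i l)) = 0"
      by (rule derivation_sdet_row[OF even_derivation_glp[of p m n], where a = i])
        (use that glp xvar_commute A in auto)
    then show ?thesis by (simp add: Delta_def)
  qed
  show "glmn_action p m a (Suc a) (Delta r) = sscale 0 (Delta r)" if a: "a \<ge> 1" "Suc a \<le> m"
  proof -
    have "glmn_action p m a (Suc a) (sdet r (\<lambda>i l. xvar i l)) = 0"
    proof (rule derivation_sdet_column[OF even_derivation_glmn, where a = a and b = "Suc a"])
      show "\<not> gl_odd m a (Suc a)" using a by (simp add: gl_odd_def)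
      show "glmn_action p m a (Suc a) (xvar c l) = (if l = Suc a then xvar c a else 0)"
        if "c \<in> {1..r}" "l \<in> {1..r}" for c l
        using glm[OF that] a by (simp add: zvar_def)
    qed (use a A in auto)
    then show ?thesis by (simp add: Delta_def)
  qed
qed

subsection \<open>The product of determinants does not vanish\<close>

definition diagonal_exponents :: "(var \<Rightarrow>\<^sub>0 nat) \<Rightarrow> bool" where
  "diagonal_exponents \<alpha> \<longleftrightarrow> (\<forall>v. fst v \<noteq> snd v \<longrightarrow> Poly_Mapping.lookup \<alpha> v = 0)"

lemma diagonal_exponents_add:
  "diagonal_exponents (\<alpha> + \<beta>) \<longleftrightarrow> diagonal_exponents \<alpha> \<and> diagonal_exponents \<beta>"
  by (auto simp: diagonal_exponents_def lookup_add)

lemma diagonal_exponents_0: "diagonal_exponents 0"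
  by (simp add: diagonal_exponents_def)

text \<open>The substitution \<open>x_l^i = \<delta>_{i l}\<close>. It turns \<open>\<Delta>_r\<close> into 1 and \<open>\<Delta>_{k,r}\<close> into a nonzero multiple of
  the monomial \<open>\<eta>_k^{m+1} \<cdots> \<eta>_k^r\<close>; for different \<open>k\<close> these have no variable in common.\<close>

definition at_identity :: "superpoly \<Rightarrow> superpoly" where
  "at_identity = lin_extend (\<lambda>(\<alpha>, A). if diagonal_exponents \<alpha> then smonom (0, A) else 0)"

lemma slinear_at_identity: "slinear at_identity"
  unfolding at_identity_def by (rule slinear_lin_extend)

lemmas at_identity_lin = slinearD[OF slinear_at_identity] slinear_0[OF slinear_at_identity]

lemma at_identity_smonom:
  "at_identity (smonom (\<alpha>, A)) = (if diagonal_exponents \<alpha> then smonom (0, A) else 0)"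
  by (simp add: at_identity_def)

lemma at_identity_mult: "at_identity (f * g) = at_identity f * at_identity g"
proof -
  have mon: "at_identity (smonom k * smonom l) = at_identity (smonom k) * at_identity (smonom l)"
    for k l :: supermonom
    by (cases k; cases l)
      (simp add: smonom_mult monom_times_def at_identity_smonom at_identity_lin diagonal_exponents_add)
  show ?thesis
  proof (induction f rule: superpoly_induct)
    case (monom c k)
    have "at_identity (smonom k * g) = at_identity (smonom k) * at_identity g"
      by (induction g rule: superpoly_induct)
        (simp_all add: at_identity_lin mon superpoly_mult_sscale superpoly_distrib superpoly_mult_0)
    then show ?case by (simp add: at_identity_lin superpoly_mult_sscale)
  qed (simp_all add: at_identity_lin superpoly_distrib superpoly_mult_0)
qed

lemma at_identity_one: "at_identity 1 = 1"
  by (simp add: one_superpoly_def at_identity_smonom diagonal_exponents_0)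

lemma at_identity_prod_list: "at_identity (prod_list fs) = prod_list (map at_identity fs)"
  by (induction fs) (simp_all add: at_identity_one at_identity_mult)

lemma at_identity_xvar: "at_identity (xvar i l) = (if i = l then 1 else 0)"
  by (auto simp: xvar_def at_identity_smonom one_superpoly_def lookup_single when_def
      diagonal_exponents_def)

lemma at_identity_etavar: "at_identity (etavar i k) = etavar i k"
  by (simp add: etavar_def at_identity_smonom diagonal_exponents_0)

lemma at_identity_sdet: "at_identity (sdet r A) = sdet r (\<lambda>l i. at_identity (A l i))"
  by (simp add: sdet_sscale slinear_sum[OF slinear_at_identity] at_identity_lin at_identity_prod_list
      comp_def del: upt_Suc)

lemma at_identity_Delta: "at_identity (Delta r) = 1"
proof -
  have prod: "prod_list (map (\<lambda>i. if i = \<sigma> i then 1 else 0 :: superpoly) [1..<r + 1]) =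
      (if \<sigma> = id then 1 else 0)" if \<sigma>: "\<sigma> permutes {1..r}" for \<sigma>
  proof (cases "\<sigma> = id")
    case True
    then show ?thesis by (simp del: upt_Suc add: map_replicate_const)
  next
    case False
    then obtain i where i: "\<sigma> i \<noteq> i" by (metis id_apply ext)
    then have "i \<in> {1..r}" using permutes_not_in[OF \<sigma>] by blast
    then have "i \<in> set [1..<r + 1]" by auto
    then have "0 \<in> set (map (\<lambda>i. if i = \<sigma> i then 1 else 0 :: superpoly) [1..<r + 1])"
      using i by (force simp del: upt_Suc)
    then show ?thesis using False prod_list_zero by (simp del: upt_Suc)
  qed
  then have "at_identity (Delta r) =
      (\<Sum>\<sigma> | \<sigma> permutes {1..r}. if \<sigma> = id then sscale (of_int (sign \<sigma>)) 1 else 0)"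
    unfolding Delta_def at_identity_sdet at_identity_xvar unfolding sdet_sscale
  proof (intro sum.cong refl)
    fix \<sigma> assume "\<sigma> \<in> {\<sigma>. \<sigma> permutes {1..r}}"
    then have "prod_list (map (\<lambda>i. if i = \<sigma> i then 1 else 0 :: superpoly) [1..<r + 1]) =
        (if \<sigma> = id then 1 else 0)"
      using prod by blast
    then show "sscale (of_int (sign \<sigma>)) (prod_list (map (\<lambda>i. if i = \<sigma> i then 1 else 0) [1..<r + 1])) =
        (if \<sigma> = id then sscale (of_int (sign \<sigma>)) 1 else 0)"
      by (simp only: if_distrib[of "sscale _"] sscale_simps)
  qed
  then show ?thesis by (simp add: finite_permutations permutes_id)
qed

lemma anticommuting_prod_list:
  assumes "\<And>v. c * e v = - (e v * (c :: superpoly))"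
  shows "c * prod_list (map e ws) = prod_list (map e ws) * c \<or>
    c * prod_list (map e ws) = - (prod_list (map e ws) * c)"
proof (induction ws)
  case (Cons v ws)
  have "c * (e v * prod_list (map e ws)) = - (e v * (c * prod_list (map e ws)))"
    by (simp add: assms flip: mult.assoc)
  then show ?case using Cons.IH by (auto simp: mult.assoc)
qed simp

text \<open>The sum \<open>c = e_a + e_b\<close> anticommutes with every factor of the product \<open>Y\<close> between \<open>e_a\<close> and \<open>e_b\<close>, and
  its square is zero, whence \<open>c Y c = 0\<close>; the same holds for \<open>e_a\<close> and for \<open>e_b\<close> in place of \<open>c\<close>.\<close>

lemma sandwich_swap:
  assumes e: "\<And>v w. e v * e w = - (e w * (e v :: superpoly))"
  shows "e a * prod_list (map e ws) * e b = - (e b * prod_list (map e ws) * e a)"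
proof -
  let ?Y = "prod_list (map e ws)"
  have sq: "e v * e v = 0" for v using e[of v v] by (rule superpoly_eq_neg)
  have zero: "c * ?Y * c = 0" if "\<And>v. c * e v = - (e v * c)" "c * c = 0" for c
  proof -
    have "?Y * c * c = 0" using that(2) by (simp add: mult.assoc)
    then show ?thesis using anticommuting_prod_list[of c e ws] that(1) by auto
  qed
  have sum: "(e a + e b) * ?Y * (e a + e b) = 0"
  proof (rule zero)
    show "(e a + e b) * e v = - (e v * (e a + e b))" for v
      using e[of a v] e[of b v] by (simp add: algebra_simps)
    show "(e a + e b) * (e a + e b) = 0" using sq e[of a b] by (simp add: algebra_simps)
  qed
  have expand: "(e a + e b) * ?Y * (e a + e b) =
      e a * ?Y * e a + e b * ?Y * e a + (e a * ?Y * e b + e b * ?Y * e b)"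
    by (subst distrib_left) (simp only: distrib_right)
  have ends: "e a * ?Y * e a = 0" "e b * ?Y * e b = 0"
    by (rule zero[OF e sq])+
  have "e b * ?Y * e a + e a * ?Y * e b = 0"
    using trans[OF expand[symmetric] sum] unfolding ends add_0_left add_0_right .
  then have "e a * ?Y * e b + e b * ?Y * e a = 0"
    by (subst add.commute)
  then show ?thesis by (rule iffD2[OF eq_neg_iff_add_eq_0])
qed

lemma prod_list_transpose:
  assumes e: "\<And>v w. e v * e w = - (e w * (e v :: superpoly))"
    and "distinct ws" "a \<in> set ws" "b \<in> set ws" "a \<noteq> b"
  shows "prod_list (map e (map (Transposition.transpose a b) ws)) = - prod_list (map e ws)"
proof -
  have *: "prod_list (map e (map (Transposition.transpose a b) (X @ c # Y @ d # Z))) =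
      - prod_list (map e (X @ c # Y @ d # Z))"
    if "distinct (X @ c # Y @ d # Z)" "{c, d} = {a, b}" for X Y Z c d
  proof -
    have 1: "map (Transposition.transpose a b) xs = xs" if "a \<notin> set xs" "b \<notin> set xs" for xs
      using that by (intro map_idI) (auto simp: transpose_def)
    have X: "map (Transposition.transpose a b) X = X" "map (Transposition.transpose a b) Y = Y"
      "map (Transposition.transpose a b) Z = Z"
      using that by (intro 1; auto simp: doubleton_eq_iff)+
    have cd: "Transposition.transpose a b c = d" "Transposition.transpose a b d = c"
      using that(2) by (auto simp: doubleton_eq_iff)
    have "prod_list (map e X) * (e d * prod_list (map e Y) * e c) * prod_list (map e Z) =
        - (prod_list (map e X) * (e c * prod_list (map e Y) * e d) * prod_list (map e Z))"
      by (subst sandwich_swap[OF e]) simp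
    then show ?thesis using cd X by (simp add: mult.assoc)
  qed
  obtain X W where ws: "ws = X @ a # W" using assms(3) by (meson split_list)
  then consider "b \<in> set X" | "b \<in> set W" using assms(4,5) by auto
  then show ?thesis
  proof cases
    case 1
    then obtain X1 X2 where X: "X = X1 @ b # X2" by (meson split_list)
    show ?thesis using *[of X1 b X2 a W] assms(2) ws X by auto
  next
    case 2
    then obtain W1 W2 where W: "W = W1 @ b # W2" by (meson split_list)
    show ?thesis using *[of X a W1 b W2] assms(2) ws W by auto
  qed
qed

lemma prod_list_permuted:
  assumes e: "\<And>v w. e v * e w = - (e w * (e v :: superpoly))"
    and "\<sigma> permutes {s..r}"
  shows "sscale (of_int (sign \<sigma>)) (prod_list (map (\<lambda>l. e (\<sigma> l)) [s..<r + 1])) =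
    prod_list (map e [s..<r + 1])"
  using assms(2) finite_atLeastAtMost
proof (induction rule: permutes_induct)
  case id
  then show ?case by (simp del: upt_Suc)
next
  case (swap a b \<sigma>)
  have set: "set (map \<sigma> [s..<r + 1]) = {s..r}"
    using permutes_image[OF swap.hyps(4)] by (simp add: atLeastLessThanSuc_atLeastAtMost del: upt_Suc)
  have dist: "distinct (map \<sigma> [s..<r + 1])"
    using permutes_inj[OF swap.hyps(4)] by (auto simp: distinct_map intro: inj_on_subset)
  have "prod_list (map e (map (Transposition.transpose a b) (map \<sigma> [s..<r + 1]))) =
      - prod_list (map e (map \<sigma> [s..<r + 1]))"
    using swap.hyps set by (intro prod_list_transpose[OF e dist]) auto
  moreover have "sign (Transposition.transpose a b \<circ> \<sigma>) = - sign \<sigma>"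
    using swap.hyps sign_compose[of "Transposition.transpose a b" \<sigma>]
      permutes_imp_permutation[OF _ swap.hyps(4)] permutation_swap_id[of a b]
    by (simp add: sign_swap_id)
  ultimately show ?case using swap.IH by (simp add: comp_def del: upt_Suc)
qed

text \<open>A permutation contributes only if it fixes \<open>1, \<dots>, m\<close>. When the odd factors are sorted, the sign of the
  permutation is cancelled, so that all contributions are equal; \<open>N\<close> is their number.\<close>

lemma at_identity_DeltaOdd:
  assumes "m < r"
  obtains N :: nat where "N > 0" "at_identity (DeltaOdd m k r) =
    sscale (of_nat N) (prod_list (map (\<lambda>i. etavar i k) [m + 1..<r + 1]))"
proof -
  let ?E = "prod_list (map (\<lambda>i. etavar i k) [m + 1..<r + 1])"
  let ?B = "\<lambda>l i. if l \<le> m then (if i = l then 1 else 0) else etavar i k"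
  let ?F = "{\<sigma>. \<sigma> permutes {1..r} \<and> (\<forall>l\<in>{1..m}. \<sigma> l = l)}"
  have anti: "etavar v k * etavar w k = - (etavar w k * etavar v k)" for v w
    using etavar_etavar[of v k w k 1] by simp
  have split: "[1..<r + 1] = [1..<m + 1] @ [m + 1..<r + 1]"
    using upt_add_eq_append[of 1 "m + 1" "r - m"] assms by simp
  have summand: "sscale (of_int (sign \<sigma>)) (prod_list (map (\<lambda>l. ?B l (\<sigma> l)) [1..<r + 1])) =
      (if \<sigma> \<in> ?F then ?E else 0)" if \<sigma>: "\<sigma> permutes {1..r}" for \<sigma>
  proof (cases "\<sigma> \<in> ?F")
    case True
    have fix_le: "\<sigma> permutes {m + 1..r}"
      by (rule permutes_superset[OF \<sigma>]) (use True in auto)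
    have "map (\<lambda>l. ?B l (\<sigma> l)) [1..<m + 1] = map (\<lambda>l. 1) [1..<m + 1]"
      using True by (intro map_cong) (auto simp del: upt_Suc)
    moreover have "map (\<lambda>l. ?B l (\<sigma> l)) [m + 1..<r + 1] = map (\<lambda>l. etavar (\<sigma> l) k) [m + 1..<r + 1]"
      by (intro map_cong) (auto simp del: upt_Suc)
    ultimately have "prod_list (map (\<lambda>l. ?B l (\<sigma> l)) [1..<r + 1]) =
        prod_list (map (\<lambda>l. etavar (\<sigma> l) k) [m + 1..<r + 1])"
      by (simp only: split map_append prod_list.append map_replicate_const) (simp del: upt_Suc)
    then show ?thesis
      using prod_list_permuted[OF anti fix_le] True assms by (simp only: if_True) simp
  next
    case False
    then obtain l where l: "l \<in> {1..m}" "\<sigma> l \<noteq> l" using \<sigma> by blast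
    have "l \<in> set [1..<r + 1]" "?B l (\<sigma> l) = 0" using l assms by auto
    then have "0 \<in> set (map (\<lambda>l. ?B l (\<sigma> l)) [1..<r + 1])"
      unfolding set_map by (intro image_eqI[of _ _ l]) (simp_all only:)
    then show ?thesis using False by (simp only: prod_list_zero sscale_simps if_False)
  qed
  have "at_identity (DeltaOdd m k r) = sdet r ?B"
    unfolding DeltaOdd_def at_identity_sdet
    by (intro arg_cong[of _ _ "sdet r"] ext) (simp add: at_identity_xvar at_identity_etavar)
  also have "\<dots> = (\<Sum>\<sigma> | \<sigma> permutes {1..r}. if \<sigma> \<in> ?F then ?E else 0)"
    unfolding sdet_sscale using summand by (intro sum.cong refl) blast
  also have "\<dots> = (\<Sum>\<sigma>\<in>?F. ?E)"
    by (simp add: sum.If_cases finite_permutations Int_def del: upt_Suc)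
  also have "\<dots> = sscale (of_nat (card ?F)) ?E"
  proof -
    have "(\<Sum>\<sigma>\<in>S. f) = sscale (of_nat (card S)) f" for f and S :: "(nat \<Rightarrow> nat) set"
      by (rule superpoly_eqI) (simp del: sum_constant, simp)
    then show ?thesis .
  qed
  finally have "at_identity (DeltaOdd m k r) = sscale (of_nat (card ?F)) ?E" .
  moreover have "card ?F > 0"
  proof -
    have "finite ?F" by (rule finite_subset[OF _ finite_permutations[of "{1..r}"]]) auto
    moreover have "id \<in> ?F" by (simp add: permutes_id)
    ultimately show ?thesis unfolding card_gt_0_iff by blast
  qed
  ultimately show ?thesis using that by blast
qed

definition odd_monomial :: "var set \<Rightarrow> superpoly \<Rightarrow> bool" where
  "odd_monomial S f \<longleftrightarrow> (\<exists>c A. c \<noteq> 0 \<and> fset A = S \<and> f = sscale c (smonom (0, A)))"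

lemma odd_monomial_nonzero: "odd_monomial S f \<Longrightarrow> f \<noteq> 0"
proof
  assume "odd_monomial S f" "f = 0"
  then obtain c A where "c \<noteq> 0" "sscale c (smonom (0, A)) = 0" by (auto simp: odd_monomial_def)
  then have "coeff (sscale c (smonom (0, A))) (0, A) = 0" by (simp only: coeff_simps)
  then show False using \<open>c \<noteq> 0\<close> by simp
qed

lemma odd_monomial_one: "odd_monomial {} 1"
  unfolding odd_monomial_def one_superpoly_def by (intro exI[of _ 1] exI[of _ "{||}"]) simp

lemma odd_monomial_etavar: "odd_monomial {(i, k)} (etavar i k)"
  unfolding odd_monomial_def etavar_def by (intro exI[of _ 1] exI[of _ "{|(i, k)|}"]) simp

lemma odd_monomial_sscale: "odd_monomial S f \<Longrightarrow> c \<noteq> 0 \<Longrightarrow> odd_monomial S (sscale c f)"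
  unfolding odd_monomial_def using sscale_sscale by (metis mult_eq_0_iff)

lemma odd_monomial_mult:
  assumes "odd_monomial S f" "odd_monomial T g" "S \<inter> T = {}"
  shows "odd_monomial (S \<union> T) (f * g)"
proof -
  obtain c A d B where A: "c \<noteq> 0" "fset A = S" "f = sscale c (smonom (0, A))"
    and B: "d \<noteq> 0" "fset B = T" "g = sscale d (smonom (0, B))"
    using assms(1,2) by (auto simp: odd_monomial_def)
  have "A |\<inter>| B = {||}" using assms(3) A(2) B(2) by (metis bot_fset.rep_eq fset_inject inf_fset.rep_eq)
  then have "f * g = sscale (d * (c * (-1) ^ inversions A B)) (smonom (0, A |\<union>| B))"
    by (simp add: A B superpoly_mult_sscale smonom_mult monom_times_def sscale_sscale mult_ac)
  then show ?thesis
    unfolding odd_monomial_def using A B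
    by (intro exI[of _ "d * (c * (-1) ^ inversions A B)"] exI[of _ "A |\<union>| B"]) auto
qed

lemma odd_monomial_prod_list:
  assumes "distinct xs" "\<And>x. x \<in> set xs \<Longrightarrow> odd_monomial (S x) (F x)"
    "\<And>x y. x \<in> set xs \<Longrightarrow> y \<in> set xs \<Longrightarrow> x \<noteq> y \<Longrightarrow> S x \<inter> S y = {}"
  shows "odd_monomial (\<Union>x\<in>set xs. S x) (prod_list (map F xs))"
  using assms
proof (induction xs)
  case Nil
  then show ?case using odd_monomial_one by simp
next
  case (Cons x xs)
  have "odd_monomial (S x \<union> (\<Union>x\<in>set xs. S x)) (F x * prod_list (map F xs))"
    using Cons by (intro odd_monomial_mult Cons.IH) fastforce+
  then show ?case by simp
qed

lemma product_of_determinants_nonzero: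
  assumes "\<And>k. k \<in> {1..r} \<Longrightarrow> m < q k"
  shows "prod_list (map (\<lambda>k. DeltaOdd m k (q k)) [1..<r + 1]) * prod_list (map (\<lambda>j. Delta (q j)) js) \<noteq> 0"
proof
  have odd: "odd_monomial ((\<lambda>i. (i, k)) ` {m + 1..q k}) (at_identity (DeltaOdd m k (q k)))"
    if k: "k \<in> {1..r}" for k
  proof -
    obtain N :: nat where N: "N > 0" "at_identity (DeltaOdd m k (q k)) =
        sscale (of_nat N) (prod_list (map (\<lambda>i. etavar i k) [m + 1..<q k + 1]))"
      using at_identity_DeltaOdd[OF assms[OF k]] by blast
    have "odd_monomial (\<Union>i\<in>set [m + 1..<q k + 1]. {(i, k)})
        (prod_list (map (\<lambda>i. etavar i k) [m + 1..<q k + 1]))"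
      by (intro odd_monomial_prod_list odd_monomial_etavar) auto
    moreover have "(\<Union>i\<in>set [m + 1..<q k + 1]. {(i, k)}) = (\<lambda>i. (i, k)) ` {m + 1..q k}" by auto
    ultimately show ?thesis using N by (simp only: odd_monomial_sscale of_nat_eq_0_iff neq0_conv)
  qed
  have "odd_monomial (\<Union>k\<in>set [1..<r + 1]. (\<lambda>i. (i, k)) ` {m + 1..q k})
      (prod_list (map (\<lambda>k. at_identity (DeltaOdd m k (q k))) [1..<r + 1]))"
    by (intro odd_monomial_prod_list odd) auto
  then have "prod_list (map (\<lambda>k. at_identity (DeltaOdd m k (q k))) [1..<r + 1]) \<noteq> 0"
    by (rule odd_monomial_nonzero)
  moreover have "prod_list (map (\<lambda>j. at_identity (Delta (q j))) js) = 1"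
    by (induction js) (simp_all add: at_identity_Delta)
  moreover assume "prod_list (map (\<lambda>k. DeltaOdd m k (q k)) [1..<r + 1]) *
    prod_list (map (\<lambda>j. Delta (q j)) js) = 0"
  then have "at_identity (prod_list (map (\<lambda>k. DeltaOdd m k (q k)) [1..<r + 1]) *
    prod_list (map (\<lambda>j. Delta (q j)) js)) = 0"
    by (simp only: at_identity_lin)
  then have "prod_list (map (\<lambda>k. at_identity (DeltaOdd m k (q k))) [1..<r + 1]) *
      prod_list (map (\<lambda>j. at_identity (Delta (q j))) js) = 0"
    by (simp add: at_identity_mult at_identity_prod_list comp_def del: upt_Suc)
  ultimately show False by simp
qed

subsection \<open>The highest weight vector\<close>

text \<open>Each factor belongs to one column \<open>j\<close> of \<open>\<lambda>\<close>, and contributes 1 to the \<open>i\<close>-th weight for \<open>gl(p)\<close> if and only if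
  \<open>i \<le> \<lambda>'_j\<close>, that is, if \<open>j \<le> \<lambda>_i\<close>. The contributions therefore add up to the length of row \<open>i\<close>. Beyond the
  first \<open>m\<close> rows, column \<open>k\<close> contributes its \<open>\<lambda>'_k - m\<close> odd variables.\<close>

lemma hook_product_joint_highest_weight:
  assumes mp: "m < p" and young: "young_diagram lam" and len: "diagram_length lam \<le> p"
    and hook: "Re (lam (m + 1)) \<le> real n" and t: "lam 1 = of_nat t"
    and r: "r = 0 \<or> m < transpose_diagram lam r" "transpose_diagram lam (r + 1) \<le> m"
  shows "joint_highest_weight_vector p m n lam
    (prod_list (map (\<lambda>k. DeltaOdd m k (transpose_diagram lam k)) [1..<r + 1]) *
     prod_list (map (\<lambda>j. Delta (transpose_diagram lam j)) [r + 1..<t + 1]))"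
proof -
  let ?q = "transpose_diagram lam"
  let ?P = "prod_list (map (\<lambda>k. DeltaOdd m k (?q k)) [1..<r + 1])"
  let ?R = "prod_list (map (\<lambda>j. Delta (?q j)) [r + 1..<t + 1])"
  obtain L where rows: "row_lengths lam L" by (rule young_diagram_row_lengths[OF young])
  note L = row_lengthsD[OF rows] and q_iff = le_transpose_iff[OF rows]
  have t': "L 1 = t" using t L(1)[of 1] by simp
  have r_le: "r \<le> L (m + 1)"
    using r(1) q_iff[of "m + 1" r] by (cases "r = 0") auto
  have r_n: "r \<le> n" using r_le hook L(1)[of "m + 1"] by simp
  have r_t: "r \<le> t" using r_le L(2)[of 1 "m + 1"] t' by simp
  have big: "m < ?q k" if "k \<in> {1..r}" for k
    using q_iff[of "m + 1" k] that r_le by auto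
  have small: "?q j \<le> m" if "j \<ge> r + 1" for j
  proof (rule ccontr)
    assume "\<not> ?q j \<le> m"
    then have "j \<le> L (m + 1)" using q_iff[of "m + 1" j] that by auto
    then have "r + 1 \<le> L (m + 1)" using that by simp
    then show False using q_iff[of "m + 1" "r + 1"] r(2) by simp
  qed
  have q_p: "?q k \<le> p" if "k \<ge> 1" for k
  proof -
    have "?q k \<le> ?q 1" unfolding transpose_row_lengths[OF rows] using that
      by (intro card_mono finite_subset[OF _ L(3)]) auto
    then show ?thesis using len diagram_length_eq_first_column[OF rows] by simp
  qed
  have odd: "k \<in> {1..n}" "m < ?q k" "?q k \<le> p" if "k \<in> set [1..<r + 1]" for k
    using that r_n big[of k] q_p[of k] by auto
  have even: "?q j \<le> m" if "j \<in> set [r + 1..<t + 1]" for j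
    using that small[of j] by auto
  have mem: "?P \<in> superpolys p m n" "?R \<in> superpolys p m n"
    using DeltaOdd_facts(1)[OF odd] Delta_facts(1)[OF even] mp
    by (auto intro!: superpolys_prod_list simp del: upt_Suc)
  have eigen: "D (?P * ?R) = sscale ((\<Sum>k\<leftarrow>[1..<r + 1]. w k) + (\<Sum>j\<leftarrow>[r + 1..<t + 1]. w' j)) (?P * ?R)"
    if D: "even_derivation p m n D"
      and 1: "\<And>k. k \<in> set [1..<r + 1] \<Longrightarrow> D (DeltaOdd m k (?q k)) = sscale (w k) (DeltaOdd m k (?q k))"
      and 2: "\<And>j. j \<in> set [r + 1..<t + 1] \<Longrightarrow> D (Delta (?q j)) = sscale (w' j) (Delta (?q j))"
    for D w w'
  proof (intro derivation_eigen_mult[OF D mem(1)] derivation_eigen_prod_list[OF D] conjI)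
    show "DeltaOdd m k (?q k) \<in> superpolys p m n" if "k \<in> set [1..<r + 1]" for k
      using DeltaOdd_facts(1)[OF odd[OF that]] .
    show "Delta (?q j) \<in> superpolys p m n" if "j \<in> set [r + 1..<t + 1]" for j
      using Delta_facts(1)[OF even[OF that]] mp by simp
  qed (use 1 2 in auto)
  have sum_list: "(\<Sum>k\<leftarrow>[a..<b + 1]. w k) = (\<Sum>k = a..b. w k)" for a b and w :: "nat \<Rightarrow> complex"
    by (simp add: sum_list_distinct_conv_sum_set atLeastLessThanSuc_atLeastAtMost del: upt_Suc)
  have row_sum: "(\<Sum>k\<leftarrow>[1..<r + 1]. if i \<in> {1..?q k} then 1 else 0) +
      (\<Sum>j\<leftarrow>[r + 1..<t + 1]. if i \<in> {1..?q j} then 1 else 0) = lam i" if i: "i \<ge> 1" for i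
  proof -
    have "(\<Sum>k = 1..r. if i \<in> {1..?q k} then 1 else 0) +
        (\<Sum>j = r + 1..t. if i \<in> {1..?q j} then 1 else 0) =
        (\<Sum>k = 1..t. if i \<in> {1..?q k} then 1 else (0 :: complex))"
      using sum.ub_add_nat[of 1 r "\<lambda>k. if i \<in> {1..?q k} then 1 else (0 :: complex)" "t - r"] r_t by simp
    also have "\<dots> = (\<Sum>k = 1..t. if k \<in> {1..L i} then 1 else 0)"
      using q_iff[OF i] i by (intro sum.cong) auto
    also have "\<dots> = (\<Sum>k = 1..L i. 1)"
      using L(2)[of 1 i] i t' by (intro sum.mono_neutral_cong_right) auto
    finally show ?thesis using L(1)[OF i] by (simp only: sum_list) simp
  qed
  have zero: "(\<Sum>k\<leftarrow>xs. 0) = (0 :: complex)" for xs :: "nat list" by (induction xs) auto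
  have glp_diag: "glp_action m n i i (?P * ?R) = sscale (lam i) (?P * ?R)" if "i \<in> {1..p}" for i
  proof -
    have "glp_action m n i i (?P * ?R) = sscale ((\<Sum>k\<leftarrow>[1..<r + 1]. if i \<in> {1..?q k} then 1 else 0) +
        (\<Sum>j\<leftarrow>[r + 1..<t + 1]. if i \<in> {1..?q j} then 1 else 0)) (?P * ?R)"
      by (intro eigen even_derivation_glp DeltaOdd_facts(2)[where p = p] Delta_facts(2)[where p = p] odd even less_imp_le[OF mp])
    then show ?thesis using row_sum[of i] that by simp
  qed
  have glm_diag: "glmn_action p m a a (?P * ?R) = sscale (glmn_weight m lam a) (?P * ?R)"
    if a: "a \<in> {1..m + n}" for a
  proof (cases "a \<le> m")
    case True
    have "glmn_action p m a a (?P * ?R) = sscale ((\<Sum>k\<leftarrow>[1..<r + 1]. if a \<in> {1..?q k} then 1 else 0) +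
        (\<Sum>j\<leftarrow>[r + 1..<t + 1]. if a \<in> {1..?q j} then 1 else 0)) (?P * ?R)"
    proof (intro eigen even_derivation_glmn Delta_facts(3)[where n = n] even a less_imp_le[OF mp])
      fix k assume k: "k \<in> set [1..<r + 1]"
      have "a \<in> {1..?q k}" "a \<in> {1..m}" using odd(2)[OF k] True a by auto
      then show "glmn_action p m a a (DeltaOdd m k (?q k)) =
          sscale (if a \<in> {1..?q k} then 1 else 0) (DeltaOdd m k (?q k))"
        using DeltaOdd_facts(3)[OF odd[OF k]] by simp
    qed (simp add: gl_odd_def)
    then show ?thesis using row_sum[of a] True a by (simp add: glmn_weight_def)
  next
    case False
    define k' where "k' = a - m"
    have k': "a = m + k'" "k' \<in> {1..n}" using False a by (auto simp: k'_def)
    have "glmn_action p m a a (?P * ?R) = sscale ((\<Sum>k\<leftarrow>[1..<r + 1]. if k' = k then of_nat (?q k - m) else 0) +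
        (\<Sum>j\<leftarrow>[r + 1..<t + 1]. if a \<in> {1..?q j} then 1 else 0)) (?P * ?R)"
    proof (intro eigen even_derivation_glmn Delta_facts(3)[where n = n] even a less_imp_le[OF mp])
      fix k assume k: "k \<in> set [1..<r + 1]"
      show "glmn_action p m a a (DeltaOdd m k (?q k)) =
          sscale (if k' = k then of_nat (?q k - m) else 0) (DeltaOdd m k (?q k))"
        using DeltaOdd_facts(4)[OF odd[OF k] k'(2)] k'(1) by simp
    qed (simp add: gl_odd_def)
    moreover have "(\<Sum>j\<leftarrow>[r + 1..<t + 1]. if a \<in> {1..?q j} then 1 else 0) = (\<Sum>j\<leftarrow>[r + 1..<t + 1]. 0 :: complex)"
      using even False by (intro arg_cong[of _ _ sum_list] map_cong) fastforce+
    moreover have "(\<Sum>k\<leftarrow>[1..<r + 1]. if k' = k then of_nat (?q k - m) else 0) = (of_nat (?q k' - m) :: complex)"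
      using small[of k'] k'(2) by (simp only: sum_list) auto
    ultimately show ?thesis using k' by (simp add: glmn_weight_def zero del: upt_Suc)
  qed
  have glp_up: "glp_action m n i (Suc i) (?P * ?R) = 0" if "i \<ge> 1" for i
  proof -
    have "glp_action m n i (Suc i) (?P * ?R) =
        sscale ((\<Sum>k\<leftarrow>[1..<r + 1]. 0) + (\<Sum>j\<leftarrow>[r + 1..<t + 1]. 0)) (?P * ?R)"
      by (intro eigen even_derivation_glp DeltaOdd_facts(5)[where p = p] Delta_facts(4)[where p = p] odd even less_imp_le[OF mp] that)
    then show ?thesis by (simp only: zero) simp
  qed
  have glm_up: "glmn_action p m a (Suc a) (?P * ?R) = 0" if "a \<ge> 1" "Suc a \<le> m" for a
  proof -
    have "glmn_action p m a (Suc a) (?P * ?R) =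
        sscale ((\<Sum>k\<leftarrow>[1..<r + 1]. 0) + (\<Sum>j\<leftarrow>[r + 1..<t + 1]. 0)) (?P * ?R)"
      by (intro eigen even_derivation_glmn DeltaOdd_facts(6)[where n = n] Delta_facts(5) odd even less_imp_le[OF mp] that)
        (use that in \<open>simp add: gl_odd_def\<close>)
    then show ?thesis by (simp only: zero) simp
  qed
  have ne: "?P * ?R \<noteq> 0"
    using product_of_determinants_nonzero[of r m ?q "[r + 1..<t + 1]"] big by blast
  have hwp: "highest_weight_vector sscale p (glp_action m n) lam (?P * ?R)"
    unfolding highest_weight_vector_def
  proof (intro conjI ne ballI)
    fix a assume "a \<in> {2..p}"
    then have "1 \<le> a - 1" "Suc (a - 1) = a" by auto
    then show "glp_action m n (a - 1) a (?P * ?R) = 0" using glp_up[of "a - 1"] by (simp only:)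
  qed (rule glp_diag)
  interpret glm: gl_rep sscale m m "glmn_action p m"
    by standard (simp_all add: slinearD[OF slinear_glmn[OF slinear_id]] glmn_superbracket[symmetric] gl_odd_def)
  have hwm: "highest_weight_vector sscale m (glmn_action p m) (glmn_weight m lam) (?P * ?R)"
    unfolding highest_weight_vector_def
  proof (intro conjI ne ballI)
    fix a assume "a \<in> {2..m}"
    then have "1 \<le> a - 1" "Suc (a - 1) = a" "a \<le> m" by auto
    then show "glmn_action p m (a - 1) a (?P * ?R) = 0" using glm_up[of "a - 1"] by (simp only:)
  next
    fix a assume "a \<in> {1..m}"
    then show "glmn_action p m a a (?P * ?R) = sscale (glmn_weight m lam a) (?P * ?R)"
      by (intro glm_diag) auto
  qed
  have "even_highest_weight_vector p m n lam (?P * ?R)"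
    using mp mem glp.highest_weight_raising[OF hwp] glm.highest_weight_raising[OF hwm] glp_diag glm_diag
    by unfold_locales (auto intro: superpolys_mult)
  then show ?thesis
    by (rule even_highest_weight_vector.joint_highest_weight[OF _ young ne])
qed

section \<open>Tensor products\<close>

lemma lookup_free_scale: "Poly_Mapping.lookup (free_scale c z) k = c * Poly_Mapping.lookup z k"
  by (simp add: free_scale_def Poly_Mapping.map.rep_eq when_def)

lemma vector_space_free_scale: "vector_space (free_scale :: complex \<Rightarrow> ('b \<Rightarrow>\<^sub>0 complex) \<Rightarrow> _)"
  by standard (auto intro!: poly_mapping_eqI simp: lookup_free_scale lookup_add algebra_simps)

interpretation free: vector_space "free_scale :: complex \<Rightarrow> ('b \<Rightarrow>\<^sub>0 complex) \<Rightarrow> _"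
  by (rule vector_space_free_scale)

definition bilinear_map ::
  "(complex \<Rightarrow> 'v::ab_group_add \<Rightarrow> 'v) \<Rightarrow> (complex \<Rightarrow> 'w::ab_group_add \<Rightarrow> 'w) \<Rightarrow>
   (complex \<Rightarrow> 'u::ab_group_add \<Rightarrow> 'u) \<Rightarrow> ('v \<Rightarrow> 'w \<Rightarrow> 'u) \<Rightarrow> bool" where
  "bilinear_map sV sW s B \<longleftrightarrow>
     (\<forall>v v' w. B (v + v') w = B v w + B v' w) \<and> (\<forall>v w w'. B v (w + w') = B v w + B v w') \<and>
     (\<forall>c v w. B (sV c v) w = s c (B v w)) \<and> (\<forall>c v w. B v (sW c w) = s c (B v w))"

definition free_extend ::
  "(complex \<Rightarrow> 'u::ab_group_add \<Rightarrow> 'u) \<Rightarrow> ('v \<Rightarrow> 'w \<Rightarrow> 'u) \<Rightarrow> ('v \<times> 'w \<Rightarrow>\<^sub>0 complex) \<Rightarrow> 'u" where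
  "free_extend s B z = (\<Sum>k\<in>Poly_Mapping.keys z. s (Poly_Mapping.lookup z k) (B (fst k) (snd k)))"

lemma free_extend_superset:
  assumes "vector_space s" "finite S" "Poly_Mapping.keys z \<subseteq> S"
  shows "free_extend s B z = (\<Sum>k\<in>S. s (Poly_Mapping.lookup z k) (B (fst k) (snd k)))"
proof -
  interpret vector_space s by (rule assms)
  show ?thesis
    unfolding free_extend_def using assms by (intro sum.mono_neutral_left) (auto simp: in_keys_iff)
qed

lemma linear_free_extend:
  assumes s: "vector_space s"
  shows "Vector_Spaces.linear free_scale s (free_extend s B)"
proof -
  interpret vector_space s by (rule s)
  have "free_extend s B (y + z) = free_extend s B y + free_extend s B z" for y z
  proof -
    let ?S = "Poly_Mapping.keys y \<union> Poly_Mapping.keys z"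
    show ?thesis
      using Poly_Mapping.keys_add[of y z]
      by (simp add: free_extend_superset[OF s, of ?S] lookup_add scale_left_distrib sum.distrib)
  qed
  moreover have "free_extend s B (free_scale c z) = s c (free_extend s B z)" for c z
  proof -
    have "Poly_Mapping.keys (free_scale c z) \<subseteq> Poly_Mapping.keys z"
      by (auto simp: in_keys_iff lookup_free_scale)
    then show ?thesis
      by (simp add: free_extend_superset[OF s, of "Poly_Mapping.keys z"] lookup_free_scale scale_sum_right)
  qed
  ultimately show ?thesis
    using s vector_space_free_scale by (simp add: Vector_Spaces.linear_iff)
qed

lemma free_extend_pair:
  assumes "vector_space s"
  shows "free_extend s B (free_pair v w) = B v w"
proof -
  interpret vector_space s by (rule assms)
  show ?thesis
    by (subst free_extend_superset[OF assms, of "{(v, w)}"]) (auto simp: free_pair_def lookup_single)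
qed

lemma linear_props:
  assumes "Vector_Spaces.linear s1 s2 \<Phi>"
  shows "\<Phi> (x + y) = \<Phi> x + \<Phi> y" "\<Phi> (x - y) = \<Phi> x - \<Phi> y" "\<Phi> (s1 c x) = s2 c (\<Phi> x)" "\<Phi> 0 = 0"
    "\<Phi> (sum g S) = (\<Sum>a\<in>S. \<Phi> (g a))"
proof -
  interpret module_hom s1 s2 \<Phi> using assms by (simp add: linear_iff_module_hom)
  show "\<Phi> (x + y) = \<Phi> x + \<Phi> y" "\<Phi> (x - y) = \<Phi> x - \<Phi> y" "\<Phi> (s1 c x) = s2 c (\<Phi> x)" "\<Phi> 0 = 0"
    "\<Phi> (sum g S) = (\<Sum>a\<in>S. \<Phi> (g a))"
    by (simp_all add: add diff scale zero sum)
qed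

lemma tensor_relations_rules:
  "free_pair (v + v') w - free_pair v w - free_pair v' w \<in> tensor_relations sV sW"
  "free_pair v (w + w') - free_pair v w - free_pair v w' \<in> tensor_relations sV sW"
  "free_pair (sV c v) w - free_scale c (free_pair v w) \<in> tensor_relations sV sW"
  "free_pair v (sW c w) - free_scale c (free_pair v w) \<in> tensor_relations sV sW"
  unfolding tensor_relations_def by (rule free.span_base, blast)+

lemma bilinear_kills_tensor_relations:
  assumes s: "vector_space s" and B: "bilinear_map sV sW s B" and z: "z \<in> tensor_relations sV sW"
  shows "free_extend s B z = 0"
proof -
  interpret vector_space s by (rule s)
  note lin = linear_props[OF linear_free_extend[OF s, of B]]
  have "free.subspace {z. free_extend s B z = 0}"
    unfolding free.subspace_def by (simp add: lin)
  then have "tensor_relations sV sW \<subseteq> {z. free_extend s B z = 0}"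
    unfolding tensor_relations_def
    using B by (intro free.span_minimal)
      (auto simp: lin free_extend_pair[OF s] bilinear_map_def)
  then show ?thesis using z by blast
qed

lemma vector_space_complex: "vector_space ((*) :: complex \<Rightarrow> complex \<Rightarrow> complex)"
  by standard (simp_all add: algebra_simps)

lemma exists_functional:
  assumes "vector_space s" "v \<noteq> 0"
  obtains \<phi> :: "'v::ab_group_add \<Rightarrow> complex"
  where "\<And>x y. \<phi> (x + y) = \<phi> x + \<phi> y" "\<And>c x. \<phi> (s c x) = c * \<phi> x" "\<phi> v = 1"
proof -
  interpret vector_space s by (rule assms)
  interpret C: vector_space "(*) :: complex \<Rightarrow> complex \<Rightarrow> complex"
    by (rule vector_space_complex)
  interpret pair: vector_space_pair s "(*) :: complex \<Rightarrow> complex \<Rightarrow> complex" ..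
  have "independent {v}" using assms(2) by (simp add: dependent_single)
  then obtain \<phi> where \<phi>: "Vector_Spaces.linear s (*) \<phi>" "\<forall>x\<in>{v}. \<phi> x = (1 :: complex)"
    using pair.linear_independent_extend[of "{v}" "\<lambda>_. 1"] by blast
  show ?thesis
    using linear_props[OF \<phi>(1)] \<phi>(2) by (intro that[of \<phi>]) auto
qed

text \<open>Linear functionals that take the value 1 at \<open>v\<close> and at \<open>w\<close> give a bilinear form that does not vanish at
  \<open>(v, w)\<close>.\<close>

lemma free_pair_notin_tensor_relations:
  assumes "vector_space sV" "vector_space sW" "v \<noteq> 0" "w \<noteq> 0"
  shows "free_pair v w \<notin> tensor_relations sV sW"
proof
  assume rel: "free_pair v w \<in> tensor_relations sV sW"
  obtain \<phi> where \<phi>: "\<And>x y. \<phi> (x + y) = \<phi> x + \<phi> y" "\<And>c x. \<phi> (sV c x) = c * \<phi> x" "\<phi> v = 1"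
    using exists_functional[OF assms(1,3)] by blast
  obtain \<psi> where \<psi>: "\<And>x y. \<psi> (x + y) = \<psi> x + \<psi> y" "\<And>c x. \<psi> (sW c x) = c * \<psi> x" "\<psi> w = 1"
    using exists_functional[OF assms(2,4)] by blast
  have "bilinear_map sV sW (*) (\<lambda>v w. \<phi> v * \<psi> w)"
    by (simp add: bilinear_map_def \<phi> \<psi> algebra_simps)
  from bilinear_kills_tensor_relations[OF vector_space_complex this rel] show False
    by (simp add: free_extend_pair[OF vector_space_complex] \<phi> \<psi>)
qed

subsection \<open>Reduction modulo the tensor relations\<close>

context
  fixes sV :: "complex \<Rightarrow> 'v::ab_group_add \<Rightarrow> 'v" and sW :: "complex \<Rightarrow> 'w::ab_group_add \<Rightarrow> 'w"
  assumes V: "vector_space sV" and W: "vector_space sW"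
begin

interpretation V: vector_space sV by (rule V)
interpretation W: vector_space sW by (rule W)

definition tensor_equiv :: "('v \<times> 'w \<Rightarrow>\<^sub>0 complex) \<Rightarrow> ('v \<times> 'w \<Rightarrow>\<^sub>0 complex) \<Rightarrow> bool" where
  "tensor_equiv y z \<longleftrightarrow> y - z \<in> tensor_relations sV sW"

lemma subspace_tensor_relations: "free.subspace (tensor_relations sV sW)"
  unfolding tensor_relations_def by (rule free.subspace_span)

lemma tensor_equiv_refl: "tensor_equiv z z"
  by (simp add: tensor_equiv_def free.subspace_0[OF subspace_tensor_relations])

lemma tensor_equiv_sym: "tensor_equiv y z \<Longrightarrow> tensor_equiv z y"
  using free.subspace_neg[OF subspace_tensor_relations] by (fastforce simp: tensor_equiv_def)

lemma tensor_equiv_trans: "tensor_equiv x y \<Longrightarrow> tensor_equiv y z \<Longrightarrow> tensor_equiv x z"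
  using free.subspace_add[OF subspace_tensor_relations, of "x - y" "y - z"]
  by (simp add: tensor_equiv_def)

lemma tensor_equiv_add: "tensor_equiv x y \<Longrightarrow> tensor_equiv x' y' \<Longrightarrow> tensor_equiv (x + x') (y + y')"
  using free.subspace_add[OF subspace_tensor_relations, of "x - y" "x' - y'"]
  by (simp add: tensor_equiv_def add_diff_add)

lemma tensor_equiv_sum:
  "(\<And>a. a \<in> S \<Longrightarrow> tensor_equiv (g a) (h a)) \<Longrightarrow> tensor_equiv (sum g S) (sum h S)"
  by (induction S rule: infinite_finite_induct) (auto intro: tensor_equiv_refl tensor_equiv_add)

lemma tensor_equiv_rules:
  "tensor_equiv (free_pair (v + v') w) (free_pair v w + free_pair v' w)"
  "tensor_equiv (free_pair v (w + w')) (free_pair v w + free_pair v w')"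
  "tensor_equiv (free_pair (sV c v) w) (free_scale c (free_pair v w))"
  "tensor_equiv (free_pair v (sW c w)) (free_scale c (free_pair v w))"
  unfolding tensor_equiv_def diff_diff_eq[symmetric] by (rule tensor_relations_rules)+

lemma free_pair_zero_left: "tensor_equiv (free_pair 0 w) 0"
  using tensor_equiv_rules(3)[of 0 0 w] by simp

lemma free_pair_zero_right: "tensor_equiv (free_pair v 0) 0"
  using tensor_equiv_rules(4)[of v 0 0] by simp

lemma free_pair_sum_left: "tensor_equiv (free_pair (sum h S) w) (\<Sum>b\<in>S. free_pair (h b) w)"
proof (induction S rule: infinite_finite_induct)
  case (insert b S)
  then show ?case
    using tensor_equiv_trans[OF tensor_equiv_rules(1) tensor_equiv_add[OF tensor_equiv_refl insert.IH]]
    by simp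
qed (simp_all add: free_pair_zero_left)

text \<open>By bilinearity, every tensor can be rewritten in terms of a basis of the first factor alone. To show
  that a tensor vanishes, it then suffices to use linear independence in the first factor.\<close>

lemma tensor_basis_expansion:
  assumes basis: "V.span Bs = UNIV"
  shows "\<exists>S g. finite S \<and> S \<subseteq> Bs \<and> tensor_equiv z (\<Sum>b\<in>S. free_pair b (g b))"
proof -
  let ?P = "\<lambda>z. \<exists>S g. finite S \<and> S \<subseteq> Bs \<and> (\<forall>b. b \<notin> S \<longrightarrow> g b = 0) \<and>
      tensor_equiv z (\<Sum>b\<in>S. free_pair b (g b))"
  have larger: "tensor_equiv (\<Sum>b\<in>S. free_pair b (g b)) (\<Sum>b\<in>T. free_pair b (g b))"
    if "finite T" "S \<subseteq> T" "\<forall>b. b \<notin> S \<longrightarrow> g b = 0" for S T and g :: "'v \<Rightarrow> 'w"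
  proof -
    have "(\<Sum>b\<in>T. free_pair b (g b)) = (\<Sum>b\<in>S. free_pair b (g b)) + (\<Sum>b\<in>T - S. free_pair b (g b))"
      using that by (metis add.commute sum.subset_diff)
    moreover have "tensor_equiv (\<Sum>b\<in>T - S. free_pair b (g b)) (\<Sum>b\<in>T - S. 0)"
      using that(3) by (intro tensor_equiv_sum) (auto intro: free_pair_zero_right)
    ultimately show ?thesis
      using tensor_equiv_add[OF tensor_equiv_refl] tensor_equiv_sym by fastforce
  qed
  have pair: "?P (free_pair v w)" for v w
  proof -
    have "v \<in> V.span Bs" using basis by simp
    then obtain S c where S: "finite S" "S \<subseteq> Bs" "v = (\<Sum>b\<in>S. sV (c b) b)"
      unfolding V.span_explicit by blast
    let ?g = "\<lambda>b. if b \<in> S then sW (c b) w else 0"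
    have "tensor_equiv (free_pair v w) (\<Sum>b\<in>S. free_pair (sV (c b) b) w)"
      unfolding S(3) by (rule free_pair_sum_left)
    moreover have "tensor_equiv (\<Sum>b\<in>S. free_pair (sV (c b) b) w) (\<Sum>b\<in>S. free_pair b (?g b))"
    proof (rule tensor_equiv_sum)
      fix b assume "b \<in> S"
      then show "tensor_equiv (free_pair (sV (c b) b) w) (free_pair b (?g b))"
        using tensor_equiv_trans[OF tensor_equiv_rules(3) tensor_equiv_sym[OF tensor_equiv_rules(4)]]
        by simp
    qed
    ultimately show ?thesis
      using S(1,2) tensor_equiv_trans by (intro exI[of _ S] exI[of _ ?g]) auto
  qed
  have add: "?P (y + z)" if y: "?P y" and z: "?P z" for y z
  proof -
    obtain S g where S: "finite S" "S \<subseteq> Bs" "\<forall>b. b \<notin> S \<longrightarrow> g b = 0"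
      "tensor_equiv y (\<Sum>b\<in>S. free_pair b (g b))" using y by blast
    obtain T h where T: "finite T" "T \<subseteq> Bs" "\<forall>b. b \<notin> T \<longrightarrow> h b = 0"
      "tensor_equiv z (\<Sum>b\<in>T. free_pair b (h b))" using z by blast
    have "tensor_equiv (y + z) ((\<Sum>b\<in>S \<union> T. free_pair b (g b)) + (\<Sum>b\<in>S \<union> T. free_pair b (h b)))"
      using S T by (intro tensor_equiv_add) (blast intro: tensor_equiv_trans larger finite_UnI)+
    moreover have "tensor_equiv ((\<Sum>b\<in>S \<union> T. free_pair b (g b)) + (\<Sum>b\<in>S \<union> T. free_pair b (h b)))
        (\<Sum>b\<in>S \<union> T. free_pair b (g b + h b))"
      unfolding sum.distrib[symmetric]
      by (intro tensor_equiv_sum tensor_equiv_sym[OF tensor_equiv_rules(2)])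
    ultimately have eq: "tensor_equiv (y + z) (\<Sum>b\<in>S \<union> T. free_pair b (g b + h b))"
      by (rule tensor_equiv_trans)
    show ?thesis
    proof (intro exI conjI)
      show "finite (S \<union> T)" "S \<union> T \<subseteq> Bs" using S T by auto
      show "\<forall>b. b \<notin> S \<union> T \<longrightarrow> g b + h b = 0" using S(3) T(3) by simp
    qed (rule eq)
  qed
  have scaled: "?P (free_scale c (free_pair v w))" for c v w
  proof -
    obtain S g where S: "finite S" "S \<subseteq> Bs" "\<forall>b. b \<notin> S \<longrightarrow> g b = 0"
      "tensor_equiv (free_pair v (sW c w)) (\<Sum>b\<in>S. free_pair b (g b))"
      using pair[of v "sW c w"] by (elim exE conjE)
    have "tensor_equiv (free_scale c (free_pair v w)) (\<Sum>b\<in>S. free_pair b (g b))"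
      using tensor_equiv_sym[OF tensor_equiv_rules(4)] S(4) by (rule tensor_equiv_trans)
    with S(1-3) show ?thesis by (intro exI conjI)
  qed
  have zero: "?P 0"
    by (intro exI[of _ "{}"] exI[of _ "\<lambda>_. 0"]) (simp add: tensor_equiv_refl)
  have sum: "?P (\<Sum>k\<in>K. free_scale (Poly_Mapping.lookup z k) (free_pair (fst k) (snd k)))" for K
    by (induction K rule: infinite_finite_induct) (use zero add scaled in auto)
  have expand: "z = (\<Sum>k\<in>Poly_Mapping.keys z. free_scale (Poly_Mapping.lookup z k) (free_pair (fst k) (snd k)))"
  proof (rule poly_mapping_eqI)
    fix l
    have "Poly_Mapping.lookup (\<Sum>k\<in>K. free_scale (Poly_Mapping.lookup z k) (free_pair (fst k) (snd k))) l =
        (\<Sum>k\<in>K. if k = l then Poly_Mapping.lookup z l else 0)" for K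
      by (induction K rule: infinite_finite_induct)
        (auto simp: lookup_add lookup_free_scale free_pair_def lookup_single when_def)
    then show "Poly_Mapping.lookup z l = Poly_Mapping.lookup
        (\<Sum>k\<in>Poly_Mapping.keys z. free_scale (Poly_Mapping.lookup z k) (free_pair (fst k) (snd k))) l"
      by (simp add: in_keys_iff)
  qed
  have "?P z" using sum[of "Poly_Mapping.keys z"] unfolding expand[symmetric] .
  then obtain S g where "finite S" "S \<subseteq> Bs" "tensor_equiv z (\<Sum>b\<in>S. free_pair b (g b))"
    by (elim exE conjE)
  then show ?thesis by (intro exI conjI)
qed

end

section \<open>The submodule generated by a joint highest weight vector\<close>

lemma adjoint_adjoint_exp [simp]: "adjoint_exp (adjoint_exp x) = x"
  by (induction x) auto

lemma act_glp_glmn_commute: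
  assumes x: "units_in p x" and y: "units_in (m + n) y"
  shows "act sscale (glp_action m n) x (act sscale (glmn_action p m) y f) =
    act sscale (glmn_action p m) y (act sscale (glp_action m n) x f)"
proof -
  have unit: "glp_action m n i j (act sscale (glmn_action p m) y f) =
      act sscale (glmn_action p m) y (glp_action m n i j f)"
    if "i \<in> {1..p}" "j \<in> {1..p}" for i j f
    using y that
    by (induction y arbitrary: f)
      (simp_all add: glp_glmn_commute slinear_rules slinearD[OF slinear_glp[OF slinear_id]])
  show ?thesis
    using x
    by (induction x arbitrary: f)
      (simp_all add: unit glmn.act_scale[OF y] glmn.act_add[OF y])
qed

lemma superpolys_parity_closed:
  "f \<in> superpolys_parity p m n s \<Longrightarrow> sscale c f \<in> superpolys_parity p m n s"
  "f \<in> superpolys_parity p m n s \<Longrightarrow> g \<in> superpolys_parity p m n s \<Longrightarrow> f + g \<in> superpolys_parity p m n s"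
  by (simp_all add: superpolys_parity_eq supp_in_sscale supp_in_add)

lemma act_glp_parity:
  "units_in p x \<Longrightarrow> f \<in> superpolys_parity p m n s \<Longrightarrow> act sscale (glp_action m n) x f \<in> superpolys_parity p m n s"
  by (induction x arbitrary: f) (auto intro: glp_parity superpolys_parity_closed)

lemma act_glp_superpolys:
  "units_in p x \<Longrightarrow> f \<in> superpolys p m n \<Longrightarrow> act sscale (glp_action m n) x f \<in> superpolys p m n"
  by (induction x arbitrary: f) (auto intro: superpolys_closed superpolys_glp)

lemma act_glmn_superpolys:
  "units_in (m + n) y \<Longrightarrow> f \<in> superpolys p m n \<Longrightarrow> act sscale (glmn_action p m) y f \<in> superpolys p m n"
  by (induction y arbitrary: f) (auto intro: superpolys_closed superpolys_glmn)

lemma (in gl_supermodule) graded_disjoint: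
  assumes "v \<in> G s" "v \<in> G (\<not> s)"
  shows "v = 0"
proof -
  have "v \<in> G False" "v \<in> G True" using assms by (cases s; simp)+
  then show ?thesis
    using direct_sum[of v] subspace_0[OF subspace_G, of False] subspace_0[OF subspace_G, of True] by auto
qed

lemma (in embedded_comparison) act_eq_iff:
  assumes "units x" "units y"
  shows "actV x v\<^sub>0 = actV y v\<^sub>0 \<longleftrightarrow> actU x f\<^sub>0 = actU y f\<^sub>0"
  using act_eq_0_iff[of "Plus x (Times (Const (- 1)) y)"] assms
  by (simp add: eq_neg_iff_add_eq_0)

lemma (in embedded_comparison) exists_linear_combination:
  assumes "finite S" "\<And>b. b \<in> S \<Longrightarrow> units (x b)"
  shows "\<exists>X. units X \<and> actV X v\<^sub>0 = (\<Sum>b\<in>S. scale (c b) (actV (x b) v\<^sub>0)) \<and>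
    actU X f\<^sub>0 = (\<Sum>b\<in>S. sscale (c b) (actU (x b) f\<^sub>0))"
  using assms
proof (induction S)
  case empty
  then show ?case by (intro exI[of _ "Const 0"]) simp
next
  case (insert b S)
  then obtain X where "units X" "actV X v\<^sub>0 = (\<Sum>b\<in>S. scale (c b) (actV (x b) v\<^sub>0))"
    "actU X f\<^sub>0 = (\<Sum>b\<in>S. sscale (c b) (actU (x b) f\<^sub>0))" by auto
  then show ?case using insert
    by (intro exI[of _ "Plus (Times (Const (c b)) (x b)) X"]) simp
qed

text \<open>In the embedding, the vector \<open>f\<^sub>0\<close> takes the place of \<open>v\<^sub>0 \<otimes> w\<^sub>0\<close>.\<close>

locale joint_embedding =
  V: embedded_comparison sV p 0 even_grading \<rho>V "glp_action m n" lam v\<^sub>0 f\<^sub>0 p m n False t\<^sub>0 +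
  W: embedded_comparison sW m n GW \<rho>W "glmn_action p m" \<nu> w\<^sub>0 f\<^sub>0 p m n s\<^sub>0 t\<^sub>0
  for sV :: "complex \<Rightarrow> 'v::ab_group_add \<Rightarrow> 'v" and p and \<rho>V and m n :: nat and lam v\<^sub>0 f\<^sub>0 t\<^sub>0
    and sW :: "complex \<Rightarrow> 'w::ab_group_add \<Rightarrow> 'w" and GW \<rho>W \<nu> w\<^sub>0 s\<^sub>0
begin

abbreviation actP :: "uexp \<Rightarrow> superpoly \<Rightarrow> superpoly" where "actP \<equiv> act sscale (glp_action m n)"
abbreviation actM :: "uexp \<Rightarrow> superpoly \<Rightarrow> superpoly" where "actM \<equiv> act sscale (glmn_action p m)"

lemma actP_actM: "units_in p x \<Longrightarrow> units_in (m + n) y \<Longrightarrow> actP x (actM y f) = actM y (actP x f)"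
  by (rule act_glp_glmn_commute)

definition repV :: "'v \<Rightarrow> uexp" where
  "repV v = (SOME x. units_in p x \<and> act sV \<rho>V x v\<^sub>0 = v)"

definition repW :: "'w \<Rightarrow> uexp" where
  "repW w = (SOME y. units_in (m + n) y \<and> act sW \<rho>W y w\<^sub>0 = w)"

definition embed :: "'v \<Rightarrow> 'w \<Rightarrow> superpoly" where
  "embed v w = actP (repV v) (actM (repW w) f\<^sub>0)"

lemma repV: "units_in p (repV v)" "act sV \<rho>V (repV v) v\<^sub>0 = v"
  using someI_ex[OF V.act_generates[of v]] by (simp_all add: repV_def)

lemma repW: "units_in (m + n) (repW w)" "act sW \<rho>W (repW w) w\<^sub>0 = w"
  using someI_ex[OF W.act_generates[of w]] by (simp_all add: repW_def)

text \<open>The value does not depend on the chosen representatives, since the two actions commute.\<close>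

lemma embed_act:
  assumes x: "units_in p x" and y: "units_in (m + n) y"
  shows "embed (act sV \<rho>V x v\<^sub>0) (act sW \<rho>W y w\<^sub>0) = actP x (actM y f\<^sub>0)"
proof -
  let ?v = "act sV \<rho>V x v\<^sub>0" and ?w = "act sW \<rho>W y w\<^sub>0"
  have "actM (repW ?w) f\<^sub>0 = actM y f\<^sub>0"
    using W.act_eq_iff[of "repW ?w" y] repW[of ?w] y by simp
  moreover have "actP (repV ?v) f\<^sub>0 = actP x f\<^sub>0"
    using V.act_eq_iff[of "repV ?v" x] repV[of ?v] x by simp
  ultimately show ?thesis
    using x y repV(1) by (simp add: embed_def actP_actM)
qed

lemma bilinear_embed: "bilinear_map sV sW sscale embed"
  unfolding bilinear_map_def
proof (intro conjI allI)
  fix v v' w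
  have "embed (act sV \<rho>V (Plus (repV v) (repV v')) v\<^sub>0) (act sW \<rho>W (repW w) w\<^sub>0) =
      actP (Plus (repV v) (repV v')) (actM (repW w) f\<^sub>0)"
    by (rule embed_act) (simp_all add: repV repW)
  then show "embed (v + v') w = embed v w + embed v' w" by (simp add: repV repW embed_def)
next
  fix v w w'
  have "embed (act sV \<rho>V (repV v) v\<^sub>0) (act sW \<rho>W (Plus (repW w) (repW w')) w\<^sub>0) =
      actP (repV v) (actM (Plus (repW w) (repW w')) f\<^sub>0)"
    by (rule embed_act) (simp_all add: repV repW)
  then show "embed v (w + w') = embed v w + embed v w'"
    using V.U.act_add[of "repV v"] by (simp add: repV repW embed_def)
next
  fix c v w
  have "embed (act sV \<rho>V (Times (Const c) (repV v)) v\<^sub>0) (act sW \<rho>W (repW w) w\<^sub>0) =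
      actP (Times (Const c) (repV v)) (actM (repW w) f\<^sub>0)"
    by (rule embed_act) (simp_all add: repV repW)
  then show "embed (sV c v) w = sscale c (embed v w)" by (simp add: repV repW embed_def)
next
  fix c v w
  have "embed (act sV \<rho>V (repV v) v\<^sub>0) (act sW \<rho>W (Times (Const c) (repW w)) w\<^sub>0) =
      actP (repV v) (actM (Times (Const c) (repW w)) f\<^sub>0)"
    by (rule embed_act) (simp_all add: repV repW)
  then show "embed v (sW c w) = sscale c (embed v w)"
    using V.U.act_scale[of "repV v"] by (simp add: repV repW embed_def)
qed

lemma embed_glp:
  assumes "i \<in> {1..p}" "j \<in> {1..p}"
  shows "embed (\<rho>V i j v) w = glp_action m n i j (embed v w)"
proof -
  have "embed (act sV \<rho>V (Times (Unit i j) (repV v)) v\<^sub>0) (act sW \<rho>W (repW w) w\<^sub>0) =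
      actP (Times (Unit i j) (repV v)) (actM (repW w) f\<^sub>0)"
    by (rule embed_act) (use assms in \<open>simp_all add: repV repW\<close>)
  then show ?thesis by (simp add: repV repW embed_def)
qed

lemma embed_glmn:
  assumes "a \<in> {1..m + n}" "b \<in> {1..m + n}"
  shows "embed v (\<rho>W a b w) = glmn_action p m a b (embed v w)"
proof -
  have "embed (act sV \<rho>V (repV v) v\<^sub>0) (act sW \<rho>W (Times (Unit a b) (repW w)) w\<^sub>0) =
      actP (repV v) (actM (Times (Unit a b) (repW w)) f\<^sub>0)"
    by (rule embed_act) (use assms in \<open>simp_all add: repV repW\<close>)
  also have "\<dots> = actM (Unit a b) (actP (repV v) (actM (repW w) f\<^sub>0))"
    using actP_actM[OF repV(1), of "Unit a b" v "actM (repW w) f\<^sub>0"] assms by simp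
  finally show ?thesis by (simp add: repV repW embed_def)
qed

text \<open>If \<open>y w\<^sub>0\<close> is homogeneous, \<open>y\<close> can be replaced by its homogeneous part of the appropriate parity, which
  changes the parity of \<open>f\<^sub>0\<close> in the same way as that of \<open>w\<^sub>0\<close>. Expressions in \<open>gl(p)\<close> preserve parity.\<close>

lemma embed_parity:
  assumes "w \<in> GW s"
  shows "embed v w \<in> superpolys_parity p m n (s \<noteq> (s\<^sub>0 \<noteq> t\<^sub>0))"
proof -
  let ?\<tau> = "s\<^sub>0 \<noteq> s"
  let ?y = "parity_part m ?\<tau> (repW w)" and ?y' = "parity_part m (\<not> ?\<tau>) (repW w)"
  have y: "act sW \<rho>W ?y w\<^sub>0 \<in> GW (s\<^sub>0 \<noteq> ?\<tau>)" "act sW \<rho>W ?y' w\<^sub>0 \<in> GW (s\<^sub>0 \<noteq> (\<not> ?\<tau>))"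
    by (rule W.actV_parity_part[OF repW(1) W.v0_parity])+
  have par: "(s\<^sub>0 \<noteq> ?\<tau>) = s" "(s\<^sub>0 \<noteq> (\<not> ?\<tau>)) = (\<not> s)" "(t\<^sub>0 \<noteq> ?\<tau>) = (s \<noteq> (s\<^sub>0 \<noteq> t\<^sub>0))" by auto
  have w: "w = act sW \<rho>W ?y w\<^sub>0 + act sW \<rho>W ?y' w\<^sub>0"
    using W.rep.act_parity_parts[OF repW(1), of w w\<^sub>0] repW(2)[of w]
    by (cases s\<^sub>0; cases s) (simp_all add: add.commute)
  then have "act sW \<rho>W ?y' w\<^sub>0 = w - act sW \<rho>W ?y w\<^sub>0" by (simp add: algebra_simps)
  then have "act sW \<rho>W ?y' w\<^sub>0 \<in> GW s"
    using W.subspace_diff[OF W.subspace_G assms] y(1)[unfolded par(1)] by (simp only:)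
  moreover have "act sW \<rho>W ?y' w\<^sub>0 \<in> GW (\<not> s)" using y(2)[unfolded par(2)] .
  ultimately have "act sW \<rho>W ?y' w\<^sub>0 = 0" by (rule W.graded_disjoint)
  then have w': "w = act sW \<rho>W ?y w\<^sub>0" using w by simp
  have "embed v w = actP (repV v) (actM ?y f\<^sub>0)"
    using embed_act[OF repV(1)[of v] units_in_parity_part[OF repW(1)[of w], where s = ?\<tau> and M = m]]
    unfolding w'[symmetric] repV(2) .
  moreover have "actM ?y f\<^sub>0 \<in> superpolys_parity p m n (s \<noteq> (s\<^sub>0 \<noteq> t\<^sub>0))"
    using W.actU_parity_part[OF repW(1) W.f0_parity, of ?\<tau> w] unfolding par(3) .
  ultimately show ?thesis using act_glp_parity[OF repV(1)] by simp
qed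

text \<open>On the submodule generated by \<open>f\<^sub>0\<close>, the Hermitian form is the tensor product of the forms on the
  two submodules generated by \<open>f\<^sub>0\<close> under \<open>gl(p)\<close> and under \<open>gl(m|n)\<close>. Indeed, everything reduces to the
  product of \<open>P f\<^sub>0\<close> and \<open>Q\<^sup>* f\<^sub>0\<close>, where \<open>P\<close> and \<open>Q\<close> come from the two algebras. The lower weight part of \<open>P f\<^sub>0\<close>
  is orthogonal to \<open>Q\<^sup>* f\<^sub>0\<close>, which is killed by the positive root vectors of \<open>gl(p)\<close> like \<open>f\<^sub>0\<close> itself.\<close>

lemma hform_factors:
  assumes x: "units_in p x" "units_in p x'" and y: "units_in (m + n) y" "units_in (m + n) y'"
  shows "hform (actP x (actM y f\<^sub>0)) (actP x' (actM y' f\<^sub>0)) * hform f\<^sub>0 f\<^sub>0 =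
    hform (actP x f\<^sub>0) (actP x' f\<^sub>0) * hform (actM y f\<^sub>0) (actM y' f\<^sub>0)"
proof -
  let ?P = "Times (adjoint_exp x') x" and ?Q = "Times (adjoint_exp y') y"
  have PQ: "units_in p ?P" "units_in (m + n) ?Q" using x y by simp_all
  have adjP: "hform f (actP z g) = hform (actP (adjoint_exp z) f) g" if "units_in p z" for z f g
    using V.act_adjoint[of "adjoint_exp z" f g] that by simp
  have adjM: "hform f (actM z g) = hform (actM (adjoint_exp z) f) g" if "units_in (m + n) z" for z f g
    using W.act_adjoint[of "adjoint_exp z" f g] that by simp
  obtain c where c: "actP ?P f\<^sub>0 - sscale c f\<^sub>0 \<in> superpoly.span (V.U.lowered f\<^sub>0)"
    using V.U.act_highest[OF V.hwU, of ?P] PQ by auto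
  define s where "s = actP ?P f\<^sub>0 - sscale c f\<^sub>0"
  have P: "actP ?P f\<^sub>0 = sscale c f\<^sub>0 + s" by (simp add: s_def)
  have orth: "hform s (actM z f\<^sub>0) = 0" if z: "units_in (m + n) z" for z
  proof (rule V.lowered_orthogonal)
    show "s \<in> superpoly.span (V.U.lowered f\<^sub>0)" using c s_def by simp
    fix a b assume ab: "a \<in> {1..p + 0}" "b \<in> {1..p + 0}" "a < b"
    then have "glp_action m n a b f\<^sub>0 = 0" using V.U.highest_weight_raising[OF V.hwU] by blast
    then show "glp_action m n a b (actM z f\<^sub>0) = 0"
      using actP_actM[of "Unit a b" z f\<^sub>0] ab z W.U.act_0[of z] by simp
  qed
  have "hform (actP x (actM y f\<^sub>0)) (actP x' (actM y' f\<^sub>0)) = hform (actP ?P (actM ?Q f\<^sub>0)) f\<^sub>0"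
    using x y by (simp add: adjP adjM actP_actM)
  also have "actP ?P (actM ?Q f\<^sub>0) = actM ?Q (sscale c f\<^sub>0 + s)"
    by (simp only: actP_actM[OF PQ] P)
  also have "\<dots> = sscale c (actM ?Q f\<^sub>0) + actM ?Q s"
    using W.U.act_add[OF PQ(2)] W.U.act_scale[OF PQ(2)] by simp
  also have "hform \<dots> f\<^sub>0 = c * hform (actM ?Q f\<^sub>0) f\<^sub>0 + hform s (actM (adjoint_exp ?Q) f\<^sub>0)"
    using W.act_adjoint[OF PQ(2), of s f\<^sub>0] by (simp only: hform_add_left hform_sscale_left)
  also have "hform s (actM (adjoint_exp ?Q) f\<^sub>0) = 0"
    using PQ by (intro orth) simp
  finally have 1: "hform (actP x (actM y f\<^sub>0)) (actP x' (actM y' f\<^sub>0)) = c * hform (actM ?Q f\<^sub>0) f\<^sub>0"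
    by simp
  have "hform (actP x f\<^sub>0) (actP x' f\<^sub>0) = hform (actP ?P f\<^sub>0) f\<^sub>0"
    using x by (simp add: adjP)
  also have "\<dots> = c * hform f\<^sub>0 f\<^sub>0"
    using orth[of "Const 1"] by (simp only: P hform_add_left hform_sscale_left) simp
  finally have 2: "hform (actP x f\<^sub>0) (actP x' f\<^sub>0) = c * hform f\<^sub>0 f\<^sub>0" .
  have "hform (actM y f\<^sub>0) (actM y' f\<^sub>0) = hform (actM ?Q f\<^sub>0) f\<^sub>0"
    using y by (simp add: adjM)
  then show ?thesis using 1 2 by simp
qed

text \<open>Take the product of the sum with \<open>x' y' f\<^sub>0\<close>. Up to the square of the norm of \<open>f\<^sub>0\<close>, the factorization shows
  that it is \<open>\<Sum>\<^sub>b \<kappa>\<^sub>b \<langle>x\<^sub>b f\<^sub>0, x' f\<^sub>0\<rangle>\<close>, where \<open>b = x\<^sub>b v\<^sub>0\<close> and the numbers \<open>\<kappa>\<^sub>b\<close> depend on \<open>y'\<close>. With \<open>x' = \<Sum>\<^sub>b \<kappa>\<^sub>b x\<^sub>b\<close> this is the square of the norm of \<open>x' f\<^sub>0\<close>. So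
  \<open>x' v\<^sub>0 = 0\<close>, and \<open>\<kappa>\<^sub>b = 0\<close> for all \<open>b\<close> and all \<open>y'\<close>.\<close>

lemma embed_independent:
  assumes Bs: "V.independent Bs" "finite S" "S \<subseteq> Bs" and zero: "(\<Sum>b\<in>S. embed b (g b)) = 0"
    and b: "b \<in> S"
  shows "g b = 0"
proof -
  have f0: "hform f\<^sub>0 f\<^sub>0 \<noteq> 0"
    using hform_self_eq_0[of f\<^sub>0] V.hwU by (auto simp: highest_weight_vector_def)
  have coeff_0: "hform (actM (repW (g b)) f\<^sub>0) (actM y' f\<^sub>0) = 0" if y': "units_in (m + n) y'" for y'
  proof -
    define \<kappa> where "\<kappa> b = hform (actM (repW (g b)) f\<^sub>0) (actM y' f\<^sub>0)" for b
    obtain X where X: "units_in p X" "act sV \<rho>V X v\<^sub>0 = (\<Sum>b\<in>S. sV (\<kappa> b) (act sV \<rho>V (repV b) v\<^sub>0))"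
      "actP X f\<^sub>0 = (\<Sum>b\<in>S. sscale (\<kappa> b) (actP (repV b) f\<^sub>0))"
      using V.exists_linear_combination[OF Bs(2), of repV \<kappa>] repV(1) by auto
    have "hform (actP X f\<^sub>0) (actP X f\<^sub>0) = (\<Sum>b\<in>S. \<kappa> b * hform (actP (repV b) f\<^sub>0) (actP X f\<^sub>0))"
      by (subst (1) X(3)) (simp add: hform_sum_left hform_sscale_left)
    also have "\<dots> = (\<Sum>b\<in>S. hform (embed b (g b)) (actP X (actM y' f\<^sub>0)) * hform f\<^sub>0 f\<^sub>0)"
      unfolding embed_def \<kappa>_def
      by (simp add: hform_factors[OF repV(1) X(1) repW(1) y']) (simp add: mult.commute)
    also have "\<dots> = hform (\<Sum>b\<in>S. embed b (g b)) (actP X (actM y' f\<^sub>0)) * hform f\<^sub>0 f\<^sub>0"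
      by (simp add: hform_sum_left sum_distrib_right)
    finally have "hform (actP X f\<^sub>0) (actP X f\<^sub>0) = 0" by (simp add: zero)
    then have "actP X f\<^sub>0 = 0" by (rule hform_self_eq_0)
    then have "act sV \<rho>V X v\<^sub>0 = 0" using V.act_eq_0_iff[of X] X(1) by simp
    then have "(\<Sum>b\<in>S. sV (\<kappa> b) b) = 0" using X(2) by (simp add: repV)
    then have "\<kappa> b = 0"
      using Bs b unfolding V.independent_explicit_finite_subsets by blast
    then show ?thesis by (simp add: \<kappa>_def)
  qed
  have "actM (repW (g b)) f\<^sub>0 = 0"
    by (rule hform_self_eq_0[OF coeff_0[OF repW(1)]])
  then have "act sW \<rho>W (repW (g b)) w\<^sub>0 = 0"
    using W.act_eq_0_iff[of "repW (g b)"] repW(1) by simp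
  then show ?thesis by (simp add: repW)
qed

lemma tensor_appears_embed: "tensor_appears p m n sV \<rho>V sW GW \<rho>W"
proof -
  let ?\<Phi> = "free_extend sscale embed"
  note sV = V.vector_space_axioms and sW = W.vector_space_axioms
  note lin = linear_free_extend[OF vector_space_superpoly, of embed]
  note pair = free_extend_pair[OF vector_space_superpoly, of embed]
  have f0: "f\<^sub>0 \<in> superpolys p m n" using V.f0_parity by (rule superpolys_parity_subset)
  have range: "range ?\<Phi> \<subseteq> superpolys p m n"
    unfolding free_extend_def embed_def using f0 repV(1) repW(1)
    by (auto intro!: superpolys_sum superpolys_closed act_glp_superpolys act_glmn_superpolys)
  have "{z. ?\<Phi> z = 0} = tensor_relations sV sW"
  proof
    show "tensor_relations sV sW \<subseteq> {z. ?\<Phi> z = 0}"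
      using bilinear_kills_tensor_relations[OF vector_space_superpoly bilinear_embed] by blast
    show "{z. ?\<Phi> z = 0} \<subseteq> tensor_relations sV sW"
    proof
      fix z assume "z \<in> {z. ?\<Phi> z = 0}"
      then have z: "?\<Phi> z = 0" by simp
      obtain Bs where Bs: "V.independent Bs" "V.span Bs = UNIV"
        using V.maximal_independent_subset[of UNIV] by (metis top.extremum_unique)
      obtain S g where S: "finite S" "S \<subseteq> Bs" "tensor_equiv sV sW z (\<Sum>b\<in>S. free_pair b (g b))"
        using tensor_basis_expansion[OF sV sW Bs(2)] by blast
      have "?\<Phi> (z - (\<Sum>b\<in>S. free_pair b (g b))) = 0"
        using S(3) bilinear_kills_tensor_relations[OF vector_space_superpoly bilinear_embed]
        by (simp add: tensor_equiv_def[OF sV sW])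
      then have "(\<Sum>b\<in>S. embed b (g b)) = 0"
        by (simp add: linear_props[OF lin] pair z)
      then have "g b = 0" if "b \<in> S" for b
        using embed_independent[OF Bs(1) S(1,2)] that by blast
      then have "tensor_equiv sV sW (\<Sum>b\<in>S. free_pair b (g b)) (\<Sum>b\<in>S. 0)"
        by (intro tensor_equiv_sum[OF sV sW]) (simp add: free_pair_zero_right[OF sV sW])
      then have "tensor_equiv sV sW z 0"
        using tensor_equiv_trans[OF sV sW S(3)] by simp
      then show "z \<in> tensor_relations sV sW" by (simp add: tensor_equiv_def[OF sV sW])
    qed
  qed
  then show ?thesis
    unfolding tensor_appears_def using lin range embed_glp embed_glmn embed_parity
    by (intro exI[of _ ?\<Phi>] conjI exI[of _ "s\<^sub>0 \<noteq> t\<^sub>0"]) (auto simp: pair)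
qed

end

section \<open>Joint highest weight vectors and occurrence of tensor products\<close>

lemma young_diagram_hook_column:
  assumes "young_diagram lam"
  obtains r t where "lam 1 = of_nat t" "r = 0 \<or> m < transpose_diagram lam r"
    "transpose_diagram lam (r + 1) \<le> m"
proof -
  obtain L where L: "row_lengths lam L" by (rule young_diagram_row_lengths[OF assms])
  note iff = le_transpose_iff[OF L, of "m + 1"]
  have "L (m + 1) = 0 \<or> m < transpose_diagram lam (L (m + 1))"
    using iff[of "L (m + 1)"] by (cases "L (m + 1) = 0") auto
  then show ?thesis
    using iff[of "L (m + 1) + 1"] row_lengthsD(1)[OF L, of 1] by (intro that[of "L 1" "L (m + 1)"]) auto
qed

text \<open>The matrix units are homogeneous, so both components of a highest weight vector satisfy the defining
  equations; one of them is not zero.\<close>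

lemma (in gl_supermodule) homogeneous_highest_weight_vector:
  assumes "highest_weight_vector scale (M + N) \<rho> \<mu> v"
  obtains s u where "u \<in> G s" "highest_weight_vector scale (M + N) \<rho> \<mu> u"
proof -
  obtain u where u: "u \<in> G False" "v - u \<in> G True" using direct_sum[of v] by blast
  have split: "x = 0 \<and> y = 0" if "x \<in> G s" "y \<in> G (\<not> s)" "x + y = 0" for x y s
  proof -
    have "y = - x" using that(3) by (metis add.inverse_unique)
    then have "y \<in> G s" using subspace_neg[OF subspace_G that(1)] by simp
    then have "y = 0" using graded_disjoint that(2) by blast
    then show ?thesis using that(3) by simp
  qed
  have parts: "\<rho> a b u = scale c u \<and> \<rho> a b (v - u) = scale c (v - u)"
    if ab: "a \<in> {1..M + N}" "b \<in> {1..M + N}" and eq: "\<rho> a b v = scale c v" and c: "c = 0 \<or> a = b" for a b c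
  proof -
    have sum: "(\<rho> a b u - scale c u) + (\<rho> a b (v - u) - scale c (v - u)) = 0"
      using eq rep.rho_add[OF ab, of u "v - u"] scale_right_distrib[of c u "v - u"]
      by (simp add: algebra_simps)
    have mem: "\<rho> a b u \<in> G (False \<noteq> ((M < a) \<noteq> (M < b)))" "\<rho> a b (v - u) \<in> G (True \<noteq> ((M < a) \<noteq> (M < b)))"
      using parity_action[OF ab] u by blast+
    have sc: "scale c u \<in> G (False \<noteq> ((M < a) \<noteq> (M < b)))" "scale c (v - u) \<in> G (True \<noteq> ((M < a) \<noteq> (M < b)))"
      using c u subspace_scale[OF subspace_G] subspace_0[OF subspace_G] by auto
    have "\<rho> a b u - scale c u \<in> G (False \<noteq> ((M < a) \<noteq> (M < b)))"
      using subspace_diff[OF subspace_G mem(1) sc(1)] .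
    moreover have "\<rho> a b (v - u) - scale c (v - u) \<in> G (True \<noteq> ((M < a) \<noteq> (M < b)))"
      using subspace_diff[OF subspace_G mem(2) sc(2)] .
    moreover have "(True \<noteq> ((M < a) \<noteq> (M < b))) = (\<not> (False \<noteq> ((M < a) \<noteq> (M < b))))" by simp
    ultimately have "\<rho> a b u - scale c u = 0 \<and> \<rho> a b (v - u) - scale c (v - u) = 0"
      using split[OF _ _ sum] by (simp only:)
    then show ?thesis by simp
  qed
  have hw: "highest_weight_vector scale (M + N) \<rho> \<mu> x" if "x \<noteq> 0" "x = u \<or> x = v - u" for x
    unfolding highest_weight_vector_def
  proof (intro conjI ballI)
    show "x \<noteq> 0" by fact
    show "\<rho> a a x = scale (\<mu> a) x" if a: "a \<in> {1..M + N}" for a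
      using parts[OF a a, of "\<mu> a"] assms a \<open>x = u \<or> x = v - u\<close> by (auto simp: highest_weight_vector_def)
    show "\<rho> (a - 1) a x = 0" if a: "a \<in> {2..M + N}" for a
    proof -
      have "a - 1 \<in> {1..M + N}" "a \<in> {1..M + N}" using a by auto
      moreover have "\<rho> (a - 1) a v = scale 0 v"
        using assms a unfolding highest_weight_vector_def by simp
      ultimately show ?thesis using parts[of "a - 1" a 0] \<open>x = u \<or> x = v - u\<close> by auto
    qed
  qed
  have "v \<noteq> 0" using assms by (simp add: highest_weight_vector_def)
  then have "u \<noteq> 0 \<or> v - u \<noteq> 0" by auto
  then show ?thesis using hw u that by blast
qed

text \<open>The number of odd variables in a monomial is the sum of its \<open>n\<close> odd weights, which is the same for all
  monomials of \<open>f\<close>.\<close>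

lemma joint_highest_weight_parity:
  assumes "joint_highest_weight_vector p m n lam f"
  obtains t where "f \<in> superpolys_parity p m n t"
proof -
  have f: "f \<in> superpolys p m n" and "f \<noteq> 0"
    and w: "\<And>a. a \<in> {1..m + n} \<Longrightarrow> glmn_action p m a a f = sscale (glmn_weight m lam a) f"
    using assms by (auto simp: joint_highest_weight_vector_def highest_weight_vector_def)
  have card: "of_nat (fcard A) = (\<Sum>k = 1..n. glmn_weight m lam (m + k))" if A: "coeff f (\<alpha>, A) \<noteq> 0" for \<alpha> A
  proof -
    have "in_vars p m n (\<alpha>, A)"
      using f A unfolding superpolys_eq supp_in_def by blast
    then have vars: "fset A \<subseteq> {1..p} \<times> {1..n}" by (simp add: in_vars_def)
    have "(\<Sum>k = 1..n. glmn_weight m lam (m + k)) = (\<Sum>k = 1..n. of_nat (card {i \<in> {1..p}. (i, k) |\<in>| A}))"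
    proof (intro sum.cong refl)
      fix k assume k: "k \<in> {1..n}"
      have "glmn_weight m lam (m + k) = of_nat (\<Sum>j = 1..p. zdegree m (m + k) j (\<alpha>, A))"
        using k by (intro glmn_weight_monomial[OF w A]) auto
      also have "(\<Sum>j = 1..p. zdegree m (m + k) j (\<alpha>, A)) = (\<Sum>j = 1..p. if (j, k) |\<in>| A then 1 else 0)"
        using k by (intro sum.cong) (auto simp: zdegree_def)
      also have "\<dots> = card {i \<in> {1..p}. (i, k) |\<in>| A}"
        by (simp add: sum.If_cases Int_def)
      finally show "glmn_weight m lam (m + k) = of_nat (card {i \<in> {1..p}. (i, k) |\<in>| A})" .
    qed
    also have "\<dots> = of_nat (card (SIGMA k:{1..n}. {i \<in> {1..p}. (i, k) |\<in>| A}))"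
      by (subst card_SigmaI) auto
    also have "card (SIGMA k:{1..n}. {i \<in> {1..p}. (i, k) |\<in>| A}) = card (fset A)"
      by (rule bij_betw_same_card[of "\<lambda>(k, i). (i, k)"])
        (use vars in \<open>auto simp: bij_betw_def inj_on_def image_def\<close>)
    finally show ?thesis by (simp add: fcard.rep_eq)
  qed
  obtain \<alpha>\<^sub>0 A\<^sub>0 where "coeff f (\<alpha>\<^sub>0, A\<^sub>0) \<noteq> 0"
    using \<open>f \<noteq> 0\<close> superpoly_eqI[of f 0] by (metis coeff_simps(1) surj_pair)
  then have "fcard A = fcard A\<^sub>0" if "coeff f (\<alpha>, A) \<noteq> 0" for \<alpha> A
    using card[OF that] card[of \<alpha>\<^sub>0 A\<^sub>0] by (metis of_nat_eq_iff)
  then have "f \<in> superpolys_parity p m n (odd (fcard A\<^sub>0))"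
    using f by (auto simp: superpolys_parity_eq superpolys_eq supp_in_def)
  then show ?thesis by (rule that)
qed

lemma tensor_appears_if_joint_highest_weight:
  assumes V: "irreducible_highest_weight_module sV p 0 even_grading \<rho>V lam"
    and W: "irreducible_highest_weight_module sW m n GW \<rho>W (glmn_weight m lam)"
    and f: "joint_highest_weight_vector p m n lam f"
  shows "tensor_appears p m n sV \<rho>V sW GW \<rho>W"
proof -
  interpret V: irreducible_gl_supermodule sV p 0 even_grading \<rho>V
    using V by (simp add: irreducible_highest_weight_module_def)
  interpret W: irreducible_gl_supermodule sW m n GW \<rho>W
    using W by (simp add: irreducible_highest_weight_module_def)
  obtain v\<^sub>0 where v0: "highest_weight_vector sV (p + 0) \<rho>V lam v\<^sub>0"
    using V by (auto simp: irreducible_highest_weight_module_def)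
  obtain w where "highest_weight_vector sW (m + n) \<rho>W (glmn_weight m lam) w"
    using W by (auto simp: irreducible_highest_weight_module_def)
  then obtain s\<^sub>0 w\<^sub>0 where w0: "w\<^sub>0 \<in> GW s\<^sub>0" "highest_weight_vector sW (m + n) \<rho>W (glmn_weight m lam) w\<^sub>0"
    by (rule W.homogeneous_highest_weight_vector)
  obtain t\<^sub>0 where t0: "f \<in> superpolys_parity p m n t\<^sub>0"
    by (rule joint_highest_weight_parity[OF f])
  have hw: "highest_weight_vector sscale (p + 0) (glp_action m n) lam f"
    "highest_weight_vector sscale (m + n) (glmn_action p m) (glmn_weight m lam) f"
    using f by (simp_all add: joint_highest_weight_vector_def)
  interpret glp': gl_rep sscale p "p + 0" "glp_action m n"
    using glp.gl_rep_axioms[of p m n] by simp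
  interpret joint_embedding sV p \<rho>V m n lam v\<^sub>0 f t\<^sub>0 sW GW \<rho>W "glmn_weight m lam" w\<^sub>0 s\<^sub>0
  proof (intro joint_embedding.intro embedded_comparison.intro embedded_comparison_axioms.intro
      V.irreducible_gl_supermodule_axioms W.irreducible_gl_supermodule_axioms
      glp'.gl_rep_axioms glmn.gl_rep_axioms v0 w0 t0 hw)
    show "v\<^sub>0 \<in> even_grading False" by (simp add: even_grading_def)
  next
    fix a b g s assume "a \<in> {1..p + 0}" "b \<in> {1..p + 0}" "g \<in> superpolys_parity p m n s"
    then show "glp_action m n a b g \<in> superpolys_parity p m n (s \<noteq> gl_odd p a b)"
      using glp_parity[of g p m n s a b] by (simp add: gl_odd_def)
  next
    fix a b g s assume "a \<in> {1..m + n}" "b \<in> {1..m + n}" "g \<in> superpolys_parity p m n s"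
    then show "glmn_action p m a b g \<in> superpolys_parity p m n (s \<noteq> gl_odd m a b)"
      unfolding gl_odd_def by (intro glmn_parity)
  qed (rule glp_adjoint glmn_adjoint)+
  show ?thesis by (rule tensor_appears_embed)
qed

text \<open>The vector is the image of the tensor product of the two highest weight vectors.\<close>

lemma joint_highest_weight_if_tensor_appears:
  assumes V: "irreducible_highest_weight_module sV p 0 even_grading \<rho>V lam"
    and W: "irreducible_highest_weight_module sW m n GW \<rho>W (glmn_weight m lam)"
    and "tensor_appears p m n sV \<rho>V sW GW \<rho>W"
  obtains f where "joint_highest_weight_vector p m n lam f"
proof -
  interpret V: irreducible_gl_supermodule sV p 0 even_grading \<rho>V
    using V by (simp add: irreducible_highest_weight_module_def)
  interpret W: irreducible_gl_supermodule sW m n GW \<rho>W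
    using W by (simp add: irreducible_highest_weight_module_def)
  note sV = V.vector_space_axioms and sW = W.vector_space_axioms
  obtain v where v: "highest_weight_vector sV p \<rho>V lam v"
    using V by (auto simp: irreducible_highest_weight_module_def)
  obtain w where w: "highest_weight_vector sW (m + n) \<rho>W (glmn_weight m lam) w"
    using W by (auto simp: irreducible_highest_weight_module_def)
  obtain \<Phi> where lin: "Vector_Spaces.linear free_scale sscale \<Phi>" and range: "range \<Phi> \<subseteq> superpolys p m n"
    and ker: "{z. \<Phi> z = 0} = tensor_relations sV sW"
    and glp_all: "\<forall>i\<in>{1..p}. \<forall>j\<in>{1..p}. \<forall>v w.
      \<Phi> (free_pair (\<rho>V i j v) w) = glp_action m n i j (\<Phi> (free_pair v w))"
    and glmn_all: "\<forall>a\<in>{1..m + n}. \<forall>b\<in>{1..m + n}. \<forall>v w.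
      \<Phi> (free_pair v (\<rho>W a b w)) = glmn_action p m a b (\<Phi> (free_pair v w))"
    using assms(3) unfolding tensor_appears_def by (elim exE conjE)
  have glp: "\<Phi> (free_pair (\<rho>V i j v) w) = glp_action m n i j (\<Phi> (free_pair v w))"
    if "i \<in> {1..p}" "j \<in> {1..p}" for i j v w
    using glp_all that by simp
  have glmn: "\<Phi> (free_pair v (\<rho>W a b w)) = glmn_action p m a b (\<Phi> (free_pair v w))"
    if "a \<in> {1..m + n}" "b \<in> {1..m + n}" for a b v w
    using glmn_all that by simp
  note lin = linear_props[OF lin]
  have \<Phi>_rel: "\<Phi> y = \<Phi> z" if "y - z \<in> tensor_relations sV sW" for y z
  proof -
    have "y - z \<in> {z. \<Phi> z = 0}" using that unfolding ker .
    then have "\<Phi> (y - z) = 0" by simp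
    then show ?thesis by (simp add: lin(2))
  qed
  have scale: "\<Phi> (free_pair (sV c x) y) = sscale c (\<Phi> (free_pair x y))"
    "\<Phi> (free_pair x (sW c y)) = sscale c (\<Phi> (free_pair x y))" for c x y
    using \<Phi>_rel[OF tensor_relations_rules(3)] \<Phi>_rel[OF tensor_relations_rules(4)] lin(3) by metis+
  have zero: "\<Phi> (free_pair 0 y) = 0" "\<Phi> (free_pair x 0) = 0" for x y
    using scale(1)[of 0 0 y] scale(2)[of x 0 0] by simp_all
  let ?f = "\<Phi> (free_pair v w)"
  have "v \<noteq> 0" "w \<noteq> 0" using v w by (simp_all add: highest_weight_vector_def)
  then have "?f \<noteq> 0"
    using free_pair_notin_tensor_relations[OF sV sW] ker by blast
  moreover have "glp_action m n a a ?f = sscale (lam a) ?f" if "a \<in> {1..p}" for a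
    using v that glp[OF that that, of v w] by (simp add: highest_weight_vector_def scale)
  moreover have "glp_action m n (a - 1) a ?f = 0" if a: "a \<in> {2..p}" for a
  proof -
    have "a - 1 \<in> {1..p}" "a \<in> {1..p}" "\<rho>V (a - 1) a v = 0"
      using a v unfolding highest_weight_vector_def by auto
    then show ?thesis using glp[of "a - 1" a v w] by (simp add: zero)
  qed
  moreover have "glmn_action p m a a ?f = sscale (glmn_weight m lam a) ?f" if "a \<in> {1..m + n}" for a
    using w that glmn[OF that that, of v w] by (simp add: highest_weight_vector_def scale)
  moreover have "glmn_action p m (a - 1) a ?f = 0" if a: "a \<in> {2..m + n}" for a
  proof -
    have "a - 1 \<in> {1..m + n}" "a \<in> {1..m + n}" "\<rho>W (a - 1) a w = 0"
      using a w unfolding highest_weight_vector_def by auto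
    then show ?thesis using glmn[of "a - 1" a v w] by (simp add: zero)
  qed
  ultimately have "joint_highest_weight_vector p m n lam ?f"
    using range by (auto simp: joint_highest_weight_vector_def highest_weight_vector_def)
  then show ?thesis by (rule that)
qed

theorem theorem4p2:
  fixes p m n :: nat and lam :: "nat \<Rightarrow> complex"
  assumes "m < p"
    and "young_diagram lam \<or> (\<forall>i>p. lam i = 0)"
  shows
    "(\<forall>(sV :: complex \<Rightarrow> 'v::ab_group_add \<Rightarrow> 'v) \<rho>V (sW :: complex \<Rightarrow> 'w::ab_group_add \<Rightarrow> 'w) GW \<rho>W.
        irreducible_highest_weight_module sV p 0 even_grading \<rho>V lam \<longrightarrow>
        irreducible_highest_weight_module sW m n GW \<rho>W (glmn_weight m lam) \<longrightarrow>
        (tensor_appears p m n sV \<rho>V sW GW \<rho>W \<longleftrightarrow>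
          young_diagram lam \<and> diagram_length lam \<le> p \<and> Re (lam (m + 1)) \<le> real n)) \<and>
     (young_diagram lam \<and> diagram_length lam \<le> p \<and> Re (lam (m + 1)) \<le> real n \<longrightarrow>
        (\<forall>r t. lam 1 = of_nat t \<longrightarrow>
          (r = 0 \<or> m < transpose_diagram lam r) \<longrightarrow> transpose_diagram lam (r + 1) \<le> m \<longrightarrow>
          joint_highest_weight_vector p m n lam
            (prod_list (map (\<lambda>k. DeltaOdd m k (transpose_diagram lam k)) [1..<r + 1]) *
             prod_list (map (\<lambda>j. Delta (transpose_diagram lam j)) [r + 1..<t + 1]))))"
proof (intro conjI allI impI)
  fix sV :: "complex \<Rightarrow> 'v \<Rightarrow> 'v" and \<rho>V and sW :: "complex \<Rightarrow> 'w \<Rightarrow> 'w" and GW \<rho>W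
  assume V: "irreducible_highest_weight_module sV p 0 even_grading \<rho>V lam"
    and W: "irreducible_highest_weight_module sW m n GW \<rho>W (glmn_weight m lam)"
  show "tensor_appears p m n sV \<rho>V sW GW \<rho>W \<longleftrightarrow>
      young_diagram lam \<and> diagram_length lam \<le> p \<and> Re (lam (m + 1)) \<le> real n"
  proof
    assume "tensor_appears p m n sV \<rho>V sW GW \<rho>W"
    then show "young_diagram lam \<and> diagram_length lam \<le> p \<and> Re (lam (m + 1)) \<le> real n"
      using joint_highest_weight_if_tensor_appears[OF V W] joint_highest_weight_is_hook[OF assms] by metis
  next
    assume hook: "young_diagram lam \<and> diagram_length lam \<le> p \<and> Re (lam (m + 1)) \<le> real n"
    obtain r t where "lam 1 = of_nat t" "r = 0 \<or> m < transpose_diagram lam r"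
      "transpose_diagram lam (r + 1) \<le> m"
      using young_diagram_hook_column[of lam m] hook by blast
    then show "tensor_appears p m n sV \<rho>V sW GW \<rho>W"
      using tensor_appears_if_joint_highest_weight[OF V W] hook_product_joint_highest_weight[OF assms(1)] hook
      by blast
  qed
next
  fix r t
  assume "young_diagram lam \<and> diagram_length lam \<le> p \<and> Re (lam (m + 1)) \<le> real n"
    "lam 1 = of_nat t" "r = 0 \<or> m < transpose_diagram lam r" "transpose_diagram lam (r + 1) \<le> m"
  then show "joint_highest_weight_vector p m n lam
      (prod_list (map (\<lambda>k. DeltaOdd m k (transpose_diagram lam k)) [1..<r + 1]) *
       prod_list (map (\<lambda>j. Delta (transpose_diagram lam j)) [r + 1..<t + 1]))"
    using hook_product_joint_highest_weight[OF assms(1)] by blast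
qed

end
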